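(* Let $q\ge3$ and $\mathfrak g=\mathfrak{so}(2,q)=\mathfrak k\oplus\mathfrak p$. Under the projection from $\mathfrak g=\mathfrak k\oplus\mathfrak p$ to $\mathfrak p$, followed by the canonical isomorphism from $\mathfrak p$ to $\mathfrak p^+$, the closure $\overline{\mathcal O_{2,0}}$ of the principal holomorphic nilpotent orbit $\mathcal O_{2,0}$ is identified with $\mathfrak p^+\cong\mathbb C^q$, and the closure $\overline{\mathcal O_{1,0}}$ of $\mathcal O_{1,0}$ amounts to the smooth complex affine quadric in $\mathbb C^q$ given by the equation $w_1^2+w_2^2+\dots+w_q^2=0$. Furthermore, as a complex analytic space, $\overline{\mathcal O_{1,0}}$ is normal, and so is, of course, $\overline{\mathcal O_{2,0}}$ since it is an affine space.
   Context: $\mathfrak{so}(2,q)=\{\begin{pmatrix} A & B \\ B^t & D \end{pmatrix}:A\in\mathfrak{so}(2,\mathbb R),D\in\mathfrak{so}(q,\mathbb R)\}$, $B$ a real matrix with 2 rows and $q$ columns; $\mathfrak k=\mathfrak{so}(2,\mathbb R)\oplus\mathfrak{so}(q,\mathbb R)$, $\mathfrak p=\{A=0,D=0\}$. $G=\mathrm{SO}(2,q)^0$ is the identity component of $\mathrm{SO}(2,q)$, acting by conjugation. With $J=\begin{pmatrix} 0 & 1 \\ -1 & 0 \end{pmatrix}$ and $z=\mathrm{diag}(J,0)$, $J_z=\mathrm{ad}(z)|_{\mathfrak p}$ (which is $B\mapsto JB$) is a complex structure on $\mathfrak p$; $\mathfrak p^+$ is its $(+i)$-eigenspace in $\mathfrak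 p^{\mathbb C}$, and $\mathfrak p\to\mathfrak p^+$, $w\mapsto w-iJ_zw$, is the canonical complex linear isomorphism. $w_1,\dots,w_q$ are suitable complex linear coordinates on $\mathfrak p^+\cong\mathbb C^q$. In $\mathfrak{so}(2,2)\subseteq\mathfrak{so}(2,q)$ (upper left block) let, in $2\times2$ blocks, $X=\mathrm{diag}(J,J)$, $Y=\mathrm{diag}(J,-J)$, $A_2=\begin{pmatrix} 0 & S \\ S & 0 \end{pmatrix}$ with $S=\begin{pmatrix} 0 & 1 \\ 1 & 0 \end{pmatrix}$, $B_2=\begin{pmatrix} 0 & I \\ I & 0 \end{pmatrix}$, $e_1=\frac12(A_2+X)$, $e_2=\frac12(B_2+Y)$. Then $\mathcal O_{1,0}=Ge_1$, $\mathcal O_{2,0}=G(e_1+e_2)$. The complex analytic structures on the closures are those induced by their (injective) projections to $\mathfrak p\cong\mathfrak p^+$.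
   Formalization: The quadric w_1^2+...+w_q^2=0 is singular at the origin, so "smooth" is false there as stated; it is read as: the quadric is a smooth complex hypersurface at every point other than the origin. *)

theory Defs
  imports "HOL-Analysis.Analysis" "HOL-Algebra.Polynomials"
begin

section \<open>The Lie algebra \<open>so(2,q)\<close> and the group \<open>SO(2,q)\<^sup>0\<close>\<close>

text \<open>
  Here \<open>q = CARD('q)\<close>; rows and columns of a \<open>(2 + q) \<times> (2 + q)\<close> matrix are indexed by the
  disjoint sum \<open>2 + 'q\<close>, and \<open>real^'q^2\<close> is the type of matrices with 2 rows and q columns.
\<close>

definition blk :: "'a^2^2 \<Rightarrow> 'a^'q^2 \<Rightarrow> 'a^2^'q \<Rightarrow> 'a^'q^'q \<Rightarrow> 'a^(2 + 'q::finite)^(2 + 'q)"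
  where "blk A B C D = (\<chi> i j. case i of
      Inl a \<Rightarrow> (case j of Inl b \<Rightarrow> A $ a $ b | Inr b \<Rightarrow> B $ a $ b)
    | Inr a \<Rightarrow> (case j of Inl b \<Rightarrow> C $ a $ b | Inr b \<Rightarrow> D $ a $ b))"

definition so2q :: "(real^(2 + 'q::finite)^(2 + 'q)) set"
  where "so2q = {blk A B (transpose B) D | A B D. transpose A = - A \<and> transpose D = - D}"

definition k_part :: "(real^(2 + 'q::finite)^(2 + 'q)) set"
  where "k_part = {blk A 0 0 D | A D. transpose A = - A \<and> transpose D = - D}"

definition p_part :: "(real^(2 + 'q::finite)^(2 + 'q)) set"
  where "p_part = {blk 0 B (transpose B) 0 | B. True}"

definition proj_p :: "real^(2 + 'q::finite)^(2 + 'q) \<Rightarrow> real^(2 + 'q)^(2 + 'q)"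
  where "proj_p M = (\<chi> i j. if isl i = isl j then 0 else M $ i $ j)"

lemma so2q_cartan_decomposition:
  assumes "M \<in> so2q"
  shows "proj_p M \<in> p_part" and "M - proj_p M \<in> k_part"
proof -
  obtain A B D where M: "M = blk A B (transpose B) D" and A: "transpose A = - A"
    and D: "transpose D = - D"
    using assms by (auto simp: so2q_def)
  have "proj_p M = blk 0 B (transpose B) 0"
    by (simp add: M proj_p_def blk_def vec_eq_iff split: sum.split)
  then show "proj_p M \<in> p_part"
    by (auto simp: p_part_def)
  have "M - proj_p M = blk A 0 0 D"
    by (simp add: M proj_p_def blk_def vec_eq_iff split: sum.split)
  then show "M - proj_p M \<in> k_part"
    using A D by (auto simp: k_part_def)
qed

definition form2q :: "real^(2 + 'q::finite)^(2 + 'q)"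
  where "form2q = blk (mat 1) 0 0 (- mat 1)"

definition SO2q :: "(real^(2 + 'q::finite)^(2 + 'q)) set"
  where "SO2q = {g. transpose g ** form2q ** g = form2q \<and> det g = 1}"

definition SO2q0 :: "(real^(2 + 'q::finite)^(2 + 'q)) set"
  where "SO2q0 = connected_component_set SO2q (mat 1)"

definition adjoint_orbit :: "real^(2 + 'q::finite)^(2 + 'q) \<Rightarrow> (real^(2 + 'q)^(2 + 'q)) set"
  where "adjoint_orbit M = {g ** M ** matrix_inv g | g. g \<in> SO2q0}"


section \<open>The complex structure on \<open>p\<close> and the space \<open>p\<^sup>+\<close>\<close>

definition lie_bracket :: "'a::ring_1^'n^'n \<Rightarrow> 'a^'n^'n \<Rightarrow> 'a^'n^'n"
  where "lie_bracket L M = L ** M - M ** L"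

definition J_mat :: "'a::ring_1^2^2"
  where "J_mat = vector [vector [0, 1], vector [-1, 0]]"

definition z_elt :: "'a::ring_1^(2 + 'q::finite)^(2 + 'q)"
  where "z_elt = blk J_mat 0 0 0"

definition scale_mat :: "complex \<Rightarrow> complex^'n^'m \<Rightarrow> complex^'n^'m"
  where "scale_mat c M = map_matrix ((*) c) M"

text \<open>The complexification of \<open>p\<close> is realised inside the complex matrices.\<close>

definition p_complex :: "(complex^(2 + 'q::finite)^(2 + 'q)) set"
  where "p_complex = {blk 0 B (transpose B) 0 | B. True}"

definition p_plus :: "(complex^(2 + 'q::finite)^(2 + 'q)) set"
  where "p_plus = {W \<in> p_complex. lie_bracket z_elt W = scale_mat \<i> W}"

definition p_to_p_plus :: "real^(2 + 'q::finite)^(2 + 'q) \<Rightarrow> complex^(2 + 'q)^(2 + 'q)"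
  where "p_to_p_plus w =
    map_matrix of_real w - scale_mat \<i> (map_matrix of_real (lie_bracket z_elt w))"

definition proj_p_plus :: "real^(2 + 'q::finite)^(2 + 'q) \<Rightarrow> complex^(2 + 'q)^(2 + 'q)"
  where "proj_p_plus M = p_to_p_plus (proj_p M)"

text \<open>Complex linear coordinates on \<open>p\<^sup>+\<close>; only their values on \<open>p\<^sup>+\<close> matter.\<close>

definition linear_coordinates :: "(complex^(2 + 'q::finite)^(2 + 'q) \<Rightarrow> complex^'q) \<Rightarrow> bool"
  where "linear_coordinates w \<longleftrightarrow>
    Vector_Spaces.linear scale_mat (*s) w \<and> bij_betw w p_plus UNIV"


section \<open>The holomorphic nilpotent orbits\<close>

text \<open>
  The upper left block \<open>so(2,2)\<close> depends on which of the q columns are the first and the second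
  one; these are \<open>c 1\<close> and \<open>c 2\<close>, for an injective map \<open>c\<close>.
\<close>

definition incl_mat :: "(2 \<Rightarrow> 'q::finite) \<Rightarrow> real^2^'q"
  where "incl_mat c = (\<chi> i j. if i = c j then 1 else 0)"

definition blk22 :: "(2 \<Rightarrow> 'q::finite) \<Rightarrow> real^2^2 \<Rightarrow> real^2^2 \<Rightarrow> real^2^2 \<Rightarrow> real^2^2
    \<Rightarrow> real^(2 + 'q)^(2 + 'q)"
  where "blk22 c A B C D =
    blk A (B ** transpose (incl_mat c)) (incl_mat c ** C)
      (incl_mat c ** D ** transpose (incl_mat c))"

definition S_mat :: "real^2^2"
  where "S_mat = vector [vector [0, 1], vector [1, 0]]"

definition X_elt :: "(2 \<Rightarrow> 'q::finite) \<Rightarrow> real^(2 + 'q)^(2 + 'q)"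
  where "X_elt c = blk22 c J_mat 0 0 J_mat"

definition Y_elt :: "(2 \<Rightarrow> 'q::finite) \<Rightarrow> real^(2 + 'q)^(2 + 'q)"
  where "Y_elt c = blk22 c J_mat 0 0 (- J_mat)"

definition A2_elt :: "(2 \<Rightarrow> 'q::finite) \<Rightarrow> real^(2 + 'q)^(2 + 'q)"
  where "A2_elt c = blk22 c 0 S_mat S_mat 0"

definition B2_elt :: "(2 \<Rightarrow> 'q::finite) \<Rightarrow> real^(2 + 'q)^(2 + 'q)"
  where "B2_elt c = blk22 c 0 (mat 1) (mat 1) 0"

definition e1 :: "(2 \<Rightarrow> 'q::finite) \<Rightarrow> real^(2 + 'q)^(2 + 'q)"
  where "e1 c = (1/2) *\<^sub>R (A2_elt c + X_elt c)"

definition e2 :: "(2 \<Rightarrow> 'q::finite) \<Rightarrow> real^(2 + 'q)^(2 + 'q)"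
  where "e2 c = (1/2) *\<^sub>R (B2_elt c + Y_elt c)"

definition orbit10 :: "(2 \<Rightarrow> 'q::finite) \<Rightarrow> (real^(2 + 'q)^(2 + 'q)) set"
  where "orbit10 c = adjoint_orbit (e1 c)"

definition orbit20 :: "(2 \<Rightarrow> 'q::finite) \<Rightarrow> (real^(2 + 'q)^(2 + 'q)) set"
  where "orbit20 c = adjoint_orbit (e1 c + e2 c)"


section \<open>Holomorphic maps and smooth hypersurfaces\<close>

text \<open>
  \<open>S\<close> is a complex linear subspace of the source; \<open>s\<close> and \<open>t\<close> are the multiplications by complex
  scalars on the source and on the target. The derivative is real linear, so compatibility with
  multiplication by \<open>\<i>\<close> makes it complex linear on \<open>S\<close>.
\<close>

definition complex_differentiable_within ::
    "(complex \<Rightarrow> 'a::real_normed_vector \<Rightarrow> 'a) \<Rightarrow> (complex \<Rightarrow> 'b::real_normed_vector \<Rightarrow> 'b)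
      \<Rightarrow> ('a \<Rightarrow> 'b) \<Rightarrow> 'a set \<Rightarrow> 'a \<Rightarrow> bool"
  where "complex_differentiable_within s t F S w \<longleftrightarrow>
    (\<exists>D. (F has_derivative D) (at w within S) \<and> (\<forall>v\<in>S. D (s \<i> v) = t \<i> (D v)))"

definition holomorphic_map_on :: "(complex^'n \<Rightarrow> complex^'m) \<Rightarrow> (complex^'n) set \<Rightarrow> bool"
  where "holomorphic_map_on h U \<longleftrightarrow>
    (\<forall>w\<in>U. complex_differentiable_within (*s) (*s) h UNIV w)"

text \<open>Near the point, a biholomorphic change of coordinates takes \<open>Z\<close> to a coordinate hyperplane.\<close>

definition smooth_hypersurface_at :: "(complex^'n) set \<Rightarrow> complex^'n \<Rightarrow> bool"
  where "smooth_hypersurface_at Z w \<longleftrightarrow>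
    (\<exists>U V (h :: complex^'n \<Rightarrow> complex^'n) h' k. open U \<and> open V \<and> w \<in> U \<and> homeomorphism U V h h' \<and>
      holomorphic_map_on h U \<and> holomorphic_map_on h' V \<and> h ` (Z \<inter> U) = {v \<in> V. v $ k = 0})"

definition quadric :: "(complex^'q) set"
  where "quadric = {w. (\<Sum>j\<in>UNIV. (w $ j)\<^sup>2) = 0}"


section \<open>Normal rings\<close>

text \<open>The field of fractions of a domain, as classes of pairs (numerator, denominator).\<close>

definition frac_rel :: "('a, 'm) ring_scheme \<Rightarrow> (('a \<times> 'a) \<times> ('a \<times> 'a)) set"
  where "frac_rel R = {((a, b), (c, d)) | a b c d.
    a \<in> carrier R \<and> b \<in> carrier R - {\<zero>\<^bsub>R\<^esub>} \<and> c \<in> carrier R \<and> d \<in> carrier R - {\<zero>\<^bsub>R\<^esub>} \<and>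
    a \<otimes>\<^bsub>R\<^esub> d = c \<otimes>\<^bsub>R\<^esub> b}"

definition fraction :: "('a, 'm) ring_scheme \<Rightarrow> 'a \<Rightarrow> 'a \<Rightarrow> ('a \<times> 'a) set"
  where "fraction R a b = frac_rel R `` {(a, b)}"

definition fraction_field :: "('a, 'm) ring_scheme \<Rightarrow> ('a \<times> 'a) set ring"
  where "fraction_field R =
    \<lparr>carrier = (carrier R \<times> (carrier R - {\<zero>\<^bsub>R\<^esub>})) // frac_rel R,
     mult = (\<lambda>x y. \<Union>(a, b)\<in>x. \<Union>(c, d)\<in>y. fraction R (a \<otimes>\<^bsub>R\<^esub> c) (b \<otimes>\<^bsub>R\<^esub> d)),
     one = fraction R \<one>\<^bsub>R\<^esub> \<one>\<^bsub>R\<^esub>,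
     zero = fraction R \<zero>\<^bsub>R\<^esub> \<one>\<^bsub>R\<^esub>,
     add = (\<lambda>x y. \<Union>(a, b)\<in>x. \<Union>(c, d)\<in>y.
       fraction R (a \<otimes>\<^bsub>R\<^esub> d \<oplus>\<^bsub>R\<^esub> c \<otimes>\<^bsub>R\<^esub> b) (b \<otimes>\<^bsub>R\<^esub> d))\<rparr>"

text \<open>
  Polynomials are lists of coefficients whose head is the leading coefficient, so \<open>hd p = \<one>\<close>
  says that \<open>p\<close> is monic.
\<close>

definition integral_over :: "('a, 'm) ring_scheme \<Rightarrow> 'a set \<Rightarrow> 'a \<Rightarrow> bool"
  where "integral_over K A x \<longleftrightarrow>
    (\<exists>p. polynomial\<^bsub>K\<^esub> A p \<and> p \<noteq> [] \<and> hd p = \<one>\<^bsub>K\<^esub> \<and> ring.eval K p x = \<zero>\<^bsub>K\<^esub>)"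

definition normal_ring :: "('a, 'm) ring_scheme \<Rightarrow> bool"
  where "normal_ring R \<longleftrightarrow> domain R \<and>
    (\<forall>x \<in> carrier (fraction_field R).
      integral_over (fraction_field R) ((\<lambda>a. fraction R a \<one>\<^bsub>R\<^esub>) ` carrier R) x \<longrightarrow>
      x \<in> (\<lambda>a. fraction R a \<one>\<^bsub>R\<^esub>) ` carrier R)"


section \<open>The induced complex analytic structure\<close>

text \<open>
  Germs along a filter of functions taken from \<open>Fs\<close>. The ring structure is meaningful when \<open>Fs\<close> is
  closed under sums and products.
\<close>

definition germ :: "'a filter \<Rightarrow> ('a \<Rightarrow> complex) \<Rightarrow> ('a \<Rightarrow> complex) set"
  where "germ \<F> f = {g. \<forall>\<^sub>F y in \<F>. g y = f y}"

definition germ_ring :: "'a filter \<Rightarrow> ('a \<Rightarrow> complex) set \<Rightarrow> ('a \<Rightarrow> complex) set ring"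
  where "germ_ring \<F> Fs =
    \<lparr>carrier = germ \<F> ` Fs,
     mult = (\<lambda>a b. \<Union>f\<in>a. \<Union>g\<in>b. germ \<F> (\<lambda>y. f y * g y)),
     one = germ \<F> (\<lambda>_. 1),
     zero = germ \<F> (\<lambda>_. 0),
     add = (\<lambda>a b. \<Union>f\<in>a. \<Union>g\<in>b. germ \<F> (\<lambda>y. f y + g y))\<rparr>"

definition nhds_in :: "'a::topological_space set \<Rightarrow> 'a \<Rightarrow> 'a filter"
  where "nhds_in Z x = inf (nhds x) (principal Z)"

definition holomorphic_near :: "(complex^(2 + 'q::finite)^(2 + 'q) \<Rightarrow> complex)
    \<Rightarrow> complex^(2 + 'q)^(2 + 'q) \<Rightarrow> bool"
  where "holomorphic_near F w \<longleftrightarrow>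
    (\<forall>\<^sub>F v in nhds_in p_plus w. complex_differentiable_within scale_mat (*) F p_plus v)"

text \<open>
  The stalk at \<open>x\<close> of the structure sheaf that \<open>Z\<close> carries via the projection to \<open>p\<^sup>+\<close>: its
  sections are locally the pullbacks of holomorphic functions on \<open>p\<^sup>+\<close>.
\<close>

definition analytic_stalk :: "(real^(2 + 'q::finite)^(2 + 'q)) set \<Rightarrow> real^(2 + 'q)^(2 + 'q)
    \<Rightarrow> (real^(2 + 'q)^(2 + 'q) \<Rightarrow> complex) set ring"
  where "analytic_stalk Z x = germ_ring (nhds_in Z x)
    {f. \<exists>F. holomorphic_near F (proj_p_plus x) \<and>
      (\<forall>\<^sub>F y in nhds_in Z x. f y = F (proj_p_plus y))}"

definition normal_analytic :: "(real^(2 + 'q::finite)^(2 + 'q)) set \<Rightarrow> bool"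
  where "normal_analytic Z \<longleftrightarrow> (\<forall>x\<in>Z. normal_ring (analytic_stalk Z x))"

end

theory Submission
  imports Defs "HOL-Complex_Analysis.Complex_Analysis"
begin

no_notation fps_nth (infixl \<open>$\<close> 75)

text \<open>
  An element of the closure of \<open>O\<^sub>2\<^sub>,\<^sub>0\<close> is determined by its off-diagonal block \<open>B\<close>: it equals
  \<open>blk (s J) B (B\<^sup>t) (- B\<^sup>t J B / s)\<close>, where \<open>s\<close> is the operator norm of \<open>B\<close>. Indeed the orbit consists
  of nilpotent matrices whose image is nonnegative for the invariant form, which forces this shape up
  to the sign of \<open>s\<close>, and the sign is constant along the connected group. Conversely a singular value
  decomposition of \<open>B\<close>, plane rotations and boosts reach all such matrices in the closure. For
  \<open>O\<^sub>1\<^sub>,\<^sub>0\<close> both singular values coincide, which is the equation of the quadric.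

  Normality is a division property: a fraction \<open>f / g\<close> satisfying an integral equation is locally bounded,
  and a bounded quotient is holomorphic. In \<open>\<complex>\<^sup>q\<close> this is Riemann's extension theorem, proved by averaging
  over circles that avoid the zeros of \<open>g\<close>. Near a smooth point the quadric is a holomorphic retract of
  \<open>\<complex>\<^sup>q\<close>. At the origin the quadric is \<open>z\<^sup>2 = - h\<close>, where \<open>h\<close> is a sum of at least two squares in the
  other coordinates; functions on it are \<open>A + B z\<close>, multiplication by the conjugate makes the denominator
  independent of \<open>z\<close>, and \<open>B\<close> is then divisible by it because \<open>h\<close> has only simple zeros on generic lines.
\<close>

section \<open>Rings of fractions and normality\<close>

text \<open>The hypothesis q >= 3 enters in two places. For q = 2 the quadric is a pair of lines
  crossing at the origin, so its germ there is not a domain; and carrying one orthonormal pair of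
  \<open>real^'q\<close> to every other one needs a direction orthogonal to two given vectors. The
  root z of - h obstructs a direct use of Riemann's theorem: conjugation bounds B z but not B, so
  only |B|^2 |h| <= C |N|^2 is available, and \<open>cdiff_quotient\<close> is stated with such a
  weight. At a simple zero of h the quotient then grows no faster than an inverse square root, which
  excludes a pole; the weight 1 gives the usual theorem. Both base points are bivectors u, n with n
  isotropic and u orthogonal to n; \<open>frm u u\<close> is 0 for \<open>e1\<close> and 1 for
  \<open>e1 + e2\<close>. The closures are not studied inside the space of matrices:
  \<open>nil_section\<close> parametrises them continuously by C^q and by the quadric, with the
  projection as its inverse, and topology and germs are transported along it.\<close>

lemma UN_pairs_const:
  fixes f :: "'a \<Rightarrow> 'b \<Rightarrow> 'c \<Rightarrow> 'd \<Rightarrow> 'e set"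
  assumes "A \<noteq> {}" "B \<noteq> {}" "\<And>a b c d. (a, b) \<in> A \<Longrightarrow> (c, d) \<in> B \<Longrightarrow> f a b c d = Q"
  shows "(\<Union>(a, b)\<in>A. \<Union>(c, d)\<in>B. f a b c d) = Q"
proof -
  have "(case p of (a, b) \<Rightarrow> \<Union>(c, d)\<in>B. f a b c d) = Q" if "p \<in> A" for p
  proof -
    have "(case r of (c, d) \<Rightarrow> f (fst p) (snd p) c d) = Q" if "r \<in> B" for r
      using assms(3) \<open>p \<in> A\<close> that by (cases p; cases r) simp
    then have "(\<Union>(c, d)\<in>B. f (fst p) (snd p) c d) = Q"
      using assms(2) by simp
    then show ?thesis
      by (cases p) simp
  qed
  then show ?thesis
    using assms(1) by simp
qed

context domain
begin

lemma in_fraction: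
  assumes "a \<in> carrier R" "b \<in> carrier R - {\<zero>}"
  shows "(c, d) \<in> fraction R a b \<longleftrightarrow> c \<in> carrier R \<and> d \<in> carrier R - {\<zero>} \<and> a \<otimes> d = c \<otimes> b"
  using assms by (auto simp: fraction_def frac_rel_def)

text \<open>The middle denominator \<open>d\<close> is multiplied in and cancelled at the end. This
  makes the relation between fractions transitive and is where zero divisors would break it.\<close>

lemma cross_trans:
  assumes "a \<in> carrier R" "b \<in> carrier R" "c \<in> carrier R" "d \<in> carrier R - {\<zero>}"
    "e \<in> carrier R" "f \<in> carrier R"
    and "a \<otimes> d = c \<otimes> b" "c \<otimes> f = e \<otimes> d"
  shows "a \<otimes> f = e \<otimes> b"
proof -
  have "d \<otimes> (a \<otimes> f) = (a \<otimes> d) \<otimes> f"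
    using assms(1-6) by (simp add: m_ac)
  also have "\<dots> = (c \<otimes> b) \<otimes> f"
    by (simp only: assms(7))
  also have "\<dots> = (c \<otimes> f) \<otimes> b"
    using assms(1-6) by (simp add: m_ac)
  also have "\<dots> = (e \<otimes> d) \<otimes> b"
    by (simp only: assms(8))
  also have "\<dots> = d \<otimes> (e \<otimes> b)"
    using assms(1-6) by (simp add: m_ac)
  finally show ?thesis
    using assms(1-6) m_lcancel[of d "a \<otimes> f" "e \<otimes> b"] by auto
qed

lemma fraction_eq_iff:
  assumes "a \<in> carrier R" "b \<in> carrier R - {\<zero>}" "c \<in> carrier R" "d \<in> carrier R - {\<zero>}"
  shows "fraction R a b = fraction R c d \<longleftrightarrow> a \<otimes> d = c \<otimes> b"
proof
  assume "fraction R a b = fraction R c d"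
  moreover have "(c, d) \<in> fraction R c d"
    using assms by (simp add: in_fraction)
  ultimately show "a \<otimes> d = c \<otimes> b"
    using assms by (metis in_fraction)
next
  assume eq: "a \<otimes> d = c \<otimes> b"
  show "fraction R a b = fraction R c d"
  proof (rule Set.set_eqI)
    fix p :: "'a \<times> 'a"
    obtain e f where p: "p = (e, f)" by (cases p)
    have "a \<otimes> f = e \<otimes> b \<longleftrightarrow> c \<otimes> f = e \<otimes> d" if "e \<in> carrier R" "f \<in> carrier R"
    proof
      assume "a \<otimes> f = e \<otimes> b"
      then show "c \<otimes> f = e \<otimes> d"
        using assms that by (intro cross_trans[of c d a b e f] eq[symmetric]) auto
    next
      assume "c \<otimes> f = e \<otimes> d"
      then show "a \<otimes> f = e \<otimes> b"
        using assms that by (intro cross_trans[of a b c d e f] eq) auto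
    qed
    then show "p \<in> fraction R a b \<longleftrightarrow> p \<in> fraction R c d"
      using assms by (auto simp: p in_fraction)
  qed
qed

lemma fraction_eqI:
  assumes "a \<otimes> d = c \<otimes> b"
    and "a \<in> carrier R" "b \<in> carrier R - {\<zero>}" "c \<in> carrier R" "d \<in> carrier R - {\<zero>}"
  shows "fraction R a b = fraction R c d"
  using assms fraction_eq_iff by blast

lemma fraction_in_carrier:
  assumes "a \<in> carrier R" "b \<in> carrier R - {\<zero>}"
  shows "fraction R a b \<in> carrier (fraction_field R)"
  using assms by (auto simp: fraction_field_def fraction_def intro!: quotientI)

lemma fraction_cases:
  assumes "x \<in> carrier (fraction_field R)"
  obtains a b where "a \<in> carrier R" "b \<in> carrier R - {\<zero>}" "x = fraction R a b"
proof -
  have "x \<in> (carrier R \<times> (carrier R - {\<zero>})) // frac_rel R"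
    using assms by (simp add: fraction_field_def)
  then obtain a b where "a \<in> carrier R" "b \<in> carrier R - {\<zero>}" "x = frac_rel R `` {(a, b)}"
    by (elim quotientE SigmaE) blast
  then show thesis
    by (intro that[of a b]) (auto simp: fraction_def)
qed

lemma mult_nonzero:
  assumes "b \<in> carrier R - {\<zero>}" "d \<in> carrier R - {\<zero>}"
  shows "b \<otimes> d \<in> carrier R - {\<zero>}"
  using assms by (simp add: integral_iff)

lemma pow_nonzero:
  assumes "b \<in> carrier R - {\<zero>}"
  shows "b [^] (n::nat) \<in> carrier R - {\<zero>}"
proof (induction n)
  case (Suc n)
  then show ?case
    using assms mult_nonzero by (simp only: nat_pow_Suc)
qed simp

text \<open>All representatives give the same class, so the union over them in \<open>mult\<close>
  is that single class; \<open>fraction_add\<close> works the same way.\<close>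

lemma fraction_mult:
  assumes "a \<in> carrier R" "b \<in> carrier R - {\<zero>}" "c \<in> carrier R" "d \<in> carrier R - {\<zero>}"
  shows "fraction R a b \<otimes>\<^bsub>fraction_field R\<^esub> fraction R c d = fraction R (a \<otimes> c) (b \<otimes> d)"
proof -
  have "fraction R (a' \<otimes> c') (b' \<otimes> d') = fraction R (a \<otimes> c) (b \<otimes> d)"
    if "(a', b') \<in> fraction R a b" "(c', d') \<in> fraction R c d" for a' b' c' d'
  proof -
    have *: "a' \<in> carrier R" "b' \<in> carrier R - {\<zero>}" "c' \<in> carrier R" "d' \<in> carrier R - {\<zero>}"
      and eq: "a \<otimes> b' = a' \<otimes> b" "c \<otimes> d' = c' \<otimes> d"
      using that assms by (auto simp: in_fraction)
    have "(a' \<otimes> c') \<otimes> (b \<otimes> d) = (a' \<otimes> b) \<otimes> (c' \<otimes> d)"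
      using * assms by (simp add: m_ac)
    also have "\<dots> = (a \<otimes> b') \<otimes> (c \<otimes> d')"
      by (simp add: eq)
    also have "\<dots> = (a \<otimes> c) \<otimes> (b' \<otimes> d')"
      using * assms by (simp add: m_ac)
    finally show ?thesis
      using * assms mult_nonzero[of b d] mult_nonzero[of b' d'] by (intro fraction_eqI) auto
  qed
  moreover have "(a, b) \<in> fraction R a b" "(c, d) \<in> fraction R c d"
    using assms by (auto simp: in_fraction)
  then have "fraction R a b \<noteq> {}" "fraction R c d \<noteq> {}"
    by auto
  ultimately show ?thesis
    by (simp add: fraction_field_def UN_pairs_const)
qed

lemma fraction_add:
  assumes "a \<in> carrier R" "b \<in> carrier R - {\<zero>}" "c \<in> carrier R" "d \<in> carrier R - {\<zero>}"
  shows "fraction R a b \<oplus>\<^bsub>fraction_field R\<^esub> fraction R c d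
    = fraction R (a \<otimes> d \<oplus> c \<otimes> b) (b \<otimes> d)"
proof -
  have "fraction R (a' \<otimes> d' \<oplus> c' \<otimes> b') (b' \<otimes> d') = fraction R (a \<otimes> d \<oplus> c \<otimes> b) (b \<otimes> d)"
    if "(a', b') \<in> fraction R a b" "(c', d') \<in> fraction R c d" for a' b' c' d'
  proof -
    have *: "a' \<in> carrier R" "b' \<in> carrier R - {\<zero>}" "c' \<in> carrier R" "d' \<in> carrier R - {\<zero>}"
      and eq: "a \<otimes> b' = a' \<otimes> b" "c \<otimes> d' = c' \<otimes> d"
      using that assms by (auto simp: in_fraction)
    have "(a' \<otimes> d' \<oplus> c' \<otimes> b') \<otimes> (b \<otimes> d) = (a' \<otimes> b) \<otimes> (d' \<otimes> d) \<oplus> (c' \<otimes> d) \<otimes> (b' \<otimes> b)"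
      using * assms by (simp add: l_distr r_distr m_ac)
    also have "\<dots> = (a \<otimes> b') \<otimes> (d' \<otimes> d) \<oplus> (c \<otimes> d') \<otimes> (b' \<otimes> b)"
      by (simp add: eq)
    also have "\<dots> = (a \<otimes> d \<oplus> c \<otimes> b) \<otimes> (b' \<otimes> d')"
      using * assms by (simp add: l_distr r_distr m_ac)
    finally show ?thesis
      using * assms mult_nonzero[of b d] mult_nonzero[of b' d'] by (intro fraction_eqI) auto
  qed
  moreover have "(a, b) \<in> fraction R a b" "(c, d) \<in> fraction R c d"
    using assms by (auto simp: in_fraction)
  then have "fraction R a b \<noteq> {}" "fraction R c d \<noteq> {}"
    by auto
  ultimately show ?thesis
    by (simp add: fraction_field_def UN_pairs_const)
qed

lemma fraction_field_zero: "\<zero>\<^bsub>fraction_field R\<^esub> = fraction R \<zero> \<one>"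
  by (simp add: fraction_field_def)

lemma fraction_field_one: "\<one>\<^bsub>fraction_field R\<^esub> = fraction R \<one> \<one>"
  by (simp add: fraction_field_def)

lemma fraction_add_assoc:
  assumes "x \<in> carrier (fraction_field R)" "y \<in> carrier (fraction_field R)"
    "z \<in> carrier (fraction_field R)"
  shows "(x \<oplus>\<^bsub>fraction_field R\<^esub> y) \<oplus>\<^bsub>fraction_field R\<^esub> z
    = x \<oplus>\<^bsub>fraction_field R\<^esub> (y \<oplus>\<^bsub>fraction_field R\<^esub> z)"
proof -
  obtain a b where x: "a \<in> carrier R" "b \<in> carrier R - {\<zero>}" "x = fraction R a b"
    using assms(1) fraction_cases by blast
  obtain c d where y: "c \<in> carrier R" "d \<in> carrier R - {\<zero>}" "y = fraction R c d"
    using assms(2) fraction_cases by blast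
  obtain e f where z: "e \<in> carrier R" "f \<in> carrier R - {\<zero>}" "z = fraction R e f"
    using assms(3) fraction_cases by blast
  have bd: "b \<otimes> d \<in> carrier R - {\<zero>}" "d \<otimes> f \<in> carrier R - {\<zero>}"
    by (intro mult_nonzero x y z)+
  have "((a \<otimes> d \<oplus> c \<otimes> b) \<otimes> f \<oplus> e \<otimes> (b \<otimes> d)) = a \<otimes> (d \<otimes> f) \<oplus> (c \<otimes> f \<oplus> e \<otimes> d) \<otimes> b"
    using x y z by (simp add: l_distr r_distr m_ac a_ac)
  moreover have "b \<otimes> d \<otimes> f = b \<otimes> (d \<otimes> f)"
    using x y z by (simp add: m_ac)
  ultimately show ?thesis
    using x y z bd by (simp add: fraction_add)
qed

lemma fraction_mult_assoc:
  assumes "x \<in> carrier (fraction_field R)" "y \<in> carrier (fraction_field R)"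
    "z \<in> carrier (fraction_field R)"
  shows "(x \<otimes>\<^bsub>fraction_field R\<^esub> y) \<otimes>\<^bsub>fraction_field R\<^esub> z
    = x \<otimes>\<^bsub>fraction_field R\<^esub> (y \<otimes>\<^bsub>fraction_field R\<^esub> z)"
proof -
  obtain a b where x: "a \<in> carrier R" "b \<in> carrier R - {\<zero>}" "x = fraction R a b"
    using assms(1) fraction_cases by blast
  obtain c d where y: "c \<in> carrier R" "d \<in> carrier R - {\<zero>}" "y = fraction R c d"
    using assms(2) fraction_cases by blast
  obtain e f where z: "e \<in> carrier R" "f \<in> carrier R - {\<zero>}" "z = fraction R e f"
    using assms(3) fraction_cases by blast
  have bd: "b \<otimes> d \<in> carrier R - {\<zero>}" "d \<otimes> f \<in> carrier R - {\<zero>}"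
    by (intro mult_nonzero x y z)+
  then show ?thesis
    using x y z by (simp add: fraction_mult m_assoc)
qed

lemma fraction_distr:
  assumes "x \<in> carrier (fraction_field R)" "y \<in> carrier (fraction_field R)"
    "z \<in> carrier (fraction_field R)"
  shows "(x \<oplus>\<^bsub>fraction_field R\<^esub> y) \<otimes>\<^bsub>fraction_field R\<^esub> z
    = x \<otimes>\<^bsub>fraction_field R\<^esub> z \<oplus>\<^bsub>fraction_field R\<^esub> y \<otimes>\<^bsub>fraction_field R\<^esub> z"
proof -
  obtain a b where x: "a \<in> carrier R" "b \<in> carrier R - {\<zero>}" "x = fraction R a b"
    using assms(1) fraction_cases by blast
  obtain c d where y: "c \<in> carrier R" "d \<in> carrier R - {\<zero>}" "y = fraction R c d"
    using assms(2) fraction_cases by blast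
  obtain e f where z: "e \<in> carrier R" "f \<in> carrier R - {\<zero>}" "z = fraction R e f"
    using assms(3) fraction_cases by blast
  have bd: "b \<otimes> d \<in> carrier R - {\<zero>}" "d \<otimes> f \<in> carrier R - {\<zero>}" "b \<otimes> f \<in> carrier R - {\<zero>}"
    by (intro mult_nonzero x y z)+
  have "b \<otimes> d \<otimes> f \<in> carrier R - {\<zero>}" "b \<otimes> f \<otimes> (d \<otimes> f) \<in> carrier R - {\<zero>}"
    by (intro mult_nonzero bd x y z)+
  moreover have "((a \<otimes> d \<oplus> c \<otimes> b) \<otimes> e) \<otimes> (b \<otimes> f \<otimes> (d \<otimes> f))
      = (a \<otimes> e \<otimes> (d \<otimes> f) \<oplus> c \<otimes> e \<otimes> (b \<otimes> f)) \<otimes> (b \<otimes> d \<otimes> f)"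
    using x y z by (simp add: l_distr r_distr m_ac)
  ultimately show ?thesis
    using x y z bd by (simp add: fraction_add fraction_mult) (rule fraction_eqI, auto)
qed

lemma fraction_add_closed:
  assumes "x \<in> carrier (fraction_field R)" "y \<in> carrier (fraction_field R)"
  shows "x \<oplus>\<^bsub>fraction_field R\<^esub> y \<in> carrier (fraction_field R)"
proof -
  obtain a b where x: "a \<in> carrier R" "b \<in> carrier R - {\<zero>}" "x = fraction R a b"
    using assms(1) fraction_cases by blast
  obtain c d where y: "c \<in> carrier R" "d \<in> carrier R - {\<zero>}" "y = fraction R c d"
    using assms(2) fraction_cases by blast
  have "b \<otimes> d \<in> carrier R - {\<zero>}"
    by (intro mult_nonzero x y)
  then have "fraction R (a \<otimes> d \<oplus> c \<otimes> b) (b \<otimes> d) \<in> carrier (fraction_field R)"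
    using x y by (intro fraction_in_carrier) auto
  then show ?thesis
    using x y by (simp add: fraction_add)
qed

lemma fraction_mult_closed:
  assumes "x \<in> carrier (fraction_field R)" "y \<in> carrier (fraction_field R)"
  shows "x \<otimes>\<^bsub>fraction_field R\<^esub> y \<in> carrier (fraction_field R)"
proof -
  obtain a b where x: "a \<in> carrier R" "b \<in> carrier R - {\<zero>}" "x = fraction R a b"
    using assms(1) fraction_cases by blast
  obtain c d where y: "c \<in> carrier R" "d \<in> carrier R - {\<zero>}" "y = fraction R c d"
    using assms(2) fraction_cases by blast
  have "b \<otimes> d \<in> carrier R - {\<zero>}"
    by (intro mult_nonzero x y)
  then have "fraction R (a \<otimes> c) (b \<otimes> d) \<in> carrier (fraction_field R)"
    using x y by (intro fraction_in_carrier) auto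
  then show ?thesis
    using x y by (simp add: fraction_mult)
qed

lemma fraction_field_cring: "cring (fraction_field R)"
proof (rule cringI)
  show "abelian_group (fraction_field R)"
  proof (rule abelian_groupI)
    show "\<zero>\<^bsub>fraction_field R\<^esub> \<in> carrier (fraction_field R)"
      unfolding fraction_field_zero by (intro fraction_in_carrier) auto
  next
    fix x y
    assume "x \<in> carrier (fraction_field R)" "y \<in> carrier (fraction_field R)"
    then show "x \<oplus>\<^bsub>fraction_field R\<^esub> y = y \<oplus>\<^bsub>fraction_field R\<^esub> x"
      by (elim fraction_cases) (simp add: fraction_add m_comm a_comm)
  next
    fix x
    assume "x \<in> carrier (fraction_field R)"
    then show "\<zero>\<^bsub>fraction_field R\<^esub> \<oplus>\<^bsub>fraction_field R\<^esub> x = x"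
      by (elim fraction_cases) (simp add: fraction_field_zero fraction_add)
  next
    fix x
    assume "x \<in> carrier (fraction_field R)"
    then obtain a b where x: "a \<in> carrier R" "b \<in> carrier R - {\<zero>}" "x = fraction R a b"
      using fraction_cases by blast
    then have "fraction R (\<ominus> a) b \<oplus>\<^bsub>fraction_field R\<^esub> x = fraction R \<zero> (b \<otimes> b)"
      by (simp add: fraction_add l_minus l_neg)
    also have "\<dots> = \<zero>\<^bsub>fraction_field R\<^esub>"
      unfolding fraction_field_zero using x mult_nonzero[of b b] by (intro fraction_eqI) auto
    finally show "\<exists>y\<in>carrier (fraction_field R).
        y \<oplus>\<^bsub>fraction_field R\<^esub> x = \<zero>\<^bsub>fraction_field R\<^esub>"
      using x by (intro bexI[of _ "fraction R (\<ominus> a) b"] fraction_in_carrier) auto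
  qed (fact fraction_add_closed fraction_add_assoc)+
next
  show "comm_monoid (fraction_field R)"
  proof (rule comm_monoidI)
    show "\<one>\<^bsub>fraction_field R\<^esub> \<in> carrier (fraction_field R)"
      unfolding fraction_field_one by (intro fraction_in_carrier) auto
  next
    fix x y
    assume "x \<in> carrier (fraction_field R)" "y \<in> carrier (fraction_field R)"
    then show "x \<otimes>\<^bsub>fraction_field R\<^esub> y = y \<otimes>\<^bsub>fraction_field R\<^esub> x"
      by (elim fraction_cases) (simp add: fraction_mult m_comm)
  next
    fix x
    assume "x \<in> carrier (fraction_field R)"
    then show "\<one>\<^bsub>fraction_field R\<^esub> \<otimes>\<^bsub>fraction_field R\<^esub> x = x"
      by (elim fraction_cases) (simp add: fraction_field_one fraction_mult)
  qed (fact fraction_mult_closed fraction_mult_assoc)+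
qed (rule fraction_distr)

lemma fraction_pow:
  assumes "a \<in> carrier R" "b \<in> carrier R - {\<zero>}"
  shows "fraction R a b [^]\<^bsub>fraction_field R\<^esub> (n::nat) = fraction R (a [^] n) (b [^] n)"
proof -
  interpret K: cring "fraction_field R" by (rule fraction_field_cring)
  show ?thesis
  proof (induction n)
    case (Suc n)
    have "b [^] n \<in> carrier R - {\<zero>}"
      using assms(2) by (rule pow_nonzero)
    with Suc assms show ?case
      by (simp add: fraction_mult)
  qed (simp add: fraction_field_one)
qed

end

text \<open>The numerator over the common denominator \<open>b\<close> to the power \<open>length cs - 1\<close> of the value at
  \<open>a / b\<close> of the polynomial with coefficient list \<open>cs\<close>.\<close>

primrec homog_eval :: "('a, 'm) ring_scheme \<Rightarrow> 'a list \<Rightarrow> 'a \<Rightarrow> 'a \<Rightarrow> 'a" where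
  "homog_eval R [] a b = \<zero>\<^bsub>R\<^esub>"
| "homog_eval R (c # cs) a b = c \<otimes>\<^bsub>R\<^esub> a [^]\<^bsub>R\<^esub> length cs \<oplus>\<^bsub>R\<^esub> b \<otimes>\<^bsub>R\<^esub> homog_eval R cs a b"

context domain
begin

lemma homog_eval_closed:
  assumes "set cs \<subseteq> carrier R" "a \<in> carrier R" "b \<in> carrier R"
  shows "homog_eval R cs a b \<in> carrier R"
  using assms by (induction cs) auto

lemma eval_fraction:
  assumes "set cs \<subseteq> carrier R" "a \<in> carrier R" "b \<in> carrier R - {\<zero>}" "cs \<noteq> []"
  shows "ring.eval (fraction_field R) (map (\<lambda>c. fraction R c \<one>) cs) (fraction R a b)
    = fraction R (homog_eval R cs a b) (b [^] (length cs - 1))"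
  using assms
proof (induction cs)
  case (Cons c cs)
  interpret K: cring "fraction_field R" by (rule fraction_field_cring)
  have b: "b [^] n \<in> carrier R - {\<zero>}" for n :: nat
    using Cons.prems pow_nonzero by blast
  have c: "c \<in> carrier R"
    using Cons.prems by auto
  have pw: "fraction R c \<one> \<otimes>\<^bsub>fraction_field R\<^esub> fraction R a b [^]\<^bsub>fraction_field R\<^esub> length cs
      = fraction R (c \<otimes> a [^] length cs) (b [^] length cs)"
    using Cons.prems b by (simp add: fraction_pow fraction_mult)
  show ?case
  \<comment> \<open>Truncated subtraction: \<open>length cs - 1\<close> is one less than
    \<open>length cs\<close> only for a nonempty tail.\<close>
  proof (cases "cs = []")
    case True
    with Cons.prems pw show ?thesis
      by (simp add: fraction_field_zero fraction_add)
  next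
    case False
    let ?n = "length cs - 1" and ?h = "homog_eval R cs a b"
    have h: "?h \<in> carrier R"
      using Cons.prems by (auto intro: homog_eval_closed)
    have len: "b [^] length cs = b [^] ?n \<otimes> b"
      using False by (cases cs) auto
    have bn: "b [^] length cs \<otimes> b [^] ?n \<in> carrier R - {\<zero>}"
      using b mult_nonzero by blast
    have "ring.eval (fraction_field R) (map (\<lambda>c. fraction R c \<one>) (c # cs)) (fraction R a b)
      = fraction R (c \<otimes> a [^] length cs) (b [^] length cs) \<oplus>\<^bsub>fraction_field R\<^esub> fraction R ?h (b [^] ?n)"
      using Cons.IH Cons.prems False pw by simp
    also have "\<dots> = fraction R ((c \<otimes> a [^] length cs) \<otimes> b [^] ?n \<oplus> ?h \<otimes> b [^] length cs)
        (b [^] length cs \<otimes> b [^] ?n)"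
      using b h c Cons.prems by (intro fraction_add) auto
    also have "\<dots> = fraction R (homog_eval R (c # cs) a b) (b [^] length cs)"
    proof (rule fraction_eqI)
      show "(c \<otimes> a [^] length cs \<otimes> b [^] ?n \<oplus> ?h \<otimes> b [^] length cs) \<otimes> b [^] length cs
        = homog_eval R (c # cs) a b \<otimes> (b [^] length cs \<otimes> b [^] ?n)"
        using b[of ?n] h c Cons.prems unfolding len by (simp add: l_distr r_distr m_ac)
    qed (use b h c bn Cons.prems in auto)
    finally show ?thesis by simp
  qed
qed simp

text \<open>The list \<open>cs\<close> holds the coefficients below the leading 1. Multiplying the
  monic equation for a / b by b^(length cs) turns it into an equation inside \<open>R\<close>, and
  lying in \<open>R\<close> becomes divisibility of a by b, so the fraction field disappears from
  the rest of the proof.\<close>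

lemma normal_ringI:
  assumes "\<And>a b cs. \<lbrakk>a \<in> carrier R; b \<in> carrier R - {\<zero>}; set cs \<subseteq> carrier R;
      a [^] length cs \<oplus> b \<otimes> homog_eval R cs a b = \<zero>\<rbrakk> \<Longrightarrow> \<exists>d\<in>carrier R. a = d \<otimes> b"
  shows "normal_ring R"
  unfolding normal_ring_def
proof (intro conjI ballI impI)
  show "domain R" by (rule domain_axioms)
next
  interpret K: cring "fraction_field R" by (rule fraction_field_cring)
  fix x
  assume "x \<in> carrier (fraction_field R)"
    and int: "integral_over (fraction_field R) ((\<lambda>a. fraction R a \<one>) ` carrier R) x"
  then obtain a b where ab: "a \<in> carrier R" "b \<in> carrier R - {\<zero>}" "x = fraction R a b"
    using fraction_cases by blast
  from int obtain p where p: "polynomial\<^bsub>fraction_field R\<^esub> ((\<lambda>a. fraction R a \<one>) ` carrier R) p"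
    "p \<noteq> []" "hd p = \<one>\<^bsub>fraction_field R\<^esub>" "ring.eval (fraction_field R) p x = \<zero>\<^bsub>fraction_field R\<^esub>"
    unfolding integral_over_def by blast
  have "set p \<subseteq> (\<lambda>a. fraction R a \<one>) ` carrier R"
    using p(1,2) by (auto simp: polynomial_def)
  then have "set (tl p) \<subseteq> (\<lambda>a. fraction R a \<one>) ` carrier R"
    using p(2) by (meson list.set_sel(2) subset_iff)
  then have "tl p \<in> lists ((\<lambda>a. fraction R a \<one>) ` carrier R)"
    by (simp add: lists_eq_set)
  then obtain cs where cs: "set cs \<subseteq> carrier R" "tl p = map (\<lambda>a. fraction R a \<one>) cs"
    unfolding lists_image by (auto simp: lists_eq_set)
  have peq: "p = map (\<lambda>c. fraction R c \<one>) (\<one> # cs)"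
    using p(2,3) cs by (cases p) (auto simp: fraction_field_one)
  have "fraction R (homog_eval R (\<one> # cs) a b) (b [^] length cs) = fraction R \<zero> \<one>"
    using eval_fraction[of "\<one> # cs" a b] cs ab p(4) peq by (simp add: fraction_field_zero)
  moreover have "homog_eval R (\<one> # cs) a b \<in> carrier R"
    using cs ab by (intro homog_eval_closed) auto
  ultimately have "homog_eval R (\<one> # cs) a b \<otimes> \<one> = \<zero> \<otimes> b [^] length cs"
    using pow_nonzero[OF ab(2)] by (subst (asm) fraction_eq_iff) auto
  then have "a [^] length cs \<oplus> b \<otimes> homog_eval R cs a b = \<zero>"
    using ab cs homog_eval_closed by auto
  then obtain d where "d \<in> carrier R" "a = d \<otimes> b"
    using assms ab cs by blast
  then have "x = fraction R d \<one>"
    unfolding ab(3) using ab(1,2) by (intro fraction_eqI) auto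
  then show "x \<in> (\<lambda>a. fraction R a \<one>) ` carrier R"
    using \<open>d \<in> carrier R\<close> by blast
qed

end

section \<open>Rings of germs and bounds from integral equations\<close>

lemma germ_eq_iff: "germ \<F> f = germ \<F> g \<longleftrightarrow> (\<forall>\<^sub>F y in \<F>. f y = g y)"
proof
  assume "germ \<F> f = germ \<F> g"
  moreover have "f \<in> germ \<F> f"
    by (simp add: germ_def)
  ultimately show "\<forall>\<^sub>F y in \<F>. f y = g y"
    by (simp add: germ_def)
next
  assume eq: "\<forall>\<^sub>F y in \<F>. f y = g y"
  have "(\<forall>\<^sub>F y in \<F>. h y = f y) \<longleftrightarrow> (\<forall>\<^sub>F y in \<F>. h y = g y)" for h
    by (rule eventually_cong[OF eq]) simp
  then show "germ \<F> f = germ \<F> g"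
    by (simp add: germ_def)
qed

lemma germ_mult: "germ \<F> f \<otimes>\<^bsub>germ_ring \<F> Fs\<^esub> germ \<F> g = germ \<F> (\<lambda>y. f y * g y)"
proof -
  have "germ \<F> (\<lambda>y. f' y * g' y) = germ \<F> (\<lambda>y. f y * g y)"
    if "f' \<in> germ \<F> f" "g' \<in> germ \<F> g" for f' g'
    using that unfolding germ_eq_iff by (auto simp: germ_def elim: eventually_elim2)
  moreover have "f \<in> germ \<F> f" "g \<in> germ \<F> g"
    by (simp_all add: germ_def)
  then have "germ \<F> f \<noteq> {}" "germ \<F> g \<noteq> {}"
    by auto
  ultimately show ?thesis
    by (simp add: germ_ring_def)
qed

lemma germ_add: "germ \<F> f \<oplus>\<^bsub>germ_ring \<F> Fs\<^esub> germ \<F> g = germ \<F> (\<lambda>y. f y + g y)"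
proof -
  have "germ \<F> (\<lambda>y. f' y + g' y) = germ \<F> (\<lambda>y. f y + g y)"
    if "f' \<in> germ \<F> f" "g' \<in> germ \<F> g" for f' g'
    using that unfolding germ_eq_iff by (auto simp: germ_def elim: eventually_elim2)
  moreover have "f \<in> germ \<F> f" "g \<in> germ \<F> g"
    by (simp_all add: germ_def)
  then have "germ \<F> f \<noteq> {}" "germ \<F> g \<noteq> {}"
    by auto
  ultimately show ?thesis
    by (simp add: germ_ring_def)
qed

lemma germ_ring_simps:
  "carrier (germ_ring \<F> Fs) = germ \<F> ` Fs"
  "\<one>\<^bsub>germ_ring \<F> Fs\<^esub> = germ \<F> (\<lambda>_. 1)" "\<zero>\<^bsub>germ_ring \<F> Fs\<^esub> = germ \<F> (\<lambda>_. 0)"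
  by (simp_all add: germ_ring_def)

lemma germ_ring_cring:
  assumes const: "\<And>c. (\<lambda>_. c) \<in> Fs"
    and add: "\<And>f g. f \<in> Fs \<Longrightarrow> g \<in> Fs \<Longrightarrow> (\<lambda>y. f y + g y) \<in> Fs"
    and mult: "\<And>f g. f \<in> Fs \<Longrightarrow> g \<in> Fs \<Longrightarrow> (\<lambda>y. f y * g y) \<in> Fs"
  shows "cring (germ_ring \<F> Fs)"
proof (rule cringI)
  show "abelian_group (germ_ring \<F> Fs)"
  proof (rule abelian_groupI)
    fix a assume "a \<in> carrier (germ_ring \<F> Fs)"
    then obtain f where f: "f \<in> Fs" "a = germ \<F> f"
      by (auto simp: germ_ring_simps)
    have "germ \<F> (\<lambda>y. (- 1) * f y) \<oplus>\<^bsub>germ_ring \<F> Fs\<^esub> a = \<zero>\<^bsub>germ_ring \<F> Fs\<^esub>"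
      unfolding f germ_add germ_ring_simps germ_eq_iff by simp
    moreover have "(\<lambda>y. (- 1) * f y) \<in> Fs"
      by (rule mult[OF const f(1)])
    ultimately show "\<exists>b\<in>carrier (germ_ring \<F> Fs). b \<oplus>\<^bsub>germ_ring \<F> Fs\<^esub> a = \<zero>\<^bsub>germ_ring \<F> Fs\<^esub>"
      unfolding germ_ring_simps(1) by blast
  qed (use add const in \<open>auto simp: germ_ring_simps germ_add add_ac\<close>)
  show "comm_monoid (germ_ring \<F> Fs)"
    by (rule comm_monoidI) (use mult const in \<open>auto simp: germ_ring_simps germ_mult mult_ac\<close>)
qed (auto simp: germ_ring_simps germ_mult germ_add distrib_right)

text \<open>The polynomial of \<open>homog_eval\<close> in a ring given by a type class, so that an
  equation between germs can be read at each point.\<close>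

primrec homog_val :: "'a::comm_ring_1 list \<Rightarrow> 'a \<Rightarrow> 'a \<Rightarrow> 'a" where
  "homog_val [] a b = 0"
| "homog_val (c # cs) a b = c * a ^ length cs + b * homog_val cs a b"

text \<open>Every monomial has degree \<open>length cs - 1\<close> in a and b together, and |b| <=
  |a|, so each is at most M |a|^(length cs - 1). The extra factor \<open>norm a\<close> avoids the
  truncated exponent.\<close>

lemma homog_val_bound:
  fixes a b :: complex
  assumes "\<And>c. c \<in> set cs \<Longrightarrow> norm c \<le> M" "norm b \<le> norm a"
  shows "norm (homog_val cs a b) * norm a \<le> M * real (length cs) * norm a ^ length cs"
  using assms(1)
proof (induction cs)
  case (Cons c cs)
  have "norm (homog_val (c # cs) a b) \<le> norm c * norm a ^ length cs + norm b * norm (homog_val cs a b)"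
    by (simp add: norm_mult norm_power norm_triangle_le)
  also have "\<dots> \<le> M * norm a ^ length cs + norm a * norm (homog_val cs a b)"
    using Cons.prems assms(2) by (intro add_mono mult_right_mono) auto
  also have "\<dots> \<le> M * norm a ^ length cs + M * real (length cs) * norm a ^ length cs"
    using Cons by (simp add: mult.commute)
  also have "\<dots> = M * real (length (c # cs)) * norm a ^ length cs"
    by (simp add: algebra_simps)
  finally have "norm (homog_val (c # cs) a b) * norm a
      \<le> M * real (length (c # cs)) * norm a ^ length cs * norm a"
    by (rule mult_right_mono) simp
  then show ?case
    by (simp add: mult_ac)
qed simp

text \<open>The bound on the roots of a monic polynomial, for the root a / b but without dividing,
  so that b may vanish. If |a| > |b|, then with n = \<open>length cs\<close> the equation makes
  |a|^(n+1) at most |b| M n |a|^n, and |a|^n > 0 cancels.\<close>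

lemma monic_root_bound:
  fixes a b :: complex
  assumes "a ^ length cs + b * homog_val cs a b = 0"
    and M: "\<And>c. c \<in> set cs \<Longrightarrow> norm c \<le> M" "0 \<le> M"
  shows "norm a \<le> (M * length cs + 1) * norm b"
proof (cases "norm a \<le> norm b")
  case True
  then show ?thesis
    using M by (simp add: distrib_right add_increasing)
next
  case False
  let ?n = "length cs"
  have "norm a ^ ?n = norm b * norm (homog_val cs a b)"
    using assms(1) by (metis add_eq_0_iff norm_minus_cancel norm_mult norm_power)
  then have "norm a ^ ?n * norm a = norm b * (norm (homog_val cs a b) * norm a)"
    by simp
  also have "\<dots> \<le> norm b * (M * real ?n * norm a ^ ?n)"
    using False M homog_val_bound[of cs M b a] by (intro mult_left_mono) auto
  finally have "norm a ^ ?n * norm a \<le> norm a ^ ?n * (M * real ?n * norm b)"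
    by (simp add: mult_ac)
  moreover have "0 < norm a ^ ?n"
    using False by (metis norm_ge_zero not_le_imp_less order_le_less_trans zero_less_power)
  ultimately have "norm a \<le> M * real ?n * norm b"
    by (simp add: mult_le_cancel_left_pos)
  then show ?thesis
    by (simp add: distrib_right add_increasing2)
qed

text \<open>The condition \<open>divide\<close> speaks of |f| <= C |g| along the filter. From an
  integral equation with bounded coefficients \<open>monic_root_bound\<close> extracts such a C, and
  \<open>divide\<close> then yields the quotient that \<open>normal_ringI\<close> asks for.\<close>

lemma normal_germ_ring:
  assumes const: "\<And>c. (\<lambda>_. c) \<in> Fs"
    and add: "\<And>f g. f \<in> Fs \<Longrightarrow> g \<in> Fs \<Longrightarrow> (\<lambda>y. f y + g y) \<in> Fs"
    and mult: "\<And>f g. f \<in> Fs \<Longrightarrow> g \<in> Fs \<Longrightarrow> (\<lambda>y. f y * g y) \<in> Fs"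
    and bounded: "\<And>f. f \<in> Fs \<Longrightarrow> \<exists>C. \<forall>\<^sub>F y in \<F>. norm (f y) \<le> C"
    and nontrivial: "\<F> \<noteq> bot"
    and dom: "\<And>f g. \<lbrakk>f \<in> Fs; g \<in> Fs; \<forall>\<^sub>F y in \<F>. f y * g y = 0\<rbrakk>
      \<Longrightarrow> (\<forall>\<^sub>F y in \<F>. f y = 0) \<or> (\<forall>\<^sub>F y in \<F>. g y = 0)"
    and divide: "\<And>f g C. \<lbrakk>f \<in> Fs; g \<in> Fs; \<forall>\<^sub>F y in \<F>. norm (f y) \<le> C * norm (g y);
      \<not> (\<forall>\<^sub>F y in \<F>. g y = 0)\<rbrakk> \<Longrightarrow> \<exists>h\<in>Fs. \<forall>\<^sub>F y in \<F>. f y = h y * g y"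
  shows "normal_ring (germ_ring \<F> Fs)"
proof -
  let ?R = "germ_ring \<F> Fs"
  interpret cring ?R
    using const add mult by (rule germ_ring_cring)
  interpret domain ?R
  proof (rule domainI)
    show "\<one>\<^bsub>?R\<^esub> \<noteq> \<zero>\<^bsub>?R\<^esub>"
      using nontrivial by (simp add: germ_ring_simps germ_eq_iff)
    fix a b
    assume "a \<otimes>\<^bsub>?R\<^esub> b = \<zero>\<^bsub>?R\<^esub>" and a: "a \<in> carrier ?R" and b: "b \<in> carrier ?R"
    moreover obtain f where f: "f \<in> Fs" "a = germ \<F> f"
      using a unfolding germ_ring_simps by blast
    moreover obtain g where g: "g \<in> Fs" "b = germ \<F> g"
      using b unfolding germ_ring_simps by blast
    ultimately have "\<forall>\<^sub>F y in \<F>. f y * g y = 0"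
      by (simp only: germ_mult germ_ring_simps germ_eq_iff)
    from dom[OF f(1) g(1) this] show "a = \<zero>\<^bsub>?R\<^esub> \<or> b = \<zero>\<^bsub>?R\<^esub>"
      by (simp only: f g germ_ring_simps germ_eq_iff)
  qed (rule is_cring)
  have pow: "germ \<F> f [^]\<^bsub>?R\<^esub> (n::nat) = germ \<F> (\<lambda>y. f y ^ n)" for f n
    by (induction n) (simp_all add: germ_ring_simps germ_mult mult.commute)
  have homog: "homog_eval ?R (map (germ \<F>) fs) (germ \<F> f) (germ \<F> g)
    = germ \<F> (\<lambda>y. homog_val (map (\<lambda>h. h y) fs) (f y) (g y))" for fs f g
    by (induction fs) (simp_all add: germ_ring_simps germ_mult germ_add pow)
  show ?thesis
  proof (rule normal_ringI)
    fix a b cs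
    assume a: "a \<in> carrier ?R" and b: "b \<in> carrier ?R - {\<zero>\<^bsub>?R\<^esub>}" and cs: "set cs \<subseteq> carrier ?R"
      and eq: "a [^]\<^bsub>?R\<^esub> length cs \<oplus>\<^bsub>?R\<^esub> b \<otimes>\<^bsub>?R\<^esub> homog_eval ?R cs a b = \<zero>\<^bsub>?R\<^esub>"
    obtain f where f: "f \<in> Fs" "a = germ \<F> f"
      using a by (auto simp: germ_ring_simps)
    obtain g where g: "g \<in> Fs" "b = germ \<F> g"
      using b by (auto simp: germ_ring_simps)
    have g0: "\<not> (\<forall>\<^sub>F y in \<F>. g y = 0)"
      using b by (simp add: g germ_ring_simps germ_eq_iff)
    have "cs \<in> lists (germ \<F> ` Fs)"
      using cs by (simp add: lists_eq_set germ_ring_simps)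
    then obtain fs where fs: "set fs \<subseteq> Fs" "cs = map (germ \<F>) fs"
      unfolding lists_image by (auto simp: lists_eq_set)
    have root: "\<forall>\<^sub>F y in \<F>. f y ^ length fs + g y * homog_val (map (\<lambda>h. h y) fs) (f y) (g y) = 0"
      using eq unfolding f(2) g(2) fs(2) homog pow germ_mult germ_add
      by (simp add: germ_ring_simps germ_eq_iff)
    have "\<exists>M\<ge>0. \<forall>\<^sub>F y in \<F>. \<forall>h\<in>set fs. norm (h y) \<le> M"
      using fs(1)
    proof (induction fs)
      case (Cons h fs)
      then obtain M where M: "M \<ge> 0" "\<forall>\<^sub>F y in \<F>. \<forall>h\<in>set fs. norm (h y) \<le> M"
        by auto
      obtain C where C: "\<forall>\<^sub>F y in \<F>. norm (h y) \<le> C"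
        using bounded Cons.prems by auto
      have "\<forall>\<^sub>F y in \<F>. \<forall>k\<in>set (h # fs). norm (k y) \<le> max M C"
        using M(2) C by eventually_elim (auto intro: le_max_iff_disj[THEN iffD2])
      then show ?case
        using M(1) by (intro exI[of _ "max M C"]) auto
    qed (auto intro: exI[of _ 0])
    then obtain M where M: "M \<ge> 0" "\<forall>\<^sub>F y in \<F>. \<forall>h\<in>set fs. norm (h y) \<le> M"
      by blast
    have "\<forall>\<^sub>F y in \<F>. norm (f y) \<le> (M * length fs + 1) * norm (g y)"
      using root M(2)
    proof eventually_elim
      case (elim y)
      then show ?case
        using monic_root_bound[of "f y" "map (\<lambda>h. h y) fs" "g y" M] M(1) by auto
    qed
    from divide[OF f(1) g(1) this g0]
    obtain h where h: "h \<in> Fs" "\<forall>\<^sub>F y in \<F>. f y = h y * g y"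
      by blast
    then have "a = germ \<F> h \<otimes>\<^bsub>?R\<^esub> b"
      by (simp add: f g germ_mult germ_eq_iff)
    then show "\<exists>d\<in>carrier ?R. a = d \<otimes>\<^bsub>?R\<^esub> b"
      using h(1) by (auto simp: germ_ring_simps)
  qed
qed

section \<open>Holomorphic functions of several variables\<close>

abbreviation cdiff :: "(complex^'n \<Rightarrow> complex) \<Rightarrow> complex^'n \<Rightarrow> bool"
  where "cdiff F w \<equiv> complex_differentiable_within (*s) (*) F UNIV w"

lemma cdiff_def: "cdiff F w \<longleftrightarrow> (\<exists>D. (F has_derivative D) (at w) \<and> (\<forall>v. D (\<i> *s v) = \<i> * D v))"
  by (simp add: complex_differentiable_within_def)

lemma vector_scalar_mult_complex:
  fixes v :: "complex^'n"
  shows "\<zeta> *s v = Re \<zeta> *\<^sub>R v + Im \<zeta> *\<^sub>R (\<i> *s v)"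
  by (simp add: vec_eq_iff complex_eq_iff)

lemma norm_vector_scalar_mult:
  fixes v :: "complex^'n"
  shows "norm (\<zeta> *s v) = norm \<zeta> * norm v"
  by (simp add: norm_vec_def norm_mult L2_set_right_distrib)

lemma bounded_linear_vector_scalar_mult_left: "bounded_linear (\<lambda>\<zeta>::complex. \<zeta> *s (v :: complex^'n))"
  by (rule bounded_linearI'[where f = "\<lambda>\<zeta>. \<zeta> *s v"]) (auto simp: vec_eq_iff algebra_simps)

lemma continuous_on_vector_scalar_mult [continuous_intros]:
  fixes f :: "'a::topological_space \<Rightarrow> complex" and g :: "'a \<Rightarrow> complex^'n"
  assumes "continuous_on S f" "continuous_on S g"
  shows "continuous_on S (\<lambda>x. f x *s g x)"
  unfolding vector_scalar_mult_def using assms by (auto intro!: continuous_intros)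

lemma complex_linear_derivative:
  assumes "(F has_derivative D) (at (w :: complex^'n))" "\<And>v. D (\<i> *s v) = \<i> * (D v :: complex)"
  shows "D (\<zeta> *s v) = \<zeta> * D v"
proof -
  interpret bounded_linear D
    using assms(1) by (rule has_derivative_bounded_linear)
  show ?thesis
    unfolding vector_scalar_mult_complex[of \<zeta> v] add scaleR assms(2)
    by (simp add: complex_eq_iff algebra_simps)
qed

lemma cdiff_const: "cdiff (\<lambda>_. c) w"
  unfolding cdiff_def by (intro exI[of _ "\<lambda>_. 0"]) auto

lemma bounded_linear_imp_cdiff:
  assumes "bounded_linear F" "\<And>v. F (\<i> *s v) = \<i> * F v"
  shows "cdiff F w"
  unfolding cdiff_def using assms bounded_linear_imp_has_derivative by blast

lemma cdiff_nth: "cdiff (\<lambda>w. w $ j) w"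
  by (rule bounded_linear_imp_cdiff) (auto intro: bounded_linear_vec_nth)

lemma cdiff_add:
  assumes "cdiff F w" "cdiff G w"
  shows "cdiff (\<lambda>w. F w + G w) w"
proof -
  obtain D E where "(F has_derivative D) (at w)" "(G has_derivative E) (at w)"
    and "\<forall>v. D (\<i> *s v) = \<i> * D v" "\<forall>v. E (\<i> *s v) = \<i> * E v"
    using assms by (auto simp: cdiff_def)
  then show ?thesis
    unfolding cdiff_def
    by (intro exI[of _ "\<lambda>v. D v + E v"]) (auto intro!: derivative_intros simp: algebra_simps)
qed

lemma cdiff_mult:
  assumes "cdiff F w" "cdiff G w"
  shows "cdiff (\<lambda>w. F w * G w) w"
proof -
  obtain D E where "(F has_derivative D) (at w)" "(G has_derivative E) (at w)"
    and "\<forall>v. D (\<i> *s v) = \<i> * D v" "\<forall>v. E (\<i> *s v) = \<i> * E v"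
    using assms by (auto simp: cdiff_def)
  then show ?thesis
    unfolding cdiff_def
    by (intro exI[of _ "\<lambda>v. F w * E v + D v * G w"] conjI has_derivative_mult) (auto simp: algebra_simps)
qed

lemma cdiff_compose_field:
  assumes "cdiff F w" "(f has_field_derivative d) (at (F w))"
  shows "cdiff (\<lambda>w. f (F w)) w"
proof -
  obtain D where D: "(F has_derivative D) (at w)" "\<forall>v. D (\<i> *s v) = \<i> * D v"
    using assms by (auto simp: cdiff_def)
  have "(f has_derivative (*) d) (at (F w))"
    using assms(2) by (simp add: has_field_derivative_def)
  from has_derivative_compose[OF D(1) this] D(2) show ?thesis
    unfolding cdiff_def by (intro exI[of _ "\<lambda>v. d * D v"]) auto
qed

lemma cdiff_minus:
  assumes "cdiff F w"
  shows "cdiff (\<lambda>w. - F w) w"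
  using cdiff_mult[OF cdiff_const[of "-1"] assms] by simp

lemma cdiff_diff:
  assumes "cdiff F w" "cdiff G w"
  shows "cdiff (\<lambda>w. F w - G w) w"
  using cdiff_add[OF assms(1) cdiff_minus[OF assms(2)]] by simp

lemma cdiff_power:
  assumes "cdiff F w"
  shows "cdiff (\<lambda>w. F w ^ n) w"
  by (induction n) (simp_all add: cdiff_const cdiff_mult assms)

lemma cdiff_sum:
  assumes "\<And>j. j \<in> I \<Longrightarrow> cdiff (F j) w"
  shows "cdiff (\<lambda>w. \<Sum>j\<in>I. F j w) w"
  using assms
proof (induction I rule: infinite_finite_induct)
  case (insert j I)
  have "cdiff (\<lambda>w. F j w + (\<Sum>j\<in>I. F j w)) w"
    by (rule cdiff_add[OF insert.prems insert.IH]) (use insert.prems in blast)+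
  then show ?case
    by (simp only: sum.insert[OF insert.hyps])
next
  case (infinite I)
  then show ?case
    using cdiff_const[of 0 w] by (simp only: sum.infinite[OF infinite.hyps])
next
  case empty
  then show ?case
    using cdiff_const[of 0 w] by (simp only: sum.empty)
qed

lemma cdiff_divide:
  assumes "cdiff F w" "cdiff G w" "G w \<noteq> 0"
  shows "cdiff (\<lambda>w. F w / G w) w"
proof -
  have "cdiff (\<lambda>w. inverse (G w)) w"
    by (rule cdiff_compose_field[OF assms(2) DERIV_inverse[OF assms(3)]])
  then show ?thesis
    using cdiff_mult[OF assms(1)] by (simp add: divide_inverse)
qed

lemma cdiff_imp_continuous: "cdiff F w \<Longrightarrow> isCont F w"
  by (auto simp: cdiff_def intro: has_derivative_continuous)

lemma vector_complex_derivative: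
  fixes S :: "'a::real_normed_vector \<Rightarrow> complex^'m"
  assumes "\<And>j. ((\<lambda>w. S w $ j) has_derivative D j) (at w)"
  shows "(S has_derivative (\<lambda>v. \<chi> j. D j v)) (at w)"
proof -
  have "((\<lambda>w. S w $ j \<bullet> b) has_derivative (\<lambda>v. D j v \<bullet> b)) (at w)" for j b
    using assms by (rule has_derivative_inner_left)
  then show ?thesis
    by (subst has_derivative_componentwise_within) (auto simp: Basis_vec_def inner_axis)
qed

lemma cdiff_compose:
  fixes S :: "complex^'n \<Rightarrow> complex^'m"
  assumes "\<And>j. cdiff (\<lambda>w. S w $ j) w" "cdiff F (S w)"
  shows "cdiff (\<lambda>w. F (S w)) w"
proof -
  obtain D where D: "\<And>j. ((\<lambda>w. S w $ j) has_derivative D j) (at w)" "\<And>j v. D j (\<i> *s v) = \<i> * D j v"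
    using assms(1) unfolding cdiff_def by metis
  have S: "(S has_derivative (\<lambda>v. \<chi> j. D j v)) (at w)"
    using D(1) by (rule vector_complex_derivative)
  obtain E where E: "(F has_derivative E) (at (S w))" "\<forall>v. E (\<i> *s v) = \<i> * E v"
    using assms(2) by (auto simp: cdiff_def)
  have "(\<chi> j. D j (\<i> *s v)) = \<i> *s (\<chi> j. D j v)" for v
    by (simp add: vec_eq_iff D(2))
  then show ?thesis
    unfolding cdiff_def
    by (intro exI[of _ "\<lambda>v. E (\<chi> j. D j v)"]) (use has_derivative_compose[OF S E(1)] E(2) in auto)
qed

lemma cdiff_line:
  assumes "(F has_derivative D) (at (x + \<zeta> *s v :: complex^'n))" "\<And>v. D (\<i> *s v) = \<i> * (D v :: complex)"
  shows "((\<lambda>\<zeta>. F (x + \<zeta> *s v)) has_field_derivative D v) (at \<zeta>)"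
proof -
  have "((\<lambda>\<zeta>. x + \<zeta> *s v) has_derivative (\<lambda>h. h *s v)) (at \<zeta>)"
    by (auto intro!: derivative_eq_intros bounded_linear_imp_has_derivative bounded_linear_vector_scalar_mult_left)
  from has_derivative_compose[OF this assms(1)] show ?thesis
    by (simp add: has_field_derivative_def complex_linear_derivative[OF assms] mult_commute_abs)
qed

lemma holomorphic_on_line:
  assumes "\<And>\<zeta>. \<zeta> \<in> S \<Longrightarrow> cdiff F (x + \<zeta> *s v)"
  shows "(\<lambda>\<zeta>. F (x + \<zeta> *s v)) holomorphic_on S"
  unfolding holomorphic_on_def
proof
  fix \<zeta> assume "\<zeta> \<in> S"
  then have "cdiff F (x + \<zeta> *s v)"
    by (rule assms)
  then have "(\<lambda>\<zeta>. F (x + \<zeta> *s v)) field_differentiable (at \<zeta>)"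
    unfolding cdiff_def field_differentiable_def using cdiff_line by blast
  then show "(\<lambda>\<zeta>. F (x + \<zeta> *s v)) field_differentiable (at \<zeta> within S)"
    by (rule field_differentiable_at_within)
qed

section \<open>Cauchy integrals and holomorphic dependence on parameters\<close>

lemma vector_derivative_circlepath_0:
  "vector_derivative (circlepath 0 \<rho>) (at s) = 2 * of_real pi * \<i> * circlepath 0 \<rho> s"
  unfolding vector_derivative_circlepath by (simp add: circlepath)

text \<open>Cauchy's formula with the contour integral pulled back to {0..1}: the derivative of the
  circle is 2 pi \<i> times the circle itself, which cancels the prefactor and leaves one factor
  \<open>circlepath 0 \<rho> s\<close>. In this form the integral can be differentiated in
  parameters.\<close>

lemma Cauchy_mean:
  assumes "f holomorphic_on ball 0 R" "0 < \<rho>" "\<rho> < R" "norm z < \<rho>"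
  shows "((\<lambda>s. f (circlepath 0 \<rho> s) * circlepath 0 \<rho> s / (circlepath 0 \<rho> s - z)) has_integral f z) {0..1}"
proof -
  have "continuous_on (cball 0 \<rho>) f" "f holomorphic_on ball 0 \<rho>"
    using assms by (auto intro!: holomorphic_on_imp_continuous_on elim!: holomorphic_on_subset)
  then have "((\<lambda>u. f u / (u - z)) has_contour_integral (2 * of_real pi * \<i> * f z)) (circlepath 0 \<rho>)"
    using assms by (intro Cauchy_integral_circlepath) auto
  then have "((\<lambda>s. f (circlepath 0 \<rho> s) / (circlepath 0 \<rho> s - z) * (2 * of_real pi * \<i> * circlepath 0 \<rho> s))
      has_integral (2 * of_real pi * \<i> * f z)) {0..1}"
    by (simp only: has_contour_integral vector_derivative_circlepath_0)
  from has_integral_mult_right[OF this, of "1 / (2 * of_real pi * \<i>)"] show ?thesis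
    by (simp add: mult_ac)
qed

lemma Cauchy_mean_deriv:
  assumes "f holomorphic_on ball 0 R" "0 < \<rho>" "\<rho> < R"
  shows "((\<lambda>s. f (circlepath 0 \<rho> s) / circlepath 0 \<rho> s) has_integral deriv f 0) {0..1}"
proof -
  let ?g = "\<lambda>u. f u / (u - 0)\<^sup>2"
  have "continuous_on (cball 0 \<rho>) f" "f holomorphic_on ball 0 \<rho>"
    using assms by (auto intro!: holomorphic_on_imp_continuous_on elim!: holomorphic_on_subset)
  from Cauchy_derivative_integral_circlepath[OF this, of 0]
  have *: "?g contour_integrable_on circlepath 0 \<rho>"
    "deriv f 0 = 1 / (2 * of_real pi * \<i>) * contour_integral (circlepath 0 \<rho>) ?g"
    using assms(2) by (auto intro: DERIV_imp_deriv)
  have nz: "circlepath 0 \<rho> s \<noteq> 0" for s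
    using assms(2) by (simp add: circlepath)
  have "(?g has_contour_integral (2 * of_real pi * \<i> * deriv f 0)) (circlepath 0 \<rho>)"
    using has_contour_integral_integral[OF *(1)] *(2) by simp
  then have "((\<lambda>s. ?g (circlepath 0 \<rho> s) * (2 * of_real pi * \<i> * circlepath 0 \<rho> s))
      has_integral (2 * of_real pi * \<i> * deriv f 0)) {0..1}"
    by (simp only: has_contour_integral vector_derivative_circlepath_0)
  from has_integral_mult_right[OF this, of "1 / (2 * of_real pi * \<i>)"] show ?thesis
    using nz by (simp add: power2_eq_square mult_ac)
qed

lemma continuous_on_circlepath: "continuous_on S (circlepath z r)"
  unfolding circlepath by (intro continuous_intros)

lemma norm_circlepath [simp]: "norm (circlepath 0 r s) = \<bar>r\<bar>"
proof -
  have "2 * complex_of_real pi * \<i> * complex_of_real s = \<i> * complex_of_real (2 * pi * s)"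
    by simp
  then show ?thesis
    by (simp only: circlepath add_0 norm_mult norm_exp_i_times) simp
qed

text \<open>The Leibniz rule wants a derivative that is jointly continuous in w and t, and this has
  to be derived. Cauchy's formula on a small circle writes the derivative in each direction as an
  integral of values of \<Phi>, and that integral is jointly continuous.\<close>

lemma cdiff_integral:
  fixes \<Phi> :: "complex^'n \<Rightarrow> real \<Rightarrow> complex"
  assumes U: "open U" "w0 \<in> U"
    and cont: "continuous_on (U \<times> {0..1}) (\<lambda>(w, t). \<Phi> w t)"
    and cdiff: "\<And>w t. w \<in> U \<Longrightarrow> t \<in> {0..1} \<Longrightarrow> cdiff (\<lambda>w. \<Phi> w t) w"
  shows "cdiff (\<lambda>w. integral {0..1} (\<Phi> w)) w0"
proof -
  have "\<forall>w t. \<exists>D. w \<in> U \<and> t \<in> {0..1} \<longrightarrow>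
      ((\<lambda>w. \<Phi> w t) has_derivative D) (at w) \<and> (\<forall>v. D (\<i> *s v) = \<i> * D v)"
    using cdiff unfolding cdiff_def by meson
  then obtain D where D: "\<And>w t. w \<in> U \<Longrightarrow> t \<in> {0..1} \<Longrightarrow> ((\<lambda>w. \<Phi> w t) has_derivative D w t) (at w)"
    "\<And>w t v. w \<in> U \<Longrightarrow> t \<in> {0..1} \<Longrightarrow> D w t (\<i> *s v) = \<i> * D w t v"
    by metis
  obtain R where R: "R > 0" "ball w0 R \<subseteq> U"
    using U openE by blast
  define r where "r = R / 2"
  have r: "r > 0" "\<And>w \<zeta> b. w \<in> ball w0 r \<Longrightarrow> norm \<zeta> < r \<Longrightarrow> norm b = 1 \<Longrightarrow> w + \<zeta> *s b \<in> U"
  proof -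
    fix w b :: "complex^'n" and \<zeta> :: complex
    assume *: "w \<in> ball w0 r" "norm \<zeta> < r" "norm b = 1"
    have "dist w0 (w + \<zeta> *s b) \<le> dist w0 w + norm (\<zeta> *s b)"
      by (metis add_diff_cancel_left' dist_commute dist_norm dist_triangle)
    with * have "dist w0 (w + \<zeta> *s b) < R"
      by (simp add: norm_vector_scalar_mult r_def)
    then show "w + \<zeta> *s b \<in> U"
      using R(2) by auto
  qed (use R in \<open>simp add: r_def\<close>)
  have BU: "ball w0 r \<subseteq> U"
    using R unfolding r_def by (smt (verit) field_sum_of_halves mem_ball subset_iff)
  define c where "c = circlepath 0 (r / 2)"
  have c: "norm (c s) < r" "c s \<noteq> 0" for s
    using r(1) norm_circlepath[of "r / 2" s] norm_eq_zero[of "c s"] by (simp_all add: c_def del: norm_eq_zero)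
  \<comment> \<open>The derivative as an element of the Banach space of bounded linear maps, where
    \<open>leibniz_rule\<close> integrates it; continuity there can be tested on basis
    vectors.\<close>
  define fx where "fx w t = Blinfun (D w t)" for w t
  have fx: "blinfun_apply (fx w t) = D w t" if "w \<in> U" "t \<in> {0..1}" for w t
    unfolding fx_def using D(1)[OF that] by (intro bounded_linear_Blinfun_apply has_derivative_bounded_linear)
  have D_eq: "D w t b = integral (cbox 0 1) (\<lambda>s. \<Phi> (w + c s *s b) t / c s)"
    if "w \<in> ball w0 r" "t \<in> {0..1}" "norm b = 1" for w t b
  proof -
    let ?f = "\<lambda>\<zeta>. \<Phi> (w + \<zeta> *s b) t"
    have "?f holomorphic_on ball 0 r"
      using r(2) that cdiff by (intro holomorphic_on_line) auto
    then have "((\<lambda>s. ?f (c s) / c s) has_integral deriv ?f 0) {0..1}"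
      unfolding c_def using r(1) by (intro Cauchy_mean_deriv[of _ r]) auto
    moreover have "deriv ?f 0 = D w t b"
      using D[of w t] BU that by (intro DERIV_imp_deriv cdiff_line) auto
    ultimately show ?thesis
      by (auto simp: integral_unique)
  qed
  have cont_fx: "continuous_on (ball w0 r \<times> cbox 0 1) (\<lambda>(w, t). fx w t)"
  proof (rule continuous_on_blinfun_componentwise)
    fix b :: "complex^'n"
    assume "b \<in> Basis"
    then have b: "norm b = 1" by simp
    have "continuous_on (ball w0 r \<times> cbox 0 1)
        (\<lambda>p. integral (cbox 0 1) (\<lambda>s. \<Phi> (fst p + c s *s b) (snd p) / c s))"
    proof (rule integral_continuous_on_param)
      have "continuous_on ((ball w0 r \<times> cbox 0 1) \<times> cbox 0 1)
          (\<lambda>q. (case (fst (fst q) + c (snd q) *s b, snd (fst q)) of (w, t) \<Rightarrow> \<Phi> w t) / c (snd q))"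
      proof (intro continuous_on_divide continuous_on_compose2[OF cont] continuous_on_Pair
          continuous_on_add continuous_on_vector_scalar_mult continuous_on_const)
        show "continuous_on ((ball w0 r \<times> cbox 0 1) \<times> cbox 0 1) (\<lambda>q. c (snd q))"
          unfolding c_def by (intro continuous_on_compose2[OF continuous_on_circlepath[of UNIV]]
              continuous_on_snd continuous_on_id) auto
        then show "continuous_on ((ball w0 r \<times> cbox 0 1) \<times> cbox 0 1) (\<lambda>q. c (snd q))" .
      qed (use r b c in \<open>auto intro!: continuous_intros r(2)[unfolded mem_ball]\<close>)
      then show "continuous_on ((ball w0 r \<times> cbox 0 1) \<times> cbox 0 1)
          (\<lambda>(p, s). \<Phi> (fst p + c s *s b) (snd p) / c s)"
        by (simp add: case_prod_unfold)
    qed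
    moreover have "blinfun_apply (case p of (w, t) \<Rightarrow> fx w t) b
        = integral (cbox 0 1) (\<lambda>s. \<Phi> (fst p + c s *s b) (snd p) / c s)"
      if "p \<in> ball w0 r \<times> cbox 0 1" for p
      using that D_eq[of "fst p" "snd p" b] fx BU b by auto
    ultimately show "continuous_on (ball w0 r \<times> cbox 0 1) (\<lambda>p. blinfun_apply (case p of (w, t) \<Rightarrow> fx w t) b)"
      by (simp cong: continuous_on_cong)
  qed
  have cont_slice: "continuous_on (cbox 0 1) (\<Phi> w)" if "w \<in> U" for w
    using continuous_on_compose2[OF cont continuous_on_Pair[OF continuous_on_const continuous_on_id],
        of w "cbox 0 1"] that by (simp add: image_subset_iff)
  have deriv: "((\<lambda>w. integral (cbox 0 1) (\<Phi> w)) has_derivative integral (cbox 0 1) (fx w0))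
      (at w0 within ball w0 r)"
  proof (rule leibniz_rule[OF _ _ cont_fx])
    show "((\<lambda>x. \<Phi> x t) has_derivative blinfun_apply (fx x t)) (at x within ball w0 r)"
      if "x \<in> ball w0 r" "t \<in> cbox 0 1" for x t
    proof -
      have "x \<in> U" "t \<in> {0..1}"
        using that BU by auto
      then show ?thesis
        using D(1) fx by (simp add: has_derivative_at_withinI)
    qed
    show "\<Phi> x integrable_on cbox 0 1" if "x \<in> ball w0 r" for x
      using cont_slice that BU by (intro integrable_continuous) auto
  qed (use r in auto)
  have int: "fx w0 integrable_on cbox 0 1"
    using continuous_on_compose2[OF cont_fx continuous_on_Pair[OF continuous_on_const continuous_on_id],
        of w0 "cbox 0 1"] r(1) by (intro integrable_continuous) (simp add: image_subset_iff)
  have apply_int: "integral (cbox 0 1) (fx w0) v = integral (cbox 0 1) (\<lambda>t. D w0 t v)" for v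
  proof -
    have "integral (cbox 0 1) (fx w0) v = integral (cbox 0 1) (\<lambda>t. fx w0 t v)"
      using integral_linear[OF int blinfun.bounded_linear_left] by (simp add: o_def)
    also have "\<dots> = integral (cbox 0 1) (\<lambda>t. D w0 t v)"
      using fx U(2) by (intro integral_cong) auto
    finally show ?thesis .
  qed
  have "integral (cbox 0 1) (fx w0) (\<i> *s v) = \<i> * integral (cbox 0 1) (fx w0) v" for v
  proof -
    have "integral (cbox 0 1) (\<lambda>t. D w0 t (\<i> *s v)) = integral (cbox 0 1) (\<lambda>t. \<i> * D w0 t v)"
      using D(2) U(2) by (intro integral_cong) auto
    then show ?thesis
      unfolding apply_int by (simp only: integral_mult_right)
  qed
  moreover have "((\<lambda>w. integral {0..1} (\<Phi> w)) has_derivative integral (cbox 0 1) (fx w0)) (at w0)"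
    using deriv at_within_open[of w0 "ball w0 r"] r(1) by simp
  ultimately show ?thesis
    unfolding cdiff_def by blast
qed

section \<open>Identity theorem and division along complex lines\<close>

lemma open_line_ball: "open {\<zeta>. x + \<zeta> *s v \<in> ball (p :: complex^'n) r}"
proof -
  have "continuous_on UNIV (\<lambda>\<zeta>. x + \<zeta> *s v)"
    by (intro continuous_intros)
  then have "open ((\<lambda>\<zeta>. x + \<zeta> *s v) -` ball p r)"
    by (intro open_vimage open_ball)
  then show ?thesis
    by (simp only: vimage_def)
qed

lemma convex_line_ball: "convex {\<zeta>. x + \<zeta> *s v \<in> ball (p :: complex^'n) r}"
proof -
  have "linear (\<lambda>\<zeta>. \<zeta> *s v)"
    using bounded_linear_vector_scalar_mult_left bounded_linear.linear by blast
  then have "convex ((\<lambda>\<zeta>. \<zeta> *s v) -` ((+) (- x) ` ball p r))"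
    by (intro convex_linear_vimage convex_translation convex_ball)
  moreover have "(\<lambda>\<zeta>. \<zeta> *s v) -` ((+) (- x) ` ball p r) = {\<zeta>. x + \<zeta> *s v \<in> ball p r}"
  proof -
    have "z \<in> (+) (- x) ` ball p r \<longleftrightarrow> x + z \<in> ball p r" for z
    proof
      assume "x + z \<in> ball p r"
      then show "z \<in> (+) (- x) ` ball p r"
        by (intro image_eqI[of _ _ "x + z"]) simp_all
    qed auto
    then show ?thesis
      by (simp only: vimage_def)
  qed
  ultimately show ?thesis
    by simp
qed

text \<open>Points a and b with F a and G b nonzero are joined by a complex line. On its
  intersection with the ball, which is convex and hence connected, F stays nonzero near a, so G
  vanishes near a and therefore at b.\<close>

lemma cdiff_zero_product:
  assumes "\<And>w. w \<in> ball p r \<Longrightarrow> cdiff F w" "\<And>w. w \<in> ball p r \<Longrightarrow> cdiff G w"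
    and "\<And>w. w \<in> ball p r \<Longrightarrow> F w * G w = 0"
  shows "(\<forall>w\<in>ball p r. F w = 0) \<or> (\<forall>w\<in>ball p r. G w = 0)"
proof (rule ccontr)
  assume "\<not> ?thesis"
  then obtain a b where ab: "a \<in> ball p r" "F a \<noteq> 0" "b \<in> ball p r" "G b \<noteq> 0"
    by blast
  define d where "d = b - a"
  have d: "a + 1 *s d = b" "a + 0 *s d = a"
    by (simp_all add: d_def)
  let ?S = "{\<zeta>. a + \<zeta> *s d \<in> ball p r}"
  let ?f = "\<lambda>\<zeta>. F (a + \<zeta> *s d)" and ?g = "\<lambda>\<zeta>. G (a + \<zeta> *s d)"
  have S: "open ?S" "connected ?S" "0 \<in> ?S" "1 \<in> ?S"
    using ab open_line_ball convex_connected[OF convex_line_ball] d by auto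
  have hol: "?f holomorphic_on ?S" "?g holomorphic_on ?S"
    using assms by (auto intro!: holomorphic_on_line)
  have "isCont ?f 0"
    using continuous_on_interior[OF holomorphic_on_imp_continuous_on[OF hol(1)], of 0] S
    by (simp add: interior_open)
  moreover have "?f 0 \<noteq> 0"
    using ab d by simp
  ultimately obtain e where e: "e > 0" "\<And>\<zeta>. dist \<zeta> 0 < e \<Longrightarrow> ?f \<zeta> \<noteq> 0"
    using continuous_at_avoid[of 0 ?f 0] by (auto simp: dist_commute)
  have "?g 1 = 0"
  proof (rule analytic_continuation_open[of "ball 0 e \<inter> ?S" ?S ?g "\<lambda>_. 0"])
    show "?g \<zeta> = 0" if "\<zeta> \<in> ball 0 e \<inter> ?S" for \<zeta>
      using assms(3)[of "a + \<zeta> *s d"] e(2)[of \<zeta>] that by (auto simp: dist_commute)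
    show "ball 0 e \<inter> ?S \<noteq> {}"
      using S(3) e(1) by (intro ex_in_conv[THEN iffD1] exI[of _ 0]) auto
  qed (use S hol e(1) in auto)
  then show False
    using ab d by simp
qed

lemma cdiff_identity:
  assumes "\<And>w. w \<in> ball p r \<Longrightarrow> cdiff F w" "a \<in> ball p r" "s > 0"
    and "\<And>w. w \<in> ball a s \<Longrightarrow> w \<in> ball p r \<Longrightarrow> F w = 0" and "b \<in> ball p r"
  shows "F b = 0"
proof -
  define d where "d = b - a"
  have d: "a + 1 *s d = b" "a + 0 *s d = a"
    by (simp_all add: d_def)
  let ?S = "{\<zeta>. a + \<zeta> *s d \<in> ball p r}" and ?T = "{\<zeta>. a + \<zeta> *s d \<in> ball a s}"
  let ?f = "\<lambda>\<zeta>. F (a + \<zeta> *s d)"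
  have "?f 1 = 0"
  proof (rule analytic_continuation_open[of "?T \<inter> ?S" ?S ?f "\<lambda>_. 0"])
    show "?f holomorphic_on ?S"
      using assms by (auto intro!: holomorphic_on_line)
    show "?T \<inter> ?S \<noteq> {}"
      using assms d by (intro ex_in_conv[THEN iffD1] exI[of _ 0]) auto
    show "open (?T \<inter> ?S)" "open ?S"
      using open_line_ball by blast+
    show "connected ?S"
      using convex_line_ball convex_connected by blast
  qed (use assms d in auto)
  then show ?thesis
    using d by simp
qed

text \<open>At a simple zero (z - z0) / g z has a finite limit, so one more factor z - z0 sends the
  product to 0; if g z0 is nonzero this is plain continuity. Up to a constant, the norm of the
  product bounds |(z - z0) B / N|^2 in \<open>holomorphic_quotient\<close>.\<close>

lemma simple_zero_quotient_limit:
  fixes g :: "complex \<Rightarrow> complex"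
  assumes "g field_differentiable at z0" "g z0 = 0 \<Longrightarrow> deriv g z0 \<noteq> 0"
  shows "\<forall>\<^sub>F z in at z0. g z \<noteq> 0" "((\<lambda>z. (z - z0) * ((z - z0) / g z)) \<longlongrightarrow> 0) (at z0)"
proof -
  have id: "((\<lambda>z. z - z0) \<longlongrightarrow> 0) (at z0)"
    by (rule LIM_zero) (rule tendsto_ident_at)
  have "(\<forall>\<^sub>F z in at z0. g z \<noteq> 0) \<and> ((\<lambda>z. (z - z0) * ((z - z0) / g z)) \<longlongrightarrow> 0) (at z0)"
  proof (cases "g z0 = 0")
    case True
    have "(g has_field_derivative deriv g z0) (at z0)"
      using assms(1) by (simp add: field_differentiable_derivI)
    then have *: "((\<lambda>z. g z / (z - z0)) \<longlongrightarrow> deriv g z0) (at z0)"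
      using True by (simp add: has_field_derivative_iff)
    have "\<forall>\<^sub>F z in at z0. g z / (z - z0) \<noteq> 0"
      using * assms(2)[OF True] by (rule tendsto_imp_eventually_ne)
    then have "\<forall>\<^sub>F z in at z0. g z \<noteq> 0"
      by eventually_elim auto
    moreover have "((\<lambda>z. (z - z0) * inverse (g z / (z - z0))) \<longlongrightarrow> 0 * inverse (deriv g z0)) (at z0)"
      using id * assms(2)[OF True] by (intro tendsto_mult tendsto_inverse)
    ultimately show ?thesis
      by simp
  next
    case False
    have *: "(g \<longlongrightarrow> g z0) (at z0)"
      using field_differentiable_imp_continuous_at[OF assms(1)] by (simp add: isCont_def)
    then have "((\<lambda>z. (z - z0) * ((z - z0) / g z)) \<longlongrightarrow> 0 * (0 / g z0)) (at z0)"
      using id False by (intro tendsto_mult tendsto_divide)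
    then show ?thesis
      using tendsto_imp_eventually_ne[OF * False] by simp
  qed
  then show "\<forall>\<^sub>F z in at z0. g z \<noteq> 0" "((\<lambda>z. (z - z0) * ((z - z0) / g z)) \<longlongrightarrow> 0) (at z0)"
    by auto
qed

text \<open>With g = 1 this is Riemann's theorem. In general |B / N|^2 may grow like 1 / |g|, that
  is like 1 / |z - z0| at a simple zero of g; growth of order one half is too slow for a
  pole.\<close>

lemma holomorphic_quotient:
  fixes B N g :: "complex \<Rightarrow> complex"
  assumes S: "open S" "connected S"
    and hol: "B holomorphic_on S" "N holomorphic_on S" "g holomorphic_on S"
    and N: "z1 \<in> S" "N z1 \<noteq> 0"
    and bound: "\<And>z. z \<in> S \<Longrightarrow> (norm (B z))\<^sup>2 * norm (g z) \<le> C * (norm (N z))\<^sup>2"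
    and simple: "\<And>z. z \<in> S \<Longrightarrow> g z = 0 \<Longrightarrow> deriv g z \<noteq> 0"
  obtains h where "h holomorphic_on S" "\<And>z. z \<in> S \<Longrightarrow> B z = h z * N z"
proof -
  define f where "f z = B z / N z" for z
  have main: "remove_sings f analytic_on {z0} \<and> B z0 = remove_sings f z0 * N z0" if z0: "z0 \<in> S" for z0
  proof (cases "N z0 = 0")
    case False
    have "f analytic_on {z0}"
      unfolding f_def using hol S z0 False
      by (intro analytic_on_divide) (auto simp: analytic_at)
    then show ?thesis
      using False by (auto simp: remove_sings_analytic_on f_def)
  next
    case True
    obtain r where r: "0 < r" "ball z0 r \<subseteq> S" "\<And>z. z \<in> ball z0 r - {z0} \<Longrightarrow> N z \<noteq> 0"
      using isolated_zeros[OF hol(2) S z0 True N] by blast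
    have f: "f holomorphic_on (ball z0 r - {z0})"
      unfolding f_def using hol r by (intro holomorphic_on_divide) (auto elim!: holomorphic_on_subset)
    have gd: "g field_differentiable at z0"
      using hol(3) S(1) z0 holomorphic_on_imp_differentiable_at by blast
    have g: "\<forall>\<^sub>F z in at z0. g z \<noteq> 0" "((\<lambda>z. (z - z0) * ((z - z0) / g z)) \<longlongrightarrow> 0) (at z0)"
      using simple_zero_quotient_limit[OF gd] simple[OF z0] by blast+
    have ball: "\<forall>\<^sub>F z in at z0. z \<in> ball z0 r - {z0}"
      using eventually_at_in_open[of "ball z0 r" z0] r(1) by simp
    have "\<forall>\<^sub>F z in at z0. norm ((z - z0) * f z) \<le> sqrt (C * norm ((z - z0) * ((z - z0) / g z)))"
      using ball g(1)
    proof eventually_elim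
      case (elim z)
      have "(norm (B z))\<^sup>2 * norm (g z) \<le> C * (norm (N z))\<^sup>2" "N z \<noteq> 0"
        using elim r(2,3) bound[of z] by auto
      then have "(norm (f z))\<^sup>2 \<le> C / norm (g z)"
        using elim(2) by (simp add: f_def norm_divide power_divide field_simps)
      then have "(norm (z - z0))\<^sup>2 * (norm (f z))\<^sup>2 \<le> (norm (z - z0))\<^sup>2 * (C / norm (g z))"
        by (intro mult_left_mono) auto
      then show ?case
        by (intro real_le_rsqrt) (simp add: norm_mult norm_divide power_mult_distrib power2_eq_square mult_ac)
    qed
    moreover have "((\<lambda>z. sqrt (C * norm ((z - z0) * ((z - z0) / g z)))) \<longlongrightarrow> sqrt (C * norm (0::complex))) (at z0)"
      using g(2) by (intro tendsto_intros)
    ultimately have "((\<lambda>z. (z - z0) * f z) \<longlongrightarrow> 0) (at z0)"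
      by (intro Lim_null_comparison[of "\<lambda>z. (z - z0) * f z"]) auto
    then obtain k where k: "k holomorphic_on ball z0 r" "\<forall>z\<in>ball z0 r - {z0}. k z = f z"
      using holomorphic_on_extend_lim[OF f] r(1) by auto
    have "isCont k z0"
      using k(1) r(1) by (meson centre_in_ball holomorphic_on_imp_continuous_on continuous_on_eq_continuous_at open_ball)
    then have "k \<midarrow>z0\<rightarrow> k z0"
      by (simp add: isCont_def)
    moreover have "\<forall>\<^sub>F z in at z0. k z = f z"
      using ball by eventually_elim (use k(2) in auto)
    ultimately have lim: "f \<midarrow>z0\<rightarrow> k z0"
      using tendsto_cong by force
    have "isolated_singularity_at f z0"
      using f r(1) by (intro isolated_singularity_at_holomorphic[of f "ball z0 r"]) auto
    then have an: "remove_sings f analytic_on {z0}"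
      using lim by (rule remove_sings_analytic_at)
    have "isCont N z0" "isCont B z0"
      using hol S(1) z0 by (meson holomorphic_on_imp_continuous_on continuous_on_eq_continuous_at)+
    then have *: "N \<midarrow>z0\<rightarrow> N z0" "B \<midarrow>z0\<rightarrow> B z0"
      by (simp_all add: isCont_def)
    have "(\<lambda>z. f z * N z) \<midarrow>z0\<rightarrow> k z0 * N z0"
      by (intro tendsto_mult lim *)
    moreover have "\<forall>\<^sub>F z in at z0. f z * N z = B z"
      using ball by eventually_elim (use r(3) in \<open>auto simp: f_def\<close>)
    ultimately have "B \<midarrow>z0\<rightarrow> k z0 * N z0"
      using tendsto_cong by force
    with * have "B z0 = k z0 * N z0"
      using tendsto_unique trivial_limit_at by blast
    then show ?thesis
      using an lim remove_sings_eqI by metis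
  qed
  show thesis
  proof
    show "remove_sings f holomorphic_on S"
      using main analytic_imp_holomorphic analytic_on_analytic_at by blast
  qed (use main in auto)
qed

text \<open>The quotient is recovered from its values on a circle in the direction \<open>v\<close>, which avoids the
  zeros of the denominator.\<close>

lemma cdiff_quotient:
  fixes p v :: "complex^'n"
  assumes cdiff: "\<And>w. w \<in> ball p r \<Longrightarrow> cdiff B w" "\<And>w. w \<in> ball p r \<Longrightarrow> cdiff N w"
      "\<And>w. w \<in> ball p r \<Longrightarrow> cdiff g w"
    and v: "p + v \<in> ball p r" "N (p + v) \<noteq> 0"
    and bound: "\<And>w. w \<in> ball p r \<Longrightarrow> (norm (B w))\<^sup>2 * norm (g w) \<le> C * (norm (N w))\<^sup>2"
    and simple: "\<And>w s. s > 0 \<Longrightarrow>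
      \<exists>w'\<in>ball w s. \<forall>\<zeta>. g (w' + \<zeta> *s v) = 0 \<longrightarrow> deriv (\<lambda>\<zeta>. g (w' + \<zeta> *s v)) \<zeta> \<noteq> 0"
  obtains \<beta> d where "d > 0" "\<And>w. w \<in> ball p d \<Longrightarrow> cdiff \<beta> w" "\<And>w. w \<in> ball p d \<Longrightarrow> B w = \<beta> w * N w"
proof -
  have r: "r > 0" "norm v < r"
    using v(1) by (auto simp: dist_norm intro: le_less_trans[OF norm_ge_zero])
  have shift: "w + \<zeta> *s v \<in> ball p r" if "w \<in> ball p e" "norm \<zeta> * norm v \<le> r - e" for w \<zeta> e
  proof -
    have "dist p (w + \<zeta> *s v) \<le> dist p w + norm (\<zeta> *s v)"
      by (metis add_diff_cancel_left' dist_commute dist_norm dist_triangle)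
    with that show ?thesis
      by (simp add: norm_vector_scalar_mult)
  qed
  let ?L = "{\<zeta>. p + \<zeta> *s v \<in> ball p r}"
  have "(\<lambda>\<zeta>. N (p + \<zeta> *s v)) holomorphic_on ?L"
    using cdiff(2) by (intro holomorphic_on_line) auto
  moreover have "1 \<in> ?L" "0 \<in> ?L"
    using v(1) r(1) by auto
  moreover have "open ?L" "connected ?L"
    using open_line_ball convex_connected[OF convex_line_ball] by blast+
  \<comment> \<open>N does not vanish identically on the line through p in direction v, since N (p +
    v) is nonzero; hence its zeros there are isolated.\<close>
  ultimately obtain e0 where e0: "e0 > 0" "\<And>\<zeta>. norm \<zeta> < e0 \<Longrightarrow> \<zeta> \<noteq> 0 \<Longrightarrow> N (p + \<zeta> *s v) \<noteq> 0"
  proof (cases "N p = 0")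
    case True
    then show ?thesis
      using isolated_zeros[of "\<lambda>\<zeta>. N (p + \<zeta> *s v)" ?L 0 1] that v(2)
        \<open>(\<lambda>\<zeta>. N (p + \<zeta> *s v)) holomorphic_on ?L\<close> \<open>1 \<in> ?L\<close> \<open>0 \<in> ?L\<close> \<open>open ?L\<close> \<open>connected ?L\<close>
      by (metis (no_types, lifting) DiffI add.right_neutral dist_0_norm mem_ball singletonD
          vector_smult_lid vector_smult_lzero)
  next
    case False
    have "isCont (\<lambda>\<zeta>. N (p + \<zeta> *s v)) 0"
      using \<open>(\<lambda>\<zeta>. N (p + \<zeta> *s v)) holomorphic_on ?L\<close> \<open>0 \<in> ?L\<close> \<open>open ?L\<close>
      by (meson holomorphic_on_imp_continuous_on continuous_on_eq_continuous_at)
    with False show ?thesis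
      using continuous_at_avoid[of 0 "\<lambda>\<zeta>. N (p + \<zeta> *s v)" 0] that by auto
  qed
  \<comment> \<open>Below e0 the circle of radius \<epsilon> around p avoids the zeros of N. The
    second bound gives 2 \<epsilon> |v| <= r / 2, so discs of twice that radius around points of the
    half ball stay in \<open>ball p r\<close>; the + 1 allows v = 0.\<close>
  define \<epsilon> where "\<epsilon> = min (e0 / 2) (r / (4 * (norm v + 1)))"
  have \<epsilon>: "\<epsilon> > 0" "\<epsilon> < e0"
    using e0(1) r(1) min.cobounded1[of "e0 / 2" "r / (4 * (norm v + 1))"]
    by (auto simp: \<epsilon>_def add_nonneg_pos)
  have \<epsilon>v: "2 * \<epsilon> * norm v \<le> r / 2"
  proof -
    have "\<epsilon> * (norm v + 1) \<le> r / 4"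
    proof -
      have "\<epsilon> \<le> r / 4 / (norm v + 1)"
        unfolding \<epsilon>_def by (rule min.coboundedI2) (simp only: divide_divide_eq_left order_refl)
      then show ?thesis
        using pos_le_divide_eq[of "norm v + 1" \<epsilon> "r / 4"] add_nonneg_pos[OF norm_ge_zero zero_less_one, of v]
        by blast
    qed
    then show ?thesis
      using \<epsilon>(1) by (simp add: algebra_simps)
  qed
  define c where "c = circlepath 0 \<epsilon>"
  have c: "norm (c s) = \<epsilon>" "c s \<noteq> 0" for s
    using \<epsilon>(1) norm_circlepath[of \<epsilon> s] norm_eq_zero[of "c s"] by (simp_all add: c_def del: norm_eq_zero)
  have cont_c: "continuous_on T c" for T
    unfolding c_def by (rule continuous_on_circlepath)
  define K where "K = (\<lambda>s. p + c s *s v) ` {0..1}"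
  define W where "W = {w \<in> ball p r. N w \<noteq> 0}"
  have contN: "continuous_on (ball p r) N" and contB: "continuous_on (ball p r) B"
    using cdiff(1,2) by (auto intro!: continuous_at_imp_continuous_on cdiff_imp_continuous)
  have "compact K"
    unfolding K_def by (intro compact_continuous_image continuous_intros cont_c) auto
  moreover have "open W"
  proof -
    have "open (ball p r \<inter> N -` (- {0}))"
      using contN by (intro continuous_open_preimage) auto
    moreover have "W = ball p r \<inter> N -` (- {0})"
      by (auto simp: W_def)
    ultimately show ?thesis by simp
  qed
  moreover have "K \<subseteq> W"
  proof -
    have "p + c s *s v \<in> ball p r" for s
      using shift[of p "r/2" "c s"] r(1) c \<epsilon>v by auto
    then show ?thesis
      using e0(2) c \<epsilon> by (auto simp: K_def W_def)
  qed
  \<comment> \<open>The circle is compact in the open set W, so it can be translated by less than d0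
    without meeting a zero of N.\<close>
  ultimately obtain d0 where d0: "d0 > 0" "(\<Union>x\<in>K. ball x d0) \<subseteq> W"
    using compact_subset_open_imp_ball_epsilon_subset by metis
  define d where "d = min d0 (r / 2)"
  have d: "d > 0" "d \<le> r / 2" "d \<le> d0"
    using d0(1) r(1) by (auto simp: d_def)
  have circ: "w + c s *s v \<in> W" if "w \<in> ball p d" "s \<in> {0..1}" for w s
  proof -
    have "w + c s *s v \<in> ball (p + c s *s v) d0"
      using that(1) d(3) by (simp add: dist_norm)
    moreover have "p + c s *s v \<in> K"
      unfolding K_def using that(2) by (rule imageI)
    ultimately show ?thesis
      using d0(2) by blast
  qed
  \<comment> \<open>By Cauchy's formula at the centre this is the value at w of the quotient along
    the line, as soon as the quotient extends over the disc; it is holomorphic in w in any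
    case.\<close>
  define \<beta> where "\<beta> w = integral {0..1} (\<lambda>s. B (w + c s *s v) / N (w + c s *s v))" for w
  have cdiff_\<beta>: "cdiff \<beta> w" if w: "w \<in> ball p d" for w
    unfolding \<beta>_def
  proof (rule cdiff_integral[OF open_ball w])
    have arg: "continuous_on (ball p d \<times> {0..1}) (\<lambda>q. fst q + c (snd q) *s v)"
      by (intro continuous_intros continuous_on_compose2[OF cont_c[of UNIV]]) auto
    have "continuous_on (ball p d \<times> {0..1}) (\<lambda>q. B (fst q + c (snd q) *s v) / N (fst q + c (snd q) *s v))"
      using circ
      by (intro continuous_on_divide continuous_on_compose2[OF contB arg] continuous_on_compose2[OF contN arg])
        (auto simp: W_def)
    then show "continuous_on (ball p d \<times> {0..1}) (\<lambda>(w, s). B (w + c s *s v) / N (w + c s *s v))"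
      by (simp add: case_prod_unfold)
    show "cdiff (\<lambda>w. B (w + c s *s v) / N (w + c s *s v)) w" if "w \<in> ball p d" "s \<in> {0..1}" for w s
    proof -
      have *: "cdiff (\<lambda>w. (w + c s *s v) $ j) w" for j
        unfolding vector_add_component by (intro cdiff_add cdiff_nth cdiff_const)
      show ?thesis
        using circ[OF that] cdiff(1,2) by (intro cdiff_divide cdiff_compose[OF *]) (auto simp: W_def)
    qed
  qed
  have eq_good: "B w = \<beta> w * N w"
    if w: "w \<in> ball p d" and good: "\<forall>\<zeta>. g (w + \<zeta> *s v) = 0 \<longrightarrow> deriv (\<lambda>\<zeta>. g (w + \<zeta> *s v)) \<zeta> \<noteq> 0" for w
  proof -
    have line: "w + \<zeta> *s v \<in> ball p r" if "\<zeta> \<in> ball 0 (2 * \<epsilon>)" for \<zeta>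
    proof -
      have "norm \<zeta> * norm v \<le> 2 * \<epsilon> * norm v"
        using that by (intro mult_right_mono) auto
      then show ?thesis
        using w d(2) \<epsilon>v by (intro shift[of w d]) auto
    qed
    have c01: "c 0 \<in> ball 0 (2 * \<epsilon>)" "N (w + c 0 *s v) \<noteq> 0"
      using c \<epsilon>(1) circ[OF w, of 0] by (auto simp: W_def)
    obtain h where h: "h holomorphic_on ball 0 (2 * \<epsilon>)"
      "\<And>\<zeta>. \<zeta> \<in> ball 0 (2 * \<epsilon>) \<Longrightarrow> B (w + \<zeta> *s v) = h \<zeta> * N (w + \<zeta> *s v)"
    proof (rule holomorphic_quotient[of "ball 0 (2 * \<epsilon>)" "\<lambda>\<zeta>. B (w + \<zeta> *s v)" "\<lambda>\<zeta>. N (w + \<zeta> *s v)"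
          "\<lambda>\<zeta>. g (w + \<zeta> *s v)" "c 0" C])
    qed (use line cdiff bound good c01 in \<open>auto intro!: holomorphic_on_line simp del: mem_ball\<close>)
    have "((\<lambda>s. h (c s) * c s / (c s - 0)) has_integral h 0) {0..1}"
      unfolding c_def using h(1) \<epsilon>(1) by (intro Cauchy_mean[of _ "2 * \<epsilon>"]) auto
    then have "h 0 = integral {0..1} (\<lambda>s. h (c s))"
      using c by (simp add: integral_unique)
    also have "\<dots> = \<beta> w"
      unfolding \<beta>_def
    proof (rule integral_cong)
      fix s :: real assume "s \<in> {0..1}"
      then have "N (w + c s *s v) \<noteq> 0"
        using circ[OF w] by (simp add: W_def)
      then show "h (c s) = B (w + c s *s v) / N (w + c s *s v)"
        using h(2)[of "c s"] c \<epsilon>(1) by (simp add: field_simps)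
    qed
    finally show ?thesis
      using h(2)[of 0] \<epsilon>(1) by simp
  qed
  \<comment> \<open>Points through which g has only simple zeros in direction v are dense by
    \<open>simple\<close>, and both sides are continuous.\<close>
  have "B w = \<beta> w * N w" if w: "w \<in> ball p d" for w
  proof (rule ccontr)
    assume "B w \<noteq> \<beta> w * N w"
    let ?F = "\<lambda>w. B w - \<beta> w * N w"
    have "w \<in> ball p r"
      using w d r(1) by auto
    then have "isCont ?F w"
      by (intro cdiff_imp_continuous cdiff_diff cdiff_mult cdiff cdiff_\<beta> w)
    then obtain e where e: "e > 0" "\<And>y. dist w y < e \<Longrightarrow> ?F y \<noteq> 0"
      using continuous_at_avoid[of w ?F 0] \<open>B w \<noteq> \<beta> w * N w\<close> by auto
    obtain e' where e': "e' > 0" "ball w e' \<subseteq> ball p d"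
      using w openE open_ball by blast
    obtain w' where w': "w' \<in> ball w (min e e')"
      "\<forall>\<zeta>. g (w' + \<zeta> *s v) = 0 \<longrightarrow> deriv (\<lambda>\<zeta>. g (w' + \<zeta> *s v)) \<zeta> \<noteq> 0"
      using simple[of "min e e'" w] e(1) e'(1) by auto
    then have "w' \<in> ball p d" "?F w' \<noteq> 0"
      using e(2) e'(2) by auto
    then show False
      using eq_good w'(2) by auto
  qed
  then show thesis
    using that d(1) cdiff_\<beta> by blast
qed

section \<open>Germs on the quadric\<close>

abbreviation cdiff_near :: "(complex^'n \<Rightarrow> complex) \<Rightarrow> complex^'n \<Rightarrow> bool"
  where "cdiff_near F p \<equiv> \<forall>\<^sub>F w in nhds p. cdiff F w"

lemma eventually_nhds_ball:
  "(\<forall>\<^sub>F w in nhds (p :: 'a::metric_space). P w) \<longleftrightarrow> (\<exists>r>0. \<forall>w\<in>ball p r. P w)"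
  unfolding eventually_nhds_metric by (simp add: Ball_def dist_commute)

lemma eventually_nhds_in: "(\<forall>\<^sub>F w in nhds_in T p. P w) \<longleftrightarrow> (\<forall>\<^sub>F w in nhds p. w \<in> T \<longrightarrow> P w)"
  by (simp add: nhds_in_def eventually_inf_principal)

lemma cdiff_near_imp_isCont:
  assumes "cdiff_near F p"
  shows "isCont F p"
  using assms by (metis cdiff_imp_continuous eventually_nhds_x_imp_x)

lemma cdiff_near_mult:
  assumes "cdiff_near F p" "cdiff_near G p"
  shows "cdiff_near (\<lambda>w. F w * G w) p"
  using assms by eventually_elim (rule cdiff_mult)

lemma cdiff_near_add:
  assumes "cdiff_near F p" "cdiff_near G p"
  shows "cdiff_near (\<lambda>w. F w + G w) p"
  using assms by eventually_elim (rule cdiff_add)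

lemma cdiff_near_diff:
  assumes "cdiff_near F p" "cdiff_near G p"
  shows "cdiff_near (\<lambda>w. F w - G w) p"
  using assms by eventually_elim (rule cdiff_diff)

lemma cdiff_near_const: "cdiff_near (\<lambda>_. a) p"
  by (simp add: cdiff_const)

lemma cdiff_near_nth: "cdiff_near (\<lambda>w. w $ j) p"
  by (simp add: cdiff_nth)

lemma cdiff_near_zero_product:
  assumes "cdiff_near F p" "cdiff_near G p" "\<forall>\<^sub>F w in nhds p. F w * G w = 0"
  shows "(\<forall>\<^sub>F w in nhds p. F w = 0) \<or> (\<forall>\<^sub>F w in nhds p. G w = 0)"
proof -
  have "\<forall>\<^sub>F w in nhds p. cdiff F w \<and> cdiff G w \<and> F w * G w = 0"
    using assms by eventually_elim simp
  then obtain r where "r > 0" "\<And>w. w \<in> ball p r \<Longrightarrow> cdiff F w \<and> cdiff G w \<and> F w * G w = 0"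
    unfolding eventually_nhds_ball by blast
  then show ?thesis
    using cdiff_zero_product[of p r F G] unfolding eventually_nhds_ball by blast
qed

lemma cdiff_near_quotient:
  assumes "cdiff_near F p" "cdiff_near G p" "\<forall>\<^sub>F w in nhds p. norm (F w) \<le> C * norm (G w)"
    and "\<not> (\<forall>\<^sub>F w in nhds p. G w = 0)"
  shows "\<exists>H. cdiff_near H p \<and> (\<forall>\<^sub>F w in nhds p. F w = H w * G w)"
proof -
  have "\<forall>\<^sub>F w in nhds p. cdiff F w \<and> cdiff G w \<and> norm (F w) \<le> C * norm (G w)"
    using assms(1-3) by eventually_elim simp
  then obtain r where r: "r > 0" "\<And>w. w \<in> ball p r \<Longrightarrow> cdiff F w \<and> cdiff G w \<and> norm (F w) \<le> C * norm (G w)"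
    unfolding eventually_nhds_ball by blast
  obtain x where x: "x \<in> ball p r" "G x \<noteq> 0"
    using assms(4) r(1) unfolding eventually_nhds_ball by blast
  have bound: "(norm (F w))\<^sup>2 * norm (1::complex) \<le> C\<^sup>2 * (norm (G w))\<^sup>2" if "w \<in> ball p r" for w
    using r(2)[OF that] power_mono[of "norm (F w)" "C * norm (G w)" 2] by (simp add: power_mult_distrib)
  obtain \<beta> d where "d > 0" "\<And>w. w \<in> ball p d \<Longrightarrow> cdiff \<beta> w" "\<And>w. w \<in> ball p d \<Longrightarrow> F w = \<beta> w * G w"
  proof (rule cdiff_quotient[of p r F G "\<lambda>_. 1" "x - p" "C\<^sup>2"])
    show "p + (x - p) \<in> ball p r" "G (p + (x - p)) \<noteq> 0"
      using x by auto
    show "\<exists>w'\<in>ball w s. \<forall>\<zeta>. (1::complex) = 0 \<longrightarrow> deriv (\<lambda>\<zeta>. 1::complex) \<zeta> \<noteq> 0" if "s > 0" for w :: "complex^'n" and s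
      using that by (intro bexI[of _ w]) auto
  qed (use r bound in \<open>auto simp: cdiff_const simp del: mem_ball\<close>)
  then show ?thesis
    unfolding eventually_nhds_ball by blast
qed

text \<open>The second condition implies normality: a fraction that satisfies an integral equation is bounded
  where its denominator does not vanish.\<close>

definition germs_divisible :: "(complex^'n) set \<Rightarrow> complex^'n \<Rightarrow> bool"
  where "germs_divisible T p \<longleftrightarrow>
    (\<forall>F G. cdiff_near F p \<longrightarrow> cdiff_near G p \<longrightarrow> (\<forall>\<^sub>F w in nhds_in T p. F w * G w = 0) \<longrightarrow>
      (\<forall>\<^sub>F w in nhds_in T p. F w = 0) \<or> (\<forall>\<^sub>F w in nhds_in T p. G w = 0)) \<and>
    (\<forall>F G C. cdiff_near F p \<longrightarrow> cdiff_near G p \<longrightarrow>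
      (\<forall>\<^sub>F w in nhds_in T p. norm (F w) \<le> C * norm (G w)) \<longrightarrow> \<not> (\<forall>\<^sub>F w in nhds_in T p. G w = 0) \<longrightarrow>
      (\<exists>H. cdiff_near H p \<and> (\<forall>\<^sub>F w in nhds_in T p. F w = H w * G w)))"

text \<open>Precomposition with S extends a germ on \<open>T\<close> to a full neighbourhood of p
  and preserves products and bounds. The results for C^n are applied to F and G composed with S and
  restricted back to \<open>T\<close>, where S is the identity.\<close>

lemma germs_divisible_retract:
  assumes S: "\<And>j. cdiff_near (\<lambda>w. S w $ j) p" "S p = p"
    and into: "\<forall>\<^sub>F w in nhds p. S w \<in> T" and id: "\<forall>\<^sub>F w in nhds p. w \<in> T \<longrightarrow> S w = w"
  shows "germs_divisible T p"
proof -
  have "isCont S p"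
    using cdiff_near_imp_isCont[OF S(1)] unfolding isCont_def by (intro vec_tendstoI) auto
  then have "filterlim S (nhds (S p)) (nhds p)"
    by (simp only: isCont_def tendsto_at_iff_tendsto_nhds)
  then have lim: "filterlim S (nhds p) (nhds p)"
    by (simp only: S(2))
  have comp: "cdiff_near (\<lambda>w. F (S w)) p" if "cdiff_near F p" for F
  proof -
    have "\<forall>\<^sub>F w in nhds p. \<forall>j. cdiff (\<lambda>w. S w $ j) w"
      using S(1) by (intro eventually_all_finite) auto
    moreover have "\<forall>\<^sub>F w in nhds p. cdiff F (S w)"
      using lim that by (rule eventually_compose_filterlim[rotated])
    ultimately show ?thesis
      by eventually_elim (auto intro: cdiff_compose)
  qed
  have pull: "\<forall>\<^sub>F w in nhds p. P (S w)" if "\<forall>\<^sub>F w in nhds_in T p. P w" for P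
  proof -
    have "\<forall>\<^sub>F w in nhds p. w \<in> T \<longrightarrow> P w"
      using that by (simp add: eventually_nhds_in)
    then have "\<forall>\<^sub>F w in nhds p. S w \<in> T \<longrightarrow> P (S w)"
      using lim by (rule eventually_compose_filterlim)
    with into show ?thesis
      by eventually_elim auto
  qed
  have push: "\<forall>\<^sub>F w in nhds_in T p. P w" if "\<forall>\<^sub>F w in nhds p. Q w" "\<And>w. Q w \<Longrightarrow> S w = w \<Longrightarrow> P w" for P Q
    unfolding eventually_nhds_in using that(1) id by eventually_elim (use that(2) in auto)
  show ?thesis
    unfolding germs_divisible_def
  proof (intro conjI allI impI)
    fix F G :: "complex^'a \<Rightarrow> complex"
    assume "cdiff_near F p" "cdiff_near G p" "\<forall>\<^sub>F w in nhds_in T p. F w * G w = 0"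
    then have "(\<forall>\<^sub>F w in nhds p. F (S w) = 0) \<or> (\<forall>\<^sub>F w in nhds p. G (S w) = 0)"
      using pull[of "\<lambda>w. F w * G w = 0"] by (intro cdiff_near_zero_product comp)
    then show "(\<forall>\<^sub>F w in nhds_in T p. F w = 0) \<or> (\<forall>\<^sub>F w in nhds_in T p. G w = 0)"
      using push[of "\<lambda>w. F (S w) = 0" "\<lambda>w. F w = 0"] push[of "\<lambda>w. G (S w) = 0" "\<lambda>w. G w = 0"]
      by auto
  next
    fix F G :: "complex^'a \<Rightarrow> complex" and C :: real
    assume *: "cdiff_near F p" "cdiff_near G p" "\<forall>\<^sub>F w in nhds_in T p. norm (F w) \<le> C * norm (G w)"
      "\<not> (\<forall>\<^sub>F w in nhds_in T p. G w = 0)"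
    have "\<not> (\<forall>\<^sub>F w in nhds p. G (S w) = 0)"
      using *(4) push[of "\<lambda>w. G (S w) = 0" "\<lambda>w. G w = 0"] by auto
    then obtain H where H: "cdiff_near H p" "\<forall>\<^sub>F w in nhds p. F (S w) = H w * G (S w)"
      using cdiff_near_quotient[OF comp[OF *(1)] comp[OF *(2)] pull[OF *(3)]] by blast
    have "\<forall>\<^sub>F w in nhds_in T p. F w = H w * G w"
      using H(2) by (rule push) simp
    with H(1) show "\<exists>H. cdiff_near H p \<and> (\<forall>\<^sub>F w in nhds_in T p. F w = H w * G w)"
      by blast
  qed
qed

lemma germs_divisible_UNIV: "germs_divisible UNIV p"
  by (rule germs_divisible_retract[where S = "\<lambda>w. w"]) (auto simp: cdiff_nth)

section \<open>The quadric as a double cover near the origin\<close>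

definition upd :: "'n::finite \<Rightarrow> complex^'n \<Rightarrow> complex \<Rightarrow> complex^'n"
  where "upd k w z = (\<chi> j. if j = k then z else w $ j)"

text \<open>The polynomial h of the overview when the coordinate \<open>k\<close> plays the role of
  z.\<close>

definition sum_sq_except :: "'n::finite \<Rightarrow> complex^'n \<Rightarrow> complex"
  where "sum_sq_except k w = (\<Sum>j\<in>UNIV - {k}. (w $ j)\<^sup>2)"

lemma upd_nth: "upd k w z $ j = (if j = k then z else w $ j)"
  by (simp add: upd_def)

lemma upd_self [simp]: "upd k w (w $ k) = w"
  by (simp add: vec_eq_iff upd_nth)

lemma upd_line: "upd k w \<zeta> = upd k w 0 + \<zeta> *s axis k 1"
  by (simp add: vec_eq_iff upd_nth axis_def)

lemma sum_sq_except_upd [simp]: "sum_sq_except k (upd k w z) = sum_sq_except k w"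
  unfolding sum_sq_except_def by (rule sum.cong) (auto simp: upd_nth)

lemma quadric_iff: "w \<in> quadric \<longleftrightarrow> (w $ k)\<^sup>2 = - sum_sq_except k w"
proof -
  have "(\<Sum>j\<in>UNIV. (w $ j)\<^sup>2) = (w $ k)\<^sup>2 + sum_sq_except k w"
    unfolding sum_sq_except_def by (rule sum.remove) auto
  then show ?thesis
    by (simp add: quadric_def eq_neg_iff_add_eq_0)
qed

lemma cdiff_sum_sq_except: "cdiff (sum_sq_except k) w"
  unfolding sum_sq_except_def[abs_def] by (intro cdiff_sum cdiff_power cdiff_nth)

lemma cdiff_upd: "cdiff (\<lambda>w. upd k w \<zeta> $ j) w"
  by (cases "j = k") (simp_all add: upd_nth cdiff_const cdiff_nth)

lemma norm_sum_sq_except: "norm (sum_sq_except k w) \<le> (norm w)\<^sup>2"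
proof -
  have "norm (sum_sq_except k w) \<le> (\<Sum>j\<in>UNIV - {k}. (norm (w $ j))\<^sup>2)"
    unfolding sum_sq_except_def by (rule order_trans[OF norm_sum]) (simp add: norm_power)
  also have "\<dots> \<le> (\<Sum>j\<in>UNIV. (norm (w $ j))\<^sup>2)"
    by (rule sum_mono2) auto
  also have "\<dots> = (norm w)\<^sup>2"
    by (simp add: norm_vec_def L2_set_def sum_nonneg)
  finally show ?thesis .
qed

lemma norm_upd: "norm (upd k w z) \<le> norm w + norm z"
proof -
  have "norm (upd k w 0) \<le> norm w"
    by (rule norm_le_componentwise_cart) (simp add: upd_nth)
  moreover have "norm (z *s (axis k 1 :: complex^'a)) = norm z"
    by (simp add: norm_vector_scalar_mult)
  ultimately show ?thesis
    unfolding upd_line[of k w z] by (metis add_mono norm_triangle_mono order_refl)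
qed

lemma continuous_on_upd [continuous_intros]:
  assumes "continuous_on S f" "continuous_on S g"
  shows "continuous_on S (\<lambda>x. upd k (f x) (g x))"
  unfolding upd_def
proof (rule continuous_on_vec_lambda)
  show "continuous_on S (\<lambda>x. if j = k then g x else f x $ j)" for j
    using assms by (cases "j = k") (auto intro!: continuous_intros)
qed

text \<open>Weierstrass division by z^2 + h. Where z^2 = - h, the Cauchy kernel c / (c - z) equals
  (c^2 + c z) / (c^2 + h), and the two summands of this fraction give A and B, integrals in which z
  no longer occurs.\<close>

lemma cdiff_near_even_odd:
  fixes F :: "complex^'n \<Rightarrow> complex" and k :: 'n
  assumes "cdiff_near F 0"
  obtains A B where "cdiff_near A 0" "cdiff_near B 0" "\<And>w z. A (upd k w z) = A w" "\<And>w z. B (upd k w z) = B w"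
    "\<forall>\<^sub>F w in nhds 0. w \<in> quadric \<longrightarrow> F w = A w + B w * w $ k"
proof -
  let ?g = "sum_sq_except k"
  obtain r where r: "r > 0" "\<And>w. w \<in> ball 0 r \<Longrightarrow> cdiff F w"
    using assms unfolding eventually_nhds_ball by blast
  \<comment> \<open>If |w| < \<rho> and |\<zeta>| < 2 \<rho>, then \<open>upd k w \<zeta>\<close>
    has norm below 3 \<rho>, and F is holomorphic there.\<close>
  define \<rho> where "\<rho> = min 1 (r / 3)"
  have \<rho>: "\<rho> > 0" "\<rho> \<le> 1" "3 * \<rho> \<le> r"
    using r(1) by (auto simp: \<rho>_def)
  define c where "c = circlepath 0 \<rho>"
  have c: "norm (c s) = \<rho>" for s
    using \<rho>(1) by (simp add: c_def)
  have cont_c: "continuous_on T c" for T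
    unfolding c_def by (rule continuous_on_circlepath)
  have contF: "continuous_on (ball 0 r) F"
    using r(2) by (auto intro!: continuous_at_imp_continuous_on cdiff_imp_continuous)
  have cont_g: "continuous_on T ?g" for T
    by (auto intro!: continuous_at_imp_continuous_on cdiff_imp_continuous cdiff_sum_sq_except)
  have upd_in: "upd k w \<zeta> \<in> ball 0 r" if "w \<in> ball 0 \<rho>" "norm \<zeta> < 2 * \<rho>" for w \<zeta>
    using that \<rho> norm_upd[of k w \<zeta>] by auto
  have upd_c: "upd k w (c s) \<in> ball 0 r" if "w \<in> ball 0 \<rho>" for w s
    using upd_in[OF that, of "c s"] c \<rho>(1) by simp
  \<comment> \<open>On the circle |c^2| = \<rho>^2 exceeds |h w| <= |w|^2, so the kernel has no
    pole.\<close>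
  have denom: "(c s)\<^sup>2 + ?g w \<noteq> 0" if "w \<in> ball 0 \<rho>" for w s
  proof
    assume "(c s)\<^sup>2 + ?g w = 0"
    then have "norm ((c s)\<^sup>2) = norm (?g w)"
      by (metis add_eq_0_iff norm_minus_cancel)
    then have "\<rho>\<^sup>2 \<le> (norm w)\<^sup>2"
      using norm_sum_sq_except[of k w] c by (simp add: norm_power)
    moreover have "(norm w)\<^sup>2 < \<rho>\<^sup>2"
      using that by (intro power_strict_mono) auto
    ultimately show False by simp
  qed
  \<comment> \<open>The weight m is c^2 for the even part A and c for the odd part B.\<close>
  define \<Phi> where "\<Phi> m w s = F (upd k w (c s)) * m s / ((c s)\<^sup>2 + ?g w)" for m w s
  have cont: "continuous_on (ball 0 \<rho> \<times> {0..1}) (\<lambda>(w, s). \<Phi> m w s)" if "continuous_on UNIV m" for m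
  proof -
    have cs: "continuous_on (ball 0 \<rho> \<times> {0..1}) (\<lambda>q::(complex^'n) \<times> real. c (snd q))"
      by (intro continuous_on_compose2[OF cont_c[of UNIV]] continuous_intros) auto
    have "continuous_on (ball 0 \<rho> \<times> {0..1})
        (\<lambda>q. F (upd k (fst q) (c (snd q))) * m (snd q) / ((c (snd q))\<^sup>2 + ?g (fst q)))"
      using upd_c denom
      by (intro continuous_intros cs continuous_on_compose2[OF contF] continuous_on_compose2[OF that]
          continuous_on_compose2[OF cont_g[of UNIV]]) (auto simp del: mem_ball)
    then show ?thesis
      by (simp add: \<Phi>_def case_prod_unfold)
  qed
  have cdiff_\<Phi>: "cdiff (\<lambda>w. integral {0..1} (\<Phi> m w)) w" if "continuous_on UNIV m" "w \<in> ball 0 \<rho>" for m w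
  proof (rule cdiff_integral[OF open_ball that(2) cont[OF that(1)]])
    show "cdiff (\<lambda>w. \<Phi> m w s) w" if "w \<in> ball 0 \<rho>" for w s
      unfolding \<Phi>_def using r(2)[OF upd_c[OF that]] denom[OF that]
      by (intro cdiff_divide cdiff_mult cdiff_add cdiff_const cdiff_sum_sq_except cdiff_compose[OF cdiff_upd])
  qed
  have int: "\<Phi> m w integrable_on {0..1}" if "continuous_on UNIV m" "w \<in> ball 0 \<rho>" for m w
  proof -
    have "continuous_on (cbox 0 1) (\<Phi> m w)"
      using continuous_on_compose2[OF cont[OF that(1)] continuous_on_Pair[OF continuous_on_const continuous_on_id],
          of w "cbox 0 1"] that(2) by (simp add: image_subset_iff)
    then show ?thesis
      using integrable_continuous by fastforce
  qed
  define A where "A w = integral {0..1} (\<Phi> (\<lambda>s. (c s)\<^sup>2) w)" for w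
  define B where "B w = integral {0..1} (\<Phi> c w)" for w
  have m: "continuous_on UNIV (\<lambda>s. (c s)\<^sup>2)" "continuous_on UNIV c"
    using cont_c by (auto intro!: continuous_intros)
  show thesis
  proof
    show "cdiff_near A 0" "cdiff_near B 0"
      unfolding eventually_nhds_ball A_def[abs_def] B_def[abs_def] using \<rho>(1) cdiff_\<Phi> m by blast+
    have "upd k (upd k w z) \<zeta> = upd k w \<zeta>" for w z \<zeta>
      by (simp add: vec_eq_iff upd_nth)
    then show "A (upd k w z) = A w" "B (upd k w z) = B w" for w z
      by (simp_all add: A_def B_def \<Phi>_def[abs_def])
    have "F w = A w + B w * w $ k" if w: "w \<in> ball 0 \<rho>" "w \<in> quadric" for w
    proof -
      let ?z = "w $ k"
      have z: "norm ?z < \<rho>" "?z\<^sup>2 = - ?g w"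
        using w Finite_Cartesian_Product.norm_nth_le[of w k] quadric_iff by (auto intro: le_less_trans)
      have "(\<lambda>\<zeta>. F (upd k w 0 + \<zeta> *s axis k 1)) holomorphic_on ball 0 (2 * \<rho>)"
        using r(2) upd_in[OF w(1)]
        by (intro holomorphic_on_line) (simp only: upd_line[of k w, symmetric] dist_0_norm mem_ball)
      then have "(\<lambda>\<zeta>. F (upd k w \<zeta>)) holomorphic_on ball 0 (2 * \<rho>)"
        by (simp only: upd_line[of k w, symmetric])
      then have "((\<lambda>s. F (upd k w (c s)) * c s / (c s - ?z)) has_integral F (upd k w ?z)) {0..1}"
        unfolding c_def using z(1) \<rho>(1) by (intro Cauchy_mean) auto
      then have "F w = integral {0..1} (\<lambda>s. F (upd k w (c s)) * c s / (c s - ?z))"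
        by (simp add: integral_unique)
      also have "\<dots> = integral {0..1} (\<lambda>s. \<Phi> (\<lambda>s. (c s)\<^sup>2) w s + \<Phi> c w s * ?z)"
      proof (rule integral_cong)
        fix s :: real
        have g: "?g w = - ?z\<^sup>2"
          using z(2) by simp
        have factor: "(c s)\<^sup>2 + - ?z\<^sup>2 = (c s - ?z) * (c s + ?z)"
          by (simp add: algebra_simps power2_eq_square)
        have nz: "c s + ?z \<noteq> 0"
          using denom[OF w(1), of s] unfolding g factor by simp
        have "\<Phi> (\<lambda>s. (c s)\<^sup>2) w s + \<Phi> c w s * ?z
            = (F (upd k w (c s)) * (c s)\<^sup>2 + F (upd k w (c s)) * c s * ?z) / ((c s - ?z) * (c s + ?z))"
          unfolding \<Phi>_def g factor by (simp only: add_divide_distrib times_divide_eq_left)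
        also have "F (upd k w (c s)) * (c s)\<^sup>2 + F (upd k w (c s)) * c s * ?z
            = F (upd k w (c s)) * c s * (c s + ?z)"
          by (simp only: power2_eq_square distrib_left mult.assoc)
        also have "\<dots> / ((c s - ?z) * (c s + ?z)) = F (upd k w (c s)) * c s / (c s - ?z)"
          using nz by (rule nonzero_mult_divide_mult_cancel_right)
        finally show "F (upd k w (c s)) * c s / (c s - ?z) = \<Phi> (\<lambda>s. (c s)\<^sup>2) w s + \<Phi> c w s * ?z" ..
      qed
      also have "\<dots> = A w + B w * ?z"
        unfolding A_def B_def using int[OF m(1) w(1)] int[OF m(2) w(1)]
        by (subst integral_add) (auto intro: integrable_on_mult_left)
      finally show ?thesis .
    qed
    then show "\<forall>\<^sub>F w in nhds 0. w \<in> quadric \<longrightarrow> F w = A w + B w * w $ k"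
      unfolding eventually_nhds_ball using \<rho>(1) by blast
  qed
qed

lemma upd_in_quadric:
  assumes "z\<^sup>2 = - sum_sq_except k w"
  shows "upd k w z \<in> quadric"
  using assms by (simp add: quadric_iff[of _ k] upd_nth)

text \<open>Both points of the double cover over a small w are small, because |z|^2 = |h w| <=
  |w|^2. So a property of the quadric near 0 holds at both points over every w near 0.\<close>

lemma eventually_quadric_upd:
  fixes k :: "'n::finite"
  assumes "\<forall>\<^sub>F w in nhds 0. w \<in> quadric \<longrightarrow> P w"
  shows "\<forall>\<^sub>F w in nhds 0. \<forall>z. z\<^sup>2 = - sum_sq_except k w \<longrightarrow> P (upd k w z)"
proof -
  obtain r where r: "r > 0" "\<And>w. w \<in> ball 0 r \<Longrightarrow> w \<in> quadric \<Longrightarrow> P w"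
    using assms unfolding eventually_nhds_ball by blast
  have "P (upd k w z)" if w: "w \<in> ball 0 (r / 2)" and z: "z\<^sup>2 = - sum_sq_except k w" for w z
  proof -
    have "(norm z)\<^sup>2 \<le> (norm w)\<^sup>2"
      using norm_sum_sq_except[of k w] z by (metis norm_minus_cancel norm_power)
    then have "norm z \<le> norm w"
      by (simp add: power2_le_iff_abs_le)
    then have "upd k w z \<in> ball 0 r"
      using norm_upd[of k w z] w by auto
    then show ?thesis
      using r(2) upd_in_quadric[OF z] by blast
  qed
  then show ?thesis
    unfolding eventually_nhds_ball using r(1) by (intro exI[of _ "r / 2"]) auto
qed

lemma cdiff_near_sum_sq_except: "cdiff_near (sum_sq_except k) p"
  by (simp add: cdiff_sum_sq_except)

lemma ex_two_others:
  assumes "CARD('n::finite) \<ge> 3"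
  obtains i j :: "'n::finite" where "i \<noteq> k" "j \<noteq> k" "i \<noteq> j"
proof -
  have "card (UNIV - {k}) \<ge> 2"
    using assms by (simp add: card_Diff_singleton)
  then obtain i j where "i \<in> UNIV - {k}" "j \<in> UNIV - {k}" "i \<noteq> j"
    by (metis card_le_Suc0_iff_eq finite not_less_eq_eq numeral_2_eq_2)
  then show thesis
    using that by blast
qed

text \<open>Vectors in a coordinate plane; for i and j different from \<open>k\<close> and from each
  other, h reduces there to a^2 + b^2.\<close>

definition pair_vec :: "'n::finite \<Rightarrow> 'n \<Rightarrow> complex \<Rightarrow> complex \<Rightarrow> complex^'n"
  where "pair_vec i j a b = (\<chi> l. if l = i then a else if l = j then b else 0)"

lemma sum_pair_vec:
  assumes "i \<noteq> k" "j \<noteq> k" "i \<noteq> j" "\<And>l. f l 0 = 0"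
  shows "(\<Sum>l\<in>UNIV - {k}. f l (pair_vec i j a b $ l)) = f i a + (f j b :: complex)"
proof -
  have "(\<Sum>l\<in>UNIV - {k}. f l (pair_vec i j a b $ l)) = (\<Sum>l\<in>{i, j}. f l (pair_vec i j a b $ l))"
    using assms by (intro sum.mono_neutral_right) (auto simp: pair_vec_def)
  then show ?thesis
    using assms by (simp add: pair_vec_def)
qed

lemma sum_sq_except_pair_vec:
  assumes "i \<noteq> k" "j \<noteq> k" "i \<noteq> j"
  shows "sum_sq_except k (pair_vec i j a b) = a\<^sup>2 + b\<^sup>2"
  unfolding sum_sq_except_def using sum_pair_vec[OF assms, of "\<lambda>l x. x\<^sup>2"] by simp

lemma norm_pair_vec: "norm (pair_vec i j a b) \<le> norm a + norm b"
proof -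
  have "pair_vec i j a b = (if i = j then axis i a else axis i a + axis j b)"
    by (auto simp: vec_eq_iff pair_vec_def axis_def)
  moreover have "norm (axis l x :: complex^'a) = norm x" for l x
  proof -
    have "(axis l x :: complex^'a) = x *s axis l 1"
      by (simp add: vec_eq_iff axis_def)
    then show ?thesis
      by (simp add: norm_vector_scalar_mult)
  qed
  moreover from this have "norm (axis i a + axis j b :: complex^'a) \<le> norm a + norm b"
    using norm_triangle_ineq[of "axis i a :: complex^'a" "axis j b"] by simp
  ultimately show ?thesis
    by auto
qed

lemma pair_vec_line: "pair_vec i j a \<zeta> = pair_vec i j a 0 + \<zeta> *s (if i = j then 0 else axis j 1)"
  by (auto simp: vec_eq_iff pair_vec_def axis_def)

text \<open>A sum of at least two squares is not minus the square of a holomorphic function, because it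
  has a simple zero on some line.\<close>

lemma norm_form_zero:
  fixes A B :: "complex^'n \<Rightarrow> complex" and k :: 'n
  assumes card: "CARD('n) \<ge> 3" and near: "cdiff_near A 0" "cdiff_near B 0"
    and zero: "\<forall>\<^sub>F w in nhds 0. (A w)\<^sup>2 + sum_sq_except k w * (B w)\<^sup>2 = 0"
  shows "\<forall>\<^sub>F w in nhds 0. A w = 0 \<and> B w = 0"
proof -
  let ?g = "sum_sq_except k"
  have "\<forall>\<^sub>F w in nhds 0. B w = 0"
  proof (rule ccontr)
    assume B0: "\<not> ?thesis"
    have "\<forall>\<^sub>F w in nhds (0 :: complex^'n). norm w < 1"
      unfolding eventually_nhds_ball by (intro exI[of _ 1]) auto
    \<comment> \<open>Near 0 the sum of squares has norm at most 1, so |A| <= |B|. The quotient A /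
      B is then a holomorphic square root of minus the sum of squares.\<close>
    with zero have "\<forall>\<^sub>F w in nhds 0. norm (A w) \<le> 1 * norm (B w)"
    proof eventually_elim
      case (elim w)
      have "(norm (A w))\<^sup>2 = norm (?g w) * (norm (B w))\<^sup>2"
        using elim(1) by (metis add_eq_0_iff norm_minus_cancel norm_mult norm_power)
      also have "\<dots> \<le> 1 * (norm (B w))\<^sup>2"
        using norm_sum_sq_except[of k w] power_mono[of "norm w" 1 2] elim(2)
        by (intro mult_right_mono) auto
      finally show ?case
        by (simp add: power2_le_iff_abs_le)
    qed
    then obtain h where h: "cdiff_near h 0" "\<forall>\<^sub>F w in nhds 0. A w = h w * B w"
      using cdiff_near_quotient[OF near _ B0] by blast
    have "\<forall>\<^sub>F w in nhds 0. (h w * h w + ?g w) * (B w * B w) = 0"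
      using zero h(2) by eventually_elim (simp add: algebra_simps power2_eq_square)
    then have "(\<forall>\<^sub>F w in nhds 0. h w * h w + ?g w = 0) \<or> (\<forall>\<^sub>F w in nhds 0. B w * B w = 0)"
      using near(2) h(1) by (intro cdiff_near_zero_product cdiff_near_mult cdiff_near_add cdiff_near_sum_sq_except)
    then have "\<forall>\<^sub>F w in nhds 0. cdiff h w \<and> h w * h w = - ?g w"
      using B0 h(1) by (auto simp: eq_neg_iff_add_eq_0 eventually_conj_iff)
    then obtain r where r: "r > 0" "\<And>w. w \<in> ball 0 r \<Longrightarrow> cdiff h w \<and> h w * h w = - ?g w"
      unfolding eventually_nhds_ball by blast
    obtain i j where ij: "i \<noteq> k" "j \<noteq> k" "i \<noteq> j"
      using ex_two_others[OF card] by metis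
    \<comment> \<open>Nonzero, and small enough that |t| + |\<zeta>| stays below r on the disc. On
      this line the sum of squares is t^2 + \<zeta>^2, with a simple zero at \<zeta> = \<i>
      t.\<close>
    define t where "t = complex_of_real (r / 4)"
    define \<phi> where "\<phi> \<zeta> = h (pair_vec i j t 0 + \<zeta> *s axis j 1)" for \<zeta>
    have line: "pair_vec i j t 0 + \<zeta> *s axis j 1 = pair_vec i j t \<zeta>" for \<zeta>
      using pair_vec_line[of i j t \<zeta>] ij by simp
    have in_ball: "pair_vec i j t \<zeta> \<in> ball 0 r" if "\<zeta> \<in> ball 0 (r / 2)" for \<zeta>
      using norm_pair_vec[of i j t \<zeta>] that r(1) by (auto simp: t_def)
    have hol: "\<phi> holomorphic_on ball 0 (r / 2)"
      unfolding \<phi>_def using r(2) in_ball by (intro holomorphic_on_line) (simp only: line)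
    define \<zeta>\<^sub>0 where "\<zeta>\<^sub>0 = \<i> * t"
    have \<zeta>\<^sub>0: "\<zeta>\<^sub>0 \<in> ball 0 (r / 2)" "\<zeta>\<^sub>0 \<noteq> 0"
      using r(1) by (auto simp: \<zeta>\<^sub>0_def t_def norm_mult)
    have \<zeta>\<^sub>0_root: "t\<^sup>2 + \<zeta>\<^sub>0\<^sup>2 = 0"
      by (simp add: \<zeta>\<^sub>0_def power_mult_distrib)
    have sq: "\<phi> \<zeta> * \<phi> \<zeta> = - (t\<^sup>2 + \<zeta>\<^sup>2)" if "\<zeta> \<in> ball 0 (r / 2)" for \<zeta>
      using r(2)[OF in_ball[OF that]] sum_sq_except_pair_vec[OF ij] by (simp add: \<phi>_def line)
    obtain d where d: "(\<phi> has_field_derivative d) (at \<zeta>\<^sub>0)"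
      using hol \<zeta>\<^sub>0(1) by (meson holomorphic_derivI open_ball)
    have "((\<lambda>\<zeta>. \<phi> \<zeta> * \<phi> \<zeta>) has_field_derivative 2 * d * \<phi> \<zeta>\<^sub>0) (at \<zeta>\<^sub>0)"
      using d by (auto intro!: derivative_eq_intros)
    moreover have "((\<lambda>\<zeta>. \<phi> \<zeta> * \<phi> \<zeta>) has_field_derivative - (2 * \<zeta>\<^sub>0)) (at \<zeta>\<^sub>0)"
    proof (rule has_field_derivative_transform_within_open)
      show "((\<lambda>\<zeta>. - (t\<^sup>2 + \<zeta>\<^sup>2)) has_field_derivative - (2 * \<zeta>\<^sub>0)) (at \<zeta>\<^sub>0)"
        by (auto intro!: derivative_eq_intros)
      show "open (ball (0::complex) (r / 2))"
        by simp
    qed (use \<zeta>\<^sub>0(1) sq in simp_all)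
    \<comment> \<open>A square has vanishing derivative at a zero, but the right-hand side is not 0
      at \<open>\<zeta>\<^sub>0\<close>.\<close>
    ultimately have "2 * d * \<phi> \<zeta>\<^sub>0 = - (2 * \<zeta>\<^sub>0)"
      by (rule DERIV_unique)
    moreover have "\<phi> \<zeta>\<^sub>0 = 0"
      using sq[OF \<zeta>\<^sub>0(1)] unfolding \<zeta>\<^sub>0_root by simp
    ultimately show False
      using \<zeta>\<^sub>0(2) by simp
  qed
  with zero show ?thesis
    by eventually_elim simp
qed

text \<open>Along a line h is a polynomial of degree at most 2 in \<zeta>, and it has a multiple
  zero or vanishes identically only if \<open>disc w'\<close> is 0. The discriminant is holomorphic
  in w' and not identically zero, so it is nonzero at points arbitrarily close to w.\<close>

lemma ex_simple_zeros_direction: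
  fixes v :: "complex^'n" and k :: 'n
  assumes ij: "i \<noteq> k" "j \<noteq> k" "i \<noteq> j" and v: "v $ i \<noteq> 0" and s: "s > 0"
  shows "\<exists>w'\<in>ball w s. \<forall>\<zeta>. sum_sq_except k (w' + \<zeta> *s v) = 0 \<longrightarrow>
    deriv (\<lambda>\<zeta>. sum_sq_except k (w' + \<zeta> *s v)) \<zeta> \<noteq> 0"
proof -
  let ?g = "sum_sq_except k"
  define b where "b w = (\<Sum>l\<in>UNIV - {k}. v $ l * w $ l)" for w
  define disc where "disc w = (b w)\<^sup>2 - ?g w * ?g v" for w
  have expand: "?g (w + \<zeta> *s v) = ?g w + 2 * \<zeta> * b w + \<zeta>\<^sup>2 * ?g v" for w \<zeta>
    by (simp add: sum_sq_except_def b_def power2_sum sum.distrib sum_distrib_left power_mult_distrib mult_ac)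
  have cdiff_disc: "cdiff disc w" for w
    unfolding disc_def[abs_def] b_def
    by (intro cdiff_diff cdiff_power cdiff_sum cdiff_mult cdiff_const cdiff_nth cdiff_sum_sq_except)
  have "\<exists>w'\<in>ball w s. disc w' \<noteq> 0"
  proof (rule ccontr)
    assume zero: "\<not> ?thesis"
    have all: "disc y = 0" if "norm y \<le> 2" for y
    proof (rule cdiff_identity[of w "norm w + 3" disc w s y])
      have "dist w y \<le> norm w + norm y"
        by (simp add: dist_norm norm_triangle_ineq4)
      then show "y \<in> ball w (norm w + 3)"
        using that by simp
      show "w \<in> ball w (norm w + 3)"
        by (simp add: add_nonneg_pos)
    qed (use zero cdiff_disc s in auto)
    have b: "b (pair_vec i j x y) = v $ i * x + v $ j * y" for x y
      unfolding b_def using sum_pair_vec[OF ij, of "\<lambda>l x. v $ l * x"] by simp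
    have "disc (pair_vec i j x y) = 0" if "norm x + norm y \<le> 2" for x y
      using all norm_pair_vec[of i j x y] that by (meson order_trans)
    \<comment> \<open>The three test vectors force v_i^2 = v_j^2 and v_i v_j = 0, hence v_i =
      0.\<close>
    from this[of 1 0] this[of 0 1] this[of 1 1]
    have "(v $ i)\<^sup>2 = ?g v" "(v $ j)\<^sup>2 = ?g v" "(v $ i + v $ j)\<^sup>2 = 2 * ?g v"
      by (simp_all add: disc_def b sum_sq_except_pair_vec[OF ij])
    then have "v $ i * v $ j = 0" "(v $ i)\<^sup>2 = (v $ j)\<^sup>2"
      by (simp_all add: power2_sum)
    then show False
      using v by auto
  qed
  then obtain w' where w': "w' \<in> ball w s" "disc w' \<noteq> 0"
    by blast
  have "deriv (\<lambda>\<zeta>. ?g (w' + \<zeta> *s v)) \<zeta> \<noteq> 0" if "?g (w' + \<zeta> *s v) = 0" for \<zeta>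
  proof
    have "((\<lambda>\<zeta>. ?g w' + 2 * \<zeta> * b w' + \<zeta>\<^sup>2 * ?g v) has_field_derivative 2 * b w' + 2 * \<zeta> * ?g v) (at \<zeta>)"
      by (auto intro!: derivative_eq_intros)
    then have "deriv (\<lambda>\<zeta>. ?g (w' + \<zeta> *s v)) \<zeta> = 2 * b w' + 2 * \<zeta> * ?g v"
      unfolding expand by (rule DERIV_imp_deriv)
    moreover assume "deriv (\<lambda>\<zeta>. ?g (w' + \<zeta> *s v)) \<zeta> = 0"
    ultimately have "2 * (b w' + \<zeta> * ?g v) = 0"
      by (simp only: distrib_left mult.assoc)
    then have "b w' + \<zeta> * ?g v = 0"
      by (simp only: mult_eq_0_iff zero_neq_numeral[symmetric] simp_thms)
    then have b: "b w' = - \<zeta> * ?g v"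
      by (simp only: eq_neg_iff_add_eq_0 mult_minus_left)
    have "?g w' - \<zeta>\<^sup>2 * ?g v = ?g (w' + \<zeta> *s v)"
      unfolding expand b by (simp add: algebra_simps power2_eq_square)
    then have "?g w' = \<zeta>\<^sup>2 * ?g v"
      using that by simp
    then show False
      using w'(2) b by (simp add: disc_def power_mult_distrib power2_eq_square)
  qed
  then show ?thesis
    using w'(1) by blast
qed

lemma cdiff_near_even_odd_values:
  fixes F :: "complex^'n \<Rightarrow> complex" and k :: 'n
  assumes "cdiff_near F 0"
  obtains A B where "cdiff_near A 0" "cdiff_near B 0"
    "\<forall>\<^sub>F w in nhds 0. w \<in> quadric \<longrightarrow> F w = A w + B w * w $ k"
    "\<forall>\<^sub>F w in nhds 0. \<forall>z. z\<^sup>2 = - sum_sq_except k w \<longrightarrow> F (upd k w z) = A w + B w * z"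
    "\<And>w z. A (upd k w z) = A w" "\<And>w z. B (upd k w z) = B w"
proof (rule cdiff_near_even_odd[OF assms, where k = k])
  fix A B :: "complex^'n \<Rightarrow> complex"
  assume AB: "cdiff_near A 0" "cdiff_near B 0"
    "\<And>w z. A (upd k w z) = A w" "\<And>w z. B (upd k w z) = B w"
    "\<forall>\<^sub>F w in nhds 0. w \<in> quadric \<longrightarrow> F w = A w + B w * w $ k"
  have "upd k w z $ k = z" for w z
    by (simp add: upd_nth)
  with eventually_quadric_upd[OF AB(5), of k]
  have "\<forall>\<^sub>F w in nhds 0. \<forall>z. z\<^sup>2 = - sum_sq_except k w \<longrightarrow> F (upd k w z) = A w + B w * z"
    by (simp only: AB(3,4))
  then show thesis
    using AB by (intro that[of A B])
qed

text \<open>The norm A^2 + h B^2 is the product of the values A + B z and A - B z at the two points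
  over w, so it is multiplicative. It is an ordinary holomorphic function near 0, and by
  \<open>norm_form_zero\<close> it vanishes only if F does.\<close>

lemma quadric_zero_product:
  fixes F G :: "complex^'n \<Rightarrow> complex"
  assumes card: "CARD('n) \<ge> 3" and near: "cdiff_near F 0" "cdiff_near G 0"
    and zero: "\<forall>\<^sub>F w in nhds 0. w \<in> quadric \<longrightarrow> F w * G w = 0"
  shows "(\<forall>\<^sub>F w in nhds 0. w \<in> quadric \<longrightarrow> F w = 0) \<or> (\<forall>\<^sub>F w in nhds 0. w \<in> quadric \<longrightarrow> G w = 0)"
proof -
  fix k :: 'n
  let ?g = "sum_sq_except k"
  obtain A B where F: "cdiff_near A 0" "cdiff_near B 0"
    "\<forall>\<^sub>F w in nhds 0. w \<in> quadric \<longrightarrow> F w = A w + B w * w $ k"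
    "\<forall>\<^sub>F w in nhds 0. \<forall>z. z\<^sup>2 = - ?g w \<longrightarrow> F (upd k w z) = A w + B w * z"
    by (rule cdiff_near_even_odd_values[OF near(1), of k]) blast
  obtain A' B' where G: "cdiff_near A' 0" "cdiff_near B' 0"
    "\<forall>\<^sub>F w in nhds 0. w \<in> quadric \<longrightarrow> G w = A' w + B' w * w $ k"
    "\<forall>\<^sub>F w in nhds 0. \<forall>z. z\<^sup>2 = - ?g w \<longrightarrow> G (upd k w z) = A' w + B' w * z"
    by (rule cdiff_near_even_odd_values[OF near(2), of k]) blast
  let ?N = "\<lambda>w. A w * A w + ?g w * (B w * B w)" and ?N' = "\<lambda>w. A' w * A' w + ?g w * (B' w * B' w)"
  have "\<forall>\<^sub>F w in nhds 0. ?N w * ?N' w = 0"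
    using F(4) G(4) eventually_quadric_upd[OF zero, of k]
  proof eventually_elim
    case (elim w)
    define z where "z = csqrt (- ?g w)"
    have z: "z\<^sup>2 = - ?g w" "(- z)\<^sup>2 = - ?g w"
      by (simp_all add: z_def)
    have g: "?g w = - (z * z)"
      using z(1) by (simp add: power2_eq_square)
    have "(A w + B w * z) * (A' w + B' w * z) = 0"
      using elim z(1) by auto
    then have "(A w + B w * z) * (A w - B w * z) * ((A' w + B' w * z) * (A' w - B' w * z)) = 0"
      by auto
    then show ?case
      unfolding g by (simp add: algebra_simps)
  qed
  then have "(\<forall>\<^sub>F w in nhds 0. ?N w = 0) \<or> (\<forall>\<^sub>F w in nhds 0. ?N' w = 0)"
    by (intro cdiff_near_zero_product cdiff_near_add cdiff_near_mult cdiff_near_sum_sq_except F G)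
  then show ?thesis
  proof
    assume "\<forall>\<^sub>F w in nhds 0. ?N w = 0"
    then have "\<forall>\<^sub>F w in nhds 0. A w = 0 \<and> B w = 0"
      by (intro norm_form_zero[OF card F(1,2), of k]) (simp add: power2_eq_square)
    with F(3) have "\<forall>\<^sub>F w in nhds 0. w \<in> quadric \<longrightarrow> F w = 0"
      by eventually_elim simp
    then show ?thesis ..
  next
    assume "\<forall>\<^sub>F w in nhds 0. ?N' w = 0"
    then have "\<forall>\<^sub>F w in nhds 0. A' w = 0 \<and> B' w = 0"
      by (intro norm_form_zero[OF card G(1,2), of k]) (simp add: power2_eq_square)
    with G(3) have "\<forall>\<^sub>F w in nhds 0. w \<in> quadric \<longrightarrow> G w = 0"
      by eventually_elim simp
    then show ?thesis ..
  qed
qed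

lemma quadric_quotient:
  fixes F G :: "complex^'n \<Rightarrow> complex"
  assumes card: "CARD('n) \<ge> 3" and near: "cdiff_near F 0" "cdiff_near G 0"
    and bound: "\<forall>\<^sub>F w in nhds 0. w \<in> quadric \<longrightarrow> norm (F w) \<le> C * norm (G w)"
    and G0: "\<not> (\<forall>\<^sub>F w in nhds 0. w \<in> quadric \<longrightarrow> G w = 0)"
  shows "\<exists>H. cdiff_near H 0 \<and> (\<forall>\<^sub>F w in nhds 0. w \<in> quadric \<longrightarrow> F w = H w * G w)"
proof -
  fix k :: 'n
  let ?g = "sum_sq_except k"
  obtain A' B' where G: "cdiff_near A' 0" "cdiff_near B' 0"
    "\<forall>\<^sub>F w in nhds 0. w \<in> quadric \<longrightarrow> G w = A' w + B' w * w $ k"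
    "\<forall>\<^sub>F w in nhds 0. \<forall>z. z\<^sup>2 = - ?g w \<longrightarrow> G (upd k w z) = A' w + B' w * z"
    "\<And>w z. A' (upd k w z) = A' w" "\<And>w z. B' (upd k w z) = B' w"
    by (rule cdiff_near_even_odd_values[OF near(2), of k]) (rule that)
  \<comment> \<open>The conjugate of G: on the quadric near 0 its value is that of G at the other
    point over w, and G G' is the norm N.\<close>
  define G' where "G' w = A' w - B' w * w $ k" for w
  define N where "N w = A' w * A' w + ?g w * (B' w * B' w)" for w
  have near_G': "cdiff_near G' 0"
    unfolding G'_def[abs_def] by (intro cdiff_near_diff cdiff_near_mult cdiff_near_nth G)
  have near_N: "cdiff_near N 0"
    unfolding N_def[abs_def] by (intro cdiff_near_add cdiff_near_mult cdiff_near_sum_sq_except G)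
  have N_G': "\<forall>\<^sub>F w in nhds 0. w \<in> quadric \<longrightarrow> G w * G' w = N w"
    using G(3)
  proof eventually_elim
    case (elim w)
    show ?case
    proof
      assume w: "w \<in> quadric"
      have "?g w = - (w $ k * w $ k)"
        using w quadric_iff[of w k] by (simp add: power2_eq_square)
      then show "G w * G' w = N w"
        using elim w by (simp add: G'_def N_def algebra_simps)
    qed
  qed
  obtain A B where P: "cdiff_near A 0" "cdiff_near B 0"
    "\<forall>\<^sub>F w in nhds 0. w \<in> quadric \<longrightarrow> F w * G' w = A w + B w * w $ k"
    "\<forall>\<^sub>F w in nhds 0. \<forall>z. z\<^sup>2 = - ?g w \<longrightarrow> F (upd k w z) * G' (upd k w z) = A w + B w * z"
    by (rule cdiff_near_even_odd_values[OF cdiff_near_mult[OF near(1) near_G'], of k]) blast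
  have N0: "\<not> (\<forall>\<^sub>F w in nhds 0. N w = 0)"
  proof
    assume "\<forall>\<^sub>F w in nhds 0. N w = 0"
    then have "\<forall>\<^sub>F w in nhds 0. A' w = 0 \<and> B' w = 0"
      by (intro norm_form_zero[OF card G(1,2), of k]) (simp add: N_def power2_eq_square)
    with G(3) have "\<forall>\<^sub>F w in nhds 0. w \<in> quadric \<longrightarrow> G w = 0"
      by eventually_elim simp
    with G0 show False ..
  qed
  have N_upd: "N (upd k w z) = N w" for w z
    by (simp add: N_def G(5,6))
  have AB_bound: "\<forall>\<^sub>F w in nhds 0. \<forall>z. z\<^sup>2 = - ?g w \<longrightarrow> norm (A w + B w * z) \<le> C * norm (N w)"
    using eventually_quadric_upd[OF bound, of k] P(4) eventually_quadric_upd[OF N_G', of k]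
  proof eventually_elim
    case (elim w)
    show ?case
    proof (intro allI impI)
      fix z assume z: "z\<^sup>2 = - ?g w"
      have N: "G (upd k w z) * G' (upd k w z) = N w"
        using elim(3) z N_upd by simp
      have "norm (F (upd k w z)) * norm (G' (upd k w z)) \<le> C * norm (G (upd k w z)) * norm (G' (upd k w z))"
        using elim(1) z by (intro mult_right_mono) auto
      also have "\<dots> = C * norm (N w)"
        by (simp add: N[symmetric] norm_mult)
      finally show "norm (A w + B w * z) \<le> C * norm (N w)"
        using elim(2) z by (simp add: norm_mult[symmetric])
    qed
  qed
  \<comment> \<open>Adding and subtracting the bounds at z and - z separates A from B z. Squaring
    the latter replaces |z|^2 by |h|, which gets rid of the two-valued root.\<close>
  have bounds: "\<forall>\<^sub>F w in nhds 0. norm (A w) \<le> C * norm (N w) \<and> (norm (B w))\<^sup>2 * norm (?g w) \<le> C\<^sup>2 * (norm (N w))\<^sup>2"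
    using AB_bound
  proof eventually_elim
    case (elim w)
    define z where "z = csqrt (- ?g w)"
    have z: "z\<^sup>2 = - ?g w" "(- z)\<^sup>2 = - ?g w"
      by (simp_all add: z_def)
    have le: "norm (A w + B w * z) \<le> C * norm (N w)" "norm (A w - B w * z) \<le> C * norm (N w)"
      using elim z(1) elim[rule_format, OF z(2)] by simp_all
    have "norm (2 * A w) \<le> norm (A w + B w * z) + norm (A w - B w * z)"
      using norm_triangle_ineq[of "A w + B w * z" "A w - B w * z"] by simp
    moreover have "2 * (B w * z) = (A w + B w * z) - (A w - B w * z)"
      by simp
    then have "norm (2 * (B w * z)) \<le> norm (A w + B w * z) + norm (A w - B w * z)"
      by (simp only: norm_triangle_ineq4)
    ultimately have AB: "norm (A w) \<le> C * norm (N w)" "norm (B w) * norm z \<le> C * norm (N w)"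
      using le by (simp_all add: norm_mult)
    have "(norm (B w) * norm z)\<^sup>2 \<le> (C * norm (N w))\<^sup>2"
      using AB(2) by (intro power_mono) auto
    moreover have "(norm z)\<^sup>2 = norm (?g w)"
      using z(1) by (metis norm_minus_cancel norm_power)
    ultimately show ?case
      using AB(1) by (simp add: power_mult_distrib)
  qed
  have "\<forall>\<^sub>F w in nhds 0. norm (A w) \<le> C * norm (N w)"
    using bounds by eventually_elim simp
  then obtain \<alpha> where \<alpha>: "cdiff_near \<alpha> 0" "\<forall>\<^sub>F w in nhds 0. A w = \<alpha> w * N w"
    using cdiff_near_quotient[OF P(1) near_N _ N0] by blast
  obtain i j where ij: "i \<noteq> k" "j \<noteq> k" "i \<noteq> j"
    using ex_two_others[OF card] by metis
  have "\<forall>\<^sub>F w in nhds 0. cdiff B w \<and> cdiff N w \<and> (norm (B w))\<^sup>2 * norm (?g w) \<le> C\<^sup>2 * (norm (N w))\<^sup>2"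
    using P(2) near_N bounds by eventually_elim simp
  then obtain r where r: "r > 0"
    "\<And>w. w \<in> ball 0 r \<Longrightarrow> cdiff B w \<and> cdiff N w \<and> (norm (B w))\<^sup>2 * norm (?g w) \<le> C\<^sup>2 * (norm (N w))\<^sup>2"
    unfolding eventually_nhds_ball by blast
  \<comment> \<open>The direction needs N v nonzero and also \<open>v $ i\<close> nonzero, the
    latter for simple zeros of h; a point with N nonzero is moved slightly along the axis i if
    necessary.\<close>
  obtain v where v: "v \<in> ball 0 r" "N v \<noteq> 0" "v $ i \<noteq> 0"
  proof -
    obtain x where x: "x \<in> ball 0 r" "N x \<noteq> 0"
      using N0 r(1) unfolding eventually_nhds_ball by blast
    show thesis
    proof (cases "x $ i = 0")
      case False
      then show thesis
        using that x by blast
    next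
      case True
      have "isCont N x"
        using r(2)[OF x(1)] by (intro cdiff_imp_continuous) blast
      then obtain e where e: "e > 0" "\<And>y. dist x y < e \<Longrightarrow> N y \<noteq> 0"
        using continuous_at_avoid[of x N 0] x(2) by auto
      obtain e' where e': "e' > 0" "ball x e' \<subseteq> ball 0 r"
        using x(1) openE open_ball by blast
      define s where "s = min e e' / 2"
      have s: "s > 0" "s < e" "s < e'"
        using e(1) e'(1) by (auto simp: s_def)
      let ?y = "x + complex_of_real s *s axis i 1"
      have "dist x ?y = s"
        using s(1) by (simp add: dist_norm norm_vector_scalar_mult)
      moreover have "?y $ i \<noteq> 0"
        using True s(1) by (simp add: axis_def)
      moreover have "?y \<in> ball 0 r"
        using e'(2) s(3) calculation(1) by (intro subsetD[OF e'(2)]) simp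
      ultimately show thesis
        using e(2) s(2) by (intro that[of ?y]) simp_all
    qed
  qed
  obtain \<beta> d where \<beta>: "d > 0" "\<And>w. w \<in> ball 0 d \<Longrightarrow> cdiff \<beta> w" "\<And>w. w \<in> ball 0 d \<Longrightarrow> B w = \<beta> w * N w"
  proof (rule cdiff_quotient[of 0 r B N ?g v "C\<^sup>2"])
    show "\<exists>w'\<in>ball w s. \<forall>\<zeta>. ?g (w' + \<zeta> *s v) = 0 \<longrightarrow> deriv (\<lambda>\<zeta>. ?g (w' + \<zeta> *s v)) \<zeta> \<noteq> 0" if "s > 0" for w s
      using ex_simple_zeros_direction[OF ij v(3) that] .
  qed (use r v in \<open>auto simp: cdiff_sum_sq_except simp del: mem_ball\<close>)
  then have \<beta>': "cdiff_near \<beta> 0" "\<forall>\<^sub>F w in nhds 0. B w = \<beta> w * N w"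
    unfolding eventually_nhds_ball by blast+
  define H where "H w = \<alpha> w + \<beta> w * w $ k" for w
  have near_H: "cdiff_near H 0"
    unfolding H_def[abs_def] by (intro cdiff_near_add cdiff_near_mult cdiff_near_nth \<alpha> \<beta>')
  \<comment> \<open>F = H G is known after multiplication by G'; since G' is not zero as a germ on
    the quadric, \<open>quadric_zero_product\<close> cancels it.\<close>
  have "\<forall>\<^sub>F w in nhds 0. w \<in> quadric \<longrightarrow> (F w - H w * G w) * G' w = 0"
    using P(3) N_G' \<alpha>(2) \<beta>'(2)
  proof eventually_elim
    case (elim w)
    show ?case
    proof
      assume "w \<in> quadric"
      with elim have "F w * G' w = \<alpha> w * (G w * G' w) + \<beta> w * (G w * G' w) * w $ k"
        by simp
      then show "(F w - H w * G w) * G' w = 0"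
        by (simp add: H_def algebra_simps)
    qed
  qed
  then have "(\<forall>\<^sub>F w in nhds 0. w \<in> quadric \<longrightarrow> F w - H w * G w = 0) \<or> (\<forall>\<^sub>F w in nhds 0. w \<in> quadric \<longrightarrow> G' w = 0)"
    by (intro quadric_zero_product card cdiff_near_diff cdiff_near_mult near near_H near_G')
  moreover have "\<not> (\<forall>\<^sub>F w in nhds 0. w \<in> quadric \<longrightarrow> G' w = 0)"
  proof
    assume "\<forall>\<^sub>F w in nhds 0. w \<in> quadric \<longrightarrow> G' w = 0"
    then have "\<forall>\<^sub>F w in nhds 0. w \<in> quadric \<longrightarrow> N w = 0"
      using N_G' by eventually_elim auto
    from eventually_quadric_upd[OF this, of k] have "\<forall>\<^sub>F w in nhds 0. N w = 0"
      unfolding N_upd by eventually_elim (use power2_csqrt in blast)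
    with N0 show False ..
  qed
  ultimately show ?thesis
    using near_H by auto
qed

lemma germs_divisible_quadric_0:
  assumes "CARD('n::finite) \<ge> 3"
  shows "germs_divisible (quadric :: (complex^'n) set) 0"
  unfolding germs_divisible_def eventually_nhds_in
  using quadric_zero_product[OF assms] quadric_quotient[OF assms] by blast

section \<open>Smooth points of the quadric\<close>

lemma power2_not_nonpos_Reals:
  assumes "Re b > 0"
  shows "b\<^sup>2 \<notin> \<real>\<^sub>\<le>\<^sub>0"
  using assms by (auto simp: complex_nonpos_Reals_iff Re_power2 Im_power2)

lemma Re_csqrt_pos:
  assumes "u \<notin> \<real>\<^sub>\<le>\<^sub>0"
  shows "Re (csqrt u) > 0"
proof (rule ccontr)
  assume "\<not> ?thesis"
  then have "Re (csqrt u) = 0"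
    using csqrt_principal[of u] by auto
  moreover have "b\<^sup>2 \<in> \<real>\<^sub>\<le>\<^sub>0" if "Re b = 0" for b
    using that by (simp add: complex_nonpos_Reals_iff Re_power2 Im_power2)
  ultimately have "(csqrt u)\<^sup>2 \<in> \<real>\<^sub>\<le>\<^sub>0"
    by blast
  with assms show False
    by simp
qed

lemma csqrt_power2:
  assumes "Re b > 0"
  shows "csqrt (b\<^sup>2) = b"
  using assms by (intro csqrt_square) simp

lemma cdiff_csqrt:
  assumes "cdiff F w" "F w \<notin> \<real>\<^sub>\<le>\<^sub>0"
  shows "cdiff (\<lambda>w. csqrt (F w)) w"
  using cdiff_compose_field[OF assms(1) has_field_derivative_csqrt[OF assms(2)]] .

lemma open_cdiff_vimage:
  assumes "\<And>w. cdiff F w" "open S"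
  shows "open {w. F w \<in> S}"
proof -
  have "continuous_on UNIV F"
    using assms(1) by (intro continuous_at_imp_continuous_on ballI cdiff_imp_continuous)
  from open_vimage[OF assms(2) this] show ?thesis
    by (simp only: vimage_def)
qed

text \<open>The retraction replaces the coordinate w_k by a square root of - h. Dividing by p_k^2
  under the root makes the argument 1 at p, away from the branch cut of \<open>csqrt\<close>, and
  selects the branch through p.\<close>

lemma germs_divisible_quadric_nonzero:
  assumes p: "p \<in> quadric" "p $ k \<noteq> 0"
  shows "germs_divisible quadric p"
proof -
  let ?g = "sum_sq_except k"
  define s where "s w = p $ k * csqrt (- ?g w / (p $ k)\<^sup>2)" for w
  have one: "- ?g p / (p $ k)\<^sup>2 = 1"
  proof -
    have "- ?g p = (p $ k)\<^sup>2"
      using quadric_iff[of p k] p(1) by simp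
    then show ?thesis
      using p(2) by (simp only: divide_self power_not_zero simp_thms)
  qed
  have cdiff_arg: "cdiff (\<lambda>w. - ?g w / (p $ k)\<^sup>2) w" for w
    using p(2) by (intro cdiff_divide cdiff_minus cdiff_sum_sq_except cdiff_const) simp
  have "open {w. - ?g w / (p $ k)\<^sup>2 \<in> - \<real>\<^sub>\<le>\<^sub>0}"
    by (rule open_cdiff_vimage[OF cdiff_arg]) (simp add: closed_nonpos_Reals_complex open_Compl)
  moreover have "p \<in> {w. - ?g w / (p $ k)\<^sup>2 \<in> - \<real>\<^sub>\<le>\<^sub>0}"
    unfolding mem_Collect_eq one by simp
  ultimately have "\<forall>\<^sub>F w in nhds p. w \<in> {w. - ?g w / (p $ k)\<^sup>2 \<in> - \<real>\<^sub>\<le>\<^sub>0}"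
    by (rule eventually_nhds_in_open)
  then have near_s: "cdiff_near s p"
    unfolding s_def[abs_def]
    by eventually_elim (intro cdiff_mult cdiff_const cdiff_csqrt cdiff_arg, simp)
  show ?thesis
  proof (rule germs_divisible_retract[where S = "\<lambda>w. upd k w (s w)"])
    show "cdiff_near (\<lambda>w. upd k w (s w) $ j) p" for j
      using near_s by (cases "j = k") (simp_all add: upd_nth cdiff_nth)
    have "s p = p $ k"
      unfolding s_def one by simp
    then show "upd k p (s p) = p"
      by simp
    have "(s w)\<^sup>2 = - ?g w" for w
      using p(2) by (simp add: s_def power_mult_distrib)
    then show "\<forall>\<^sub>F w in nhds p. upd k w (s w) \<in> quadric"
      by (simp add: upd_in_quadric)
    \<comment> \<open>Where w_k / p_k has positive real part, \<open>csqrt\<close> inverts squaring,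
      so points of the quadric are fixed.\<close>
    have "open {w. w $ k / p $ k \<in> {b. 0 < Re b}}"
      using p(2) by (intro open_cdiff_vimage cdiff_divide cdiff_nth cdiff_const open_halfspace_Re_gt)
    then have "\<forall>\<^sub>F w in nhds p. w \<in> {w. w $ k / p $ k \<in> {b. 0 < Re b}}"
      using p(2) by (intro eventually_nhds_in_open) auto
    then show "\<forall>\<^sub>F w in nhds p. w \<in> quadric \<longrightarrow> upd k w (s w) = w"
    proof eventually_elim
      case (elim w)
      show ?case
      proof
        assume "w \<in> quadric"
        then have "- ?g w / (p $ k)\<^sup>2 = (w $ k / p $ k)\<^sup>2"
          using quadric_iff[of w k] by (simp add: power_divide)
        then have "s w = w $ k"
          using elim p(2) by (simp add: s_def csqrt_power2)
        then show "upd k w (s w) = w"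
          by simp
      qed
    qed
  qed
qed

lemma germs_divisible_quadric:
  fixes p :: "complex^'n"
  assumes "CARD('n) \<ge> 3" "p \<in> quadric"
  shows "germs_divisible quadric p"
proof (cases "p = 0")
  case True
  then show ?thesis
    using germs_divisible_quadric_0[OF assms(1)] by simp
next
  case False
  then obtain k where "p $ k \<noteq> 0"
    by (auto simp: vec_eq_iff)
  then show ?thesis
    using germs_divisible_quadric_nonzero assms(2) by blast
qed

lemma holomorphic_map_onI:
  fixes h :: "complex^'n \<Rightarrow> complex^'m"
  assumes "\<And>w j. w \<in> U \<Longrightarrow> cdiff (\<lambda>w. h w $ j) w"
  shows "holomorphic_map_on h U"
  unfolding holomorphic_map_on_def complex_differentiable_within_def
proof
  fix w assume "w \<in> U"
  then have "\<forall>j. \<exists>D. ((\<lambda>w. h w $ j) has_derivative D) (at w) \<and> (\<forall>v. D (\<i> *s v) = \<i> * D v)"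
    using assms unfolding cdiff_def by blast
  then obtain D where D: "\<And>j. ((\<lambda>w. h w $ j) has_derivative D j) (at w)" "\<And>j v. D j (\<i> *s v) = \<i> * D j v"
    by metis
  then show "\<exists>D. (h has_derivative D) (at w) \<and> (\<forall>v\<in>UNIV. D (\<i> *s v) = \<i> *s D v)"
    using vector_complex_derivative[OF D(1)]
    by (intro exI[of _ "\<lambda>v. \<chi> j. D j v"]) (simp add: vec_eq_iff)
qed

lemma continuous_on_cdiff_components:
  fixes h :: "complex^'n \<Rightarrow> complex^'m"
  assumes "\<And>w j. w \<in> U \<Longrightarrow> cdiff (\<lambda>w. h w $ j) w"
  shows "continuous_on U h"
proof -
  have "continuous_on U (\<lambda>w. \<chi> j. h w $ j)"
    using assms by (intro continuous_on_vec_lambda continuous_at_imp_continuous_on ballI cdiff_imp_continuous)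
  then show ?thesis
    by simp
qed

text \<open>The chart replaces w_k by the full sum of squares, so the quadric becomes a coordinate
  hyperplane; the inverse extracts the square root with the branch that passes through p.\<close>

lemma smooth_hypersurface_quadric:
  fixes p :: "complex^'n"
  assumes "p \<noteq> 0"
  shows "smooth_hypersurface_at quadric p"
proof -
  obtain k where pk: "p $ k \<noteq> 0"
    using assms by (auto simp: vec_eq_iff)
  let ?g = "sum_sq_except k"
  define U where "U = {w. w $ k / p $ k \<in> {b. 0 < Re b}}"
  define V where "V = {v. (v $ k - ?g v) / (p $ k)\<^sup>2 \<in> - \<real>\<^sub>\<le>\<^sub>0}"
  define h where "h w = upd k w ((w $ k)\<^sup>2 + ?g w)" for w
  define s where "s v = p $ k * csqrt ((v $ k - ?g v) / (p $ k)\<^sup>2)" for v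
  define h' where "h' v = upd k v (s v)" for v
  have open_U: "open U"
    unfolding U_def using pk by (intro open_cdiff_vimage cdiff_divide cdiff_nth cdiff_const open_halfspace_Re_gt)
  have cdiff_arg: "cdiff (\<lambda>v. (v $ k - ?g v) / (p $ k)\<^sup>2) w" for w
    using pk by (intro cdiff_divide cdiff_diff cdiff_nth cdiff_sum_sq_except cdiff_const) simp
  have open_V: "open V"
    unfolding V_def by (rule open_cdiff_vimage[OF cdiff_arg]) (simp add: closed_nonpos_Reals_complex open_Compl)
  have cdiff_h: "cdiff (\<lambda>w. h w $ j) w" for w j
    unfolding h_def by (cases "j = k")
      (simp_all add: upd_nth cdiff_nth cdiff_add cdiff_power cdiff_sum_sq_except)
  have cdiff_h': "cdiff (\<lambda>v. h' v $ j) v" if "v \<in> V" for v j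
  proof -
    have "cdiff s v"
      unfolding s_def[abs_def] using that
      by (intro cdiff_mult cdiff_const cdiff_csqrt cdiff_arg) (simp add: V_def)
    then show ?thesis
      unfolding h'_def by (cases "j = k") (simp_all add: upd_nth cdiff_nth)
  qed
  have hU: "(h w $ k - ?g (h w)) / (p $ k)\<^sup>2 = (w $ k / p $ k)\<^sup>2" for w
    by (simp add: h_def upd_nth power_divide)
  have s2: "(s v)\<^sup>2 = v $ k - ?g v" for v
    using pk by (simp add: s_def power_mult_distrib)
  have upd_upd: "upd k (upd k w y) z = upd k w z" for w :: "complex^'n" and y z
    by (simp add: vec_eq_iff upd_nth)
  have hom: "homeomorphism U V h h'"
  proof (rule homeomorphismI)
    show "continuous_on U h"
      by (rule continuous_on_cdiff_components) (rule cdiff_h)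
    show "continuous_on V h'"
      by (rule continuous_on_cdiff_components) (rule cdiff_h')
    show "h ` U \<subseteq> V"
      using hU power2_not_nonpos_Reals by (auto simp: U_def V_def)
    show "h' ` V \<subseteq> U"
      using pk Re_csqrt_pos by (auto simp: U_def V_def h'_def upd_nth s_def)
    show "h' (h w) = w" if "w \<in> U" for w
    proof -
      have "s (h w) = w $ k"
        using that pk by (simp add: s_def hU csqrt_power2 U_def)
      then show ?thesis
        by (simp add: h'_def) (simp add: h_def upd_upd)
    qed
    show "h (h' v) = v" if "v \<in> V" for v
    proof -
      have "(h' v $ k)\<^sup>2 + ?g (h' v) = v $ k"
        by (simp add: h'_def upd_nth s2)
      then show ?thesis
        by (simp add: h_def) (simp add: h'_def upd_upd)
    qed
  qed
  have "h ` (quadric \<inter> U) = {v \<in> V. v $ k = 0}"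
  proof
    have "h w \<in> V" if "w \<in> U" for w
      using hom that by (auto simp: homeomorphism_def)
    moreover have "h w $ k = 0" if "w \<in> quadric" for w
      using that quadric_iff[of w k] by (simp add: h_def upd_nth)
    ultimately show "h ` (quadric \<inter> U) \<subseteq> {v \<in> V. v $ k = 0}"
      by blast
    show "{v \<in> V. v $ k = 0} \<subseteq> h ` (quadric \<inter> U)"
    proof
      fix v assume v: "v \<in> {v \<in> V. v $ k = 0}"
      then have "h' v \<in> U" "h (h' v) = v"
        using hom by (auto simp: homeomorphism_def)
      moreover have "h' v \<in> quadric"
        using v s2[of v] by (auto simp: h'_def intro: upd_in_quadric)
      ultimately show "v \<in> h ` (quadric \<inter> U)"
        by (metis IntI imageI)
    qed
  qed
  moreover have "p \<in> U"
    using pk by (simp add: U_def)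
  ultimately show ?thesis
    unfolding smooth_hypersurface_at_def
    using open_U open_V hom holomorphic_map_onI[OF cdiff_h] holomorphic_map_onI[OF cdiff_h'] by blast
qed

section \<open>The orbits\<close>

declare transpose_matrix_vector [simp del]

lemma matrix_vector_mult_minus:
  fixes A :: "real^'n^'m"
  shows "(- A) *v x = - (A *v x)" "A *v (- x) = - (A *v x)"
  by (simp_all add: matrix_vector_mult_def vec_eq_iff sum_negf)

section \<open>The invariant form in block coordinates, and nilpotent elements\<close>

definition joinv :: "'a^2 \<Rightarrow> 'a^'q \<Rightarrow> 'a^(2 + 'q::finite)"
  where "joinv x y = (\<chi> i. case i of Inl a \<Rightarrow> x $ a | Inr b \<Rightarrow> y $ b)"

lemma joinv_nth [simp]: "joinv x y $ Inl a = x $ a" "joinv x y $ Inr b = y $ b"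
  by (simp_all add: joinv_def)

lemma vec_sum_eq_iff:
  "(v :: 'a^(2 + 'q::finite)) = w \<longleftrightarrow> (\<forall>a. v $ Inl a = w $ Inl a) \<and> (\<forall>b. v $ Inr b = w $ Inr b)"
  unfolding vec_eq_iff by (metis sum.exhaust)

lemma joinv_cases:
  obtains x y where "(v :: 'a^(2 + 'q::finite)) = joinv x y"
  by (rule that[of "\<chi> a. v $ Inl a" "\<chi> b. v $ Inr b"]) (simp add: vec_sum_eq_iff)

lemma joinv_eq_iff [simp]: "joinv x y = joinv x' y' \<longleftrightarrow> x = x' \<and> y = y'"
  by (auto simp: vec_sum_eq_iff vec_eq_iff)

lemma joinv_arith:
  fixes x x' :: "real^2" and y y' :: "real^'q::finite"
  shows "joinv x y + joinv x' y' = joinv (x + x') (y + y')" "joinv x y - joinv x' y' = joinv (x - x') (y - y')"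
    "c *\<^sub>R joinv x y = joinv (c *\<^sub>R x) (c *\<^sub>R y)" "- joinv x y = joinv (- x) (- y)"
    "(0 :: real^(2 + 'q)) = joinv 0 0"
  by (simp_all add: vec_sum_eq_iff)

lemma sum_UNIV_sum:
  "(\<Sum>i\<in>UNIV. f i) = (\<Sum>a\<in>UNIV. f (Inl a)) + (\<Sum>b\<in>UNIV. f (Inr b :: 'a::finite + 'b::finite))"
  by (simp add: UNIV_Plus_UNIV[symmetric] sum.Plus del: UNIV_Plus_UNIV)

lemma inner_joinv: "joinv x y \<bullet> joinv x' y' = x \<bullet> x' + y \<bullet> (y' :: real^'q::finite)"
  by (simp add: inner_vec_def sum_UNIV_sum)

lemma blk_nth [simp]:
  "blk A B C D $ Inl a $ Inl b = A $ a $ b" "blk A B C D $ Inl a $ Inr j = B $ a $ j"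
  "blk A B C D $ Inr i $ Inl b = C $ i $ b" "blk A B C D $ Inr i $ Inr j = D $ i $ j"
  by (simp_all add: blk_def)

lemma mat_sum_eq_iff:
  "(M :: 'a^(2 + 'q::finite)^(2 + 'q)) = N \<longleftrightarrow>
    (\<forall>a b. M $ Inl a $ Inl b = N $ Inl a $ Inl b) \<and> (\<forall>a j. M $ Inl a $ Inr j = N $ Inl a $ Inr j) \<and>
    (\<forall>i b. M $ Inr i $ Inl b = N $ Inr i $ Inl b) \<and> (\<forall>i j. M $ Inr i $ Inr j = N $ Inr i $ Inr j)"
  by (simp add: vec_sum_eq_iff) blast

lemma blk_mult_joinv: "blk A B C D *v joinv x y = joinv (A *v x + B *v y) (C *v x + D *v (y :: real^'q::finite))"
  by (simp add: vec_sum_eq_iff matrix_vector_mult_def sum_UNIV_sum)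

definition frm :: "real^(2 + 'q::finite) \<Rightarrow> real^(2 + 'q) \<Rightarrow> real"
  where "frm v w = v \<bullet> (form2q *v w)"

lemma form2q_joinv: "form2q *v joinv x y = joinv x (- y)"
  by (simp add: form2q_def blk_mult_joinv matrix_vector_mult_minus)

lemma frm_joinv: "frm (joinv x y) (joinv x' y') = x \<bullet> x' - y \<bullet> y'"
  by (simp add: frm_def form2q_joinv inner_joinv)

lemma frm_commute: "frm v w = frm w v"
  by (cases v rule: joinv_cases, cases w rule: joinv_cases) (simp add: frm_joinv inner_commute)

lemma frm_linear:
  "frm (v + v') w = frm v w + frm v' w" "frm (v - v') w = frm v w - frm v' w"
  "frm (c *\<^sub>R v) w = c * frm v w" "frm (- v) w = - frm v w"
  by (simp_all add: frm_def algebra_simps)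

lemma frm_linear':
  "frm w (v + v') = frm w v + frm w v'" "frm w (v - v') = frm w v - frm w v'"
  "frm w (c *\<^sub>R v) = c * frm w v" "frm w (- v) = - frm w v"
  by (simp_all only: frm_commute[of w] frm_linear)

lemma frm_nondegenerate:
  assumes "\<And>w. frm v w = 0"
  shows "v = 0"
proof (cases v rule: joinv_cases)
  case (1 x y)
  have "frm v (joinv x (- y)) = 0"
    by (rule assms)
  then have "x \<bullet> x + y \<bullet> y = 0"
    by (simp add: 1 frm_joinv)
  then have "x = 0" "y = 0"
    by (metis add_nonneg_eq_0_iff inner_ge_zero inner_eq_zero_iff)+
  then show ?thesis
    by (simp add: 1 joinv_arith)
qed

lemma J_mat_mult: "(J_mat *v x :: real^2) $ 1 = x $ 2" "(J_mat *v x :: real^2) $ 2 = - x $ 1"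
  by (simp_all add: J_mat_def matrix_vector_mult_def sum_2)

lemma real2_eq_iff: "(x :: 'a^2) = y \<longleftrightarrow> x $ 1 = y $ 1 \<and> x $ 2 = y $ 2"
  by (simp add: vec_eq_iff forall_2)

lemma inner_2: "(x :: real^2) \<bullet> y = x $ 1 * y $ 1 + x $ 2 * y $ 2"
  by (simp add: inner_vec_def sum_2)

lemma J_mat_simps:
  fixes x y :: "real^2"
  shows "J_mat *v (J_mat *v x) = - x" "(J_mat *v x) \<bullet> (J_mat *v y) = x \<bullet> y"
    "x \<bullet> (J_mat *v x) = 0" "(J_mat *v x) \<bullet> y = - (x \<bullet> (J_mat *v y))"
  by (simp_all add: real2_eq_iff inner_2 J_mat_mult)

lemma plane_frame:
  fixes x z :: "real^2"
  assumes "x \<bullet> x = 1"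
  shows "z = (x \<bullet> z) *\<^sub>R x + ((J_mat *v x) \<bullet> z) *\<^sub>R (J_mat *v x)"
proof -
  have "x $ 1 * x $ 1 + x $ 2 * x $ 2 = 1"
    using assms by (simp add: inner_2)
  then have "z $ 1 * (x $ 1 * x $ 1 + x $ 2 * x $ 2) = z $ 1" "z $ 2 * (x $ 1 * x $ 1 + x $ 2 * x $ 2) = z $ 2"
    by simp_all
  then show ?thesis
    by (simp add: real2_eq_iff inner_2 J_mat_mult algebra_simps)
qed

text \<open>First-order condition at the minimum t = 0: for t = - b / d with d positive and larger
  than c, the linear term outweighs the quadratic one.\<close>

lemma quadratic_nonneg_imp_zero:
  fixes b c :: real
  assumes "\<And>t. 0 \<le> 2 * t * b + t\<^sup>2 * c"
  shows "b = 0"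
proof (rule ccontr)
  assume b: "b \<noteq> 0"
  define d where "d = \<bar>c\<bar> + 1"
  have d: "d > 0" "c < d"
    by (auto simp: d_def)
  have "0 \<le> 2 * (- b / d) * b + (- b / d)\<^sup>2 * c"
    by (rule assms)
  also have "\<dots> = (b\<^sup>2 / d) * (c / d - 2)"
    using d(1) by (simp add: field_simps power2_eq_square)
  also have "\<dots> < 0"
    using b d by (intro mult_pos_neg) (auto simp: field_simps)
  finally show False by simp
qed

text \<open>All elements of the two orbits have this shape with \<open>a > 0\<close>: they are of the form \<open>wedge u n\<close>
  below, with \<open>n\<close> isotropic, \<open>u\<close> orthogonal to \<open>n\<close> and \<open>frm u u \<ge> 0\<close>.\<close>

locale nilpotent_nonneg =
  fixes a :: real and B :: "real^'q::finite^2" and D :: "real^'q^'q"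
    and M :: "real^(2 + 'q)^(2 + 'q)"
  assumes M: "M = blk (a *\<^sub>R J_mat) B (transpose B) D" and D_skew: "transpose D = - D"
    and nilpotent: "M *v (M *v (M *v v)) = 0"
    and nonneg: "0 \<le> frm (M *v v) (M *v v)"
begin

lemma M_joinv: "M *v joinv x y = joinv (a *\<^sub>R (J_mat *v x) + B *v y) (transpose B *v x + D *v y)"
  by (simp add: M blk_mult_joinv scaleR_matrix_vector_assoc)

lemma adjoint_B: "(transpose B *v x) \<bullet> y = x \<bullet> (B *v y)"
  by (simp add: transpose_matrix_vector dot_lmul_matrix)

lemma adjoint_D: "(D *v x) \<bullet> y = - (x \<bullet> (D *v y))"
proof -
  have "(D *v x) \<bullet> y = x \<bullet> (transpose D *v y)"
    by (metis dot_lmul_matrix inner_commute transpose_matrix_vector transpose_transpose)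
  then show ?thesis
    by (simp add: D_skew matrix_vector_mult_minus)
qed

lemma frm_skew: "frm (M *v v) w = - frm v (M *v w)"
proof -
  obtain x y x' y' where "v = joinv x y" "w = joinv x' y'"
    using joinv_cases by metis
  then show ?thesis
    by (simp add: M_joinv frm_joinv inner_add_left inner_add_right J_mat_simps(4)[of x x'] adjoint_B
        adjoint_D adjoint_B[of x' y] inner_commute[of "B *v y"] inner_commute[of y "transpose B *v x'"])
qed

text \<open>Such a v minimises the nonnegative quadratic form \<open>frm (M *v w) (M *v w)\<close>,
  so the first variation \<open>frm (M *v v) (M *v w)\<close> vanishes for all w; skewness moves M
  to the other side and nondegeneracy concludes.\<close>

lemma null_imp_square_zero:
  assumes "frm (M *v v) (M *v v) = 0"
  shows "M *v (M *v v) = 0"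
proof (rule frm_nondegenerate)
  fix w
  have "0 \<le> 2 * t * frm (M *v v) (M *v w) + t\<^sup>2 * frm (M *v w) (M *v w)" for t
    using nonneg[of "v + t *\<^sub>R w"] assms frm_commute[of "M *v w" "M *v v"]
    by (simp add: matrix_vector_right_distrib matrix_vector_mult_scaleR frm_linear frm_linear'
        power2_eq_square algebra_simps)
  then have "frm (M *v v) (M *v w) = 0"
    by (rule quadratic_nonneg_imp_zero)
  then show "frm (M *v (M *v v)) w = 0"
    by (simp add: frm_skew)
qed

text \<open>Nonnegativity on vectors (x, 0): the operator norm of B is at most |a|. On vectors (0,
  y) it bounds D by B, which is \<open>norm_D_le\<close>.\<close>

lemma norm_transpose_B_le: "(transpose B *v x) \<bullet> (transpose B *v x) \<le> a\<^sup>2 * (x \<bullet> x)"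
  using nonneg[of "joinv x 0"]
  by (simp add: M_joinv frm_joinv J_mat_simps power2_eq_square matrix_vector_mult_0_right)

lemma norm_D_le: "(D *v y) \<bullet> (D *v y) \<le> (B *v y) \<bullet> (B *v y)"
  using nonneg[of "joinv 0 y"] by (simp add: M_joinv frm_joinv matrix_vector_mult_0_right)

lemma zero_if_a_zero:
  assumes "a = 0"
  shows "M = 0"
proof -
  have zero: "v = 0" if "v \<bullet> v \<le> 0" for v :: "real^'n"
    using that by (meson inner_gt_zero_iff not_le)
  have "transpose B *v x = 0" for x
    using norm_transpose_B_le[of x] assms by (intro zero) simp
  then have "transpose B = 0"
    by (intro matrix_eq[THEN iffD2]) simp
  then have "transpose (transpose B) = 0"
    by (simp add: transpose_def vec_eq_iff)
  then have "B = 0"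
    by simp
  have "D *v y = 0" for y
    using norm_D_le[of y] \<open>B = 0\<close> by (intro zero) simp
  then have "D = 0"
    by (intro matrix_eq[THEN iffD2]) simp
  with \<open>B = 0\<close> \<open>transpose B = 0\<close> assms show ?thesis
    by (simp add: M mat_sum_eq_iff)
qed

text \<open>Nilpotency forces the bound of \<open>norm_transpose_B_le\<close> to be attained: (p, r)
  = M^2 (e, 0) is isotropic and killed by M because M^3 = 0, so |p| = |r| and B r = - a J p.\<close>

lemma ex_eigenvector:
  assumes "a \<noteq> 0"
  obtains x where "x \<bullet> x = 1" "(transpose B *v x) \<bullet> (transpose B *v x) = a\<^sup>2"
proof -
  define e where "e = (axis 1 1 :: real^2)"
  obtain p r where pr: "M *v (M *v joinv e 0) = joinv p r"
    using joinv_cases by blast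
  have p: "p = - (a\<^sup>2 *\<^sub>R e) + B *v (transpose B *v e)"
    using pr by (simp add: M_joinv matrix_vector_mult_0_right matrix_vector_mult_scaleR J_mat_simps power2_eq_square)
  have "frm (joinv p r) (joinv p r) = 0"
    unfolding pr[symmetric] frm_skew nilpotent by (simp add: frm_def)
  then have norm_eq: "p \<bullet> p = r \<bullet> r"
    by (simp add: frm_joinv)
  have "M *v joinv p r = 0"
    unfolding pr[symmetric] by (rule nilpotent)
  then have "a *\<^sub>R (J_mat *v p) + B *v r = 0"
    by (simp add: M_joinv joinv_arith)
  then have Br: "B *v r = - (a *\<^sub>R (J_mat *v p))"
    by (simp add: add_eq_0_iff)
  then have Br_norm: "(B *v r) \<bullet> (B *v r) = a\<^sup>2 * (r \<bullet> r)"
    using norm_eq by (simp add: J_mat_simps power2_eq_square)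
  show thesis
  proof (cases "p = 0")
    case True
    have e: "e \<bullet> e = 1"
      by (simp add: e_def inner_axis_axis)
    have "B *v (transpose B *v e) = a\<^sup>2 *\<^sub>R e"
      using True p by simp
    then have "(transpose B *v e) \<bullet> (transpose B *v e) = a\<^sup>2"
      using adjoint_B[of e "transpose B *v e"] e by simp
    with e show thesis
      by (rule that)
  next
    case False
    define y where "y = B *v r"
    have r: "r \<bullet> r > 0"
      using False norm_eq by (metis inner_gt_zero_iff)
    then have y: "y \<bullet> y > 0"
      using Br_norm assms by (simp add: y_def)
    have yy: "y \<bullet> y = a\<^sup>2 * (r \<bullet> r)"
      using Br_norm by (simp add: y_def)
    \<comment> \<open>Cauchy-Schwarz for B^t y and r gives the inequality opposite to
      \<open>norm_transpose_B_le\<close>, so equality holds for y = B r.\<close>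
    have "(y \<bullet> y)\<^sup>2 = ((transpose B *v y) \<bullet> r)\<^sup>2"
      by (simp add: adjoint_B y_def)
    also have "\<dots> \<le> ((transpose B *v y) \<bullet> (transpose B *v y)) * (r \<bullet> r)"
      by (rule Cauchy_Schwarz_ineq)
    finally have "(a\<^sup>2 * (y \<bullet> y)) * (r \<bullet> r) \<le> ((transpose B *v y) \<bullet> (transpose B *v y)) * (r \<bullet> r)"
      using yy by (simp add: power2_eq_square mult_ac)
    then have "a\<^sup>2 * (y \<bullet> y) \<le> (transpose B *v y) \<bullet> (transpose B *v y)"
      using r by (rule mult_right_le_imp_le)
    then have eq: "(transpose B *v y) \<bullet> (transpose B *v y) = a\<^sup>2 * (y \<bullet> y)"
      using norm_transpose_B_le[of y] by simp
    define s where "s = 1 / sqrt (y \<bullet> y)"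
    have "s * s * (y \<bullet> y) = 1"
      using y by (simp add: s_def)
    then show thesis
      using eq by (intro that[of "s *\<^sub>R y"]) (simp_all add: matrix_vector_mult_scaleR mult_ac)
  qed
qed

text \<open>A vector attaining the bound makes (x, 0) null for the form pulled back by M, so M^2 (x,
  0) = 0 by \<open>null_imp_square_zero\<close>; the two claims are its two blocks.\<close>

lemma eigenvector:
  assumes "a \<noteq> 0" "x \<bullet> x = 1" "(transpose B *v x) \<bullet> (transpose B *v x) = a\<^sup>2"
  shows "B *v (transpose B *v x) = a\<^sup>2 *\<^sub>R x"
    and "D *v (transpose B *v x) = - (a *\<^sub>R (transpose B *v (J_mat *v x)))"
proof -
  have "frm (M *v joinv x 0) (M *v joinv x 0) = 0"
    using assms by (simp add: M_joinv frm_joinv matrix_vector_mult_0_right J_mat_simps power2_eq_square)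
  then have "M *v (M *v joinv x 0) = 0"
    by (rule null_imp_square_zero)
  then have *: "B *v (transpose B *v x) - a\<^sup>2 *\<^sub>R x = 0"
    "a *\<^sub>R (transpose B *v (J_mat *v x)) + D *v (transpose B *v x) = 0"
    by (simp_all add: M_joinv matrix_vector_mult_0_right matrix_vector_mult_scaleR J_mat_simps
        joinv_arith power2_eq_square)
  show "B *v (transpose B *v x) = a\<^sup>2 *\<^sub>R x"
    using *(1) by simp
  show "D *v (transpose B *v x) = - (a *\<^sub>R (transpose B *v (J_mat *v x)))"
    using *(2) by (simp add: add_eq_0_iff)
qed

text \<open>Split y along b0 = B^t x and its orthogonal complement. On b0, D is known from
  \<open>eigenvector\<close>. For y' orthogonal to b0, B y' is a multiple k of J x, so |D y'| <=
  |k|, while skewness makes the inner product of b0 and D y' equal to a k: equality in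
  Cauchy-Schwarz, hence D y' = (k / a) b0.\<close>

lemma D_eq:
  assumes "a \<noteq> 0"
  shows "D *v y = - (1 / a) *\<^sub>R (transpose B *v (J_mat *v (B *v y)))"
proof -
  obtain x where x: "x \<bullet> x = 1" "(transpose B *v x) \<bullet> (transpose B *v x) = a\<^sup>2"
    using ex_eigenvector[OF assms] .
  note ev = eigenvector[OF assms x]
  define b0 where "b0 = transpose B *v x"
  define b1 where "b1 = transpose B *v (J_mat *v x)"
  have b0: "b0 \<bullet> b0 = a\<^sup>2" "B *v b0 = a\<^sup>2 *\<^sub>R x" "D *v b0 = - (a *\<^sub>R b1)"
    using x ev by (simp_all add: b0_def b1_def)
  define t where "t = (b0 \<bullet> y) / a\<^sup>2"
  define y' where "y' = y - t *\<^sub>R b0"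
  have y: "y = y' + t *\<^sub>R b0"
    by (simp add: y'_def)
  have perp: "b0 \<bullet> y' = 0"
    using assms b0(1) by (simp add: y'_def t_def inner_diff_right)
  define k where "k = b1 \<bullet> y'"
  have By': "B *v y' = k *\<^sub>R (J_mat *v x)"
  proof -
    have "x \<bullet> (B *v y') = 0" "(J_mat *v x) \<bullet> (B *v y') = k"
      using perp by (simp_all add: adjoint_B[symmetric] b0_def[symmetric] b1_def[symmetric] k_def)
    then show ?thesis
      using plane_frame[OF x(1), of "B *v y'"] by simp
  qed
  have "b0 \<bullet> (D *v y') = a * k"
    using adjoint_D[of b0 y'] b0(3) by (simp add: k_def)
  moreover have "(D *v y') \<bullet> (D *v y') \<le> k * k"
    using norm_D_le[of y'] x(1) by (simp add: By' J_mat_simps)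
  moreover have "(D *v y' - (k / a) *\<^sub>R b0) \<bullet> (D *v y' - (k / a) *\<^sub>R b0)
      = (D *v y') \<bullet> (D *v y') - 2 * (k / a) * (b0 \<bullet> (D *v y')) + (k / a)\<^sup>2 * (b0 \<bullet> b0)"
    by (simp add: inner_diff_left inner_diff_right inner_commute[of "D *v y'" b0] power2_eq_square algebra_simps)
  ultimately have "(D *v y' - (k / a) *\<^sub>R b0) \<bullet> (D *v y' - (k / a) *\<^sub>R b0) \<le> 0"
    using assms b0(1) by (simp add: power2_eq_square)
  then have Dy': "D *v y' = (k / a) *\<^sub>R b0"
    by (metis eq_iff_diff_eq_0 inner_eq_zero_iff inner_ge_zero order_antisym)
  show ?thesis
    unfolding y using assms
    by (simp add: matrix_vector_right_distrib matrix_vector_mult_scaleR Dy' By' b0 J_mat_simps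
        matrix_vector_mult_minus b0_def[symmetric] b1_def[symmetric] algebra_simps power2_eq_square)
qed

end

section \<open>The section over the off-diagonal blocks\<close>

definition rows_mat :: "complex^'q \<Rightarrow> real^'q^2"
  where "rows_mat w = (\<chi> a j. if a = 1 then Re (w $ j) else - Im (w $ j))"

definition re_sq :: "complex^'q \<Rightarrow> real"
  where "re_sq w = (\<Sum>j\<in>UNIV. (Re (w $ j))\<^sup>2)"

definition im_sq :: "complex^'q \<Rightarrow> real"
  where "im_sq w = (\<Sum>j\<in>UNIV. (Im (w $ j))\<^sup>2)"

definition re_im :: "complex^'q \<Rightarrow> real"
  where "re_im w = (\<Sum>j\<in>UNIV. Re (w $ j) * Im (w $ j))"

text \<open>The operator norm of \<open>rows_mat w\<close>: the square root of the larger eigenvalue of its Gram matrix.\<close>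

definition top_sv :: "complex^'q \<Rightarrow> real"
  where "top_sv w = sqrt ((re_sq w + im_sq w) / 2 + sqrt (((re_sq w - im_sq w) / 2)\<^sup>2 + (re_im w)\<^sup>2))"

text \<open>The lower right block is forced by \<open>D_eq\<close>. At w = 0 the division by zero
  returns 0, which is also the limit.\<close>

definition nil_section :: "complex^'q::finite \<Rightarrow> real^(2 + 'q)^(2 + 'q)"
  where "nil_section w = blk (top_sv w *\<^sub>R J_mat) (rows_mat w) (transpose (rows_mat w))
    (- (1 / top_sv w) *\<^sub>R (transpose (rows_mat w) ** J_mat ** rows_mat w))"

text \<open>The minus sign is that of w - \<i> J w, whose first row is the first row of B minus \<i>
  times the second.\<close>

definition p_coord :: "real^(2 + 'q::finite)^(2 + 'q) \<Rightarrow> complex^'q"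
  where "p_coord M = (\<chi> j. Complex (M $ Inl 1 $ Inr j) (- M $ Inl 2 $ Inr j))"

lemma rows_mat_nth: "rows_mat w $ 1 $ j = Re (w $ j)" "rows_mat w $ 2 $ j = - Im (w $ j)"
  by (simp_all add: rows_mat_def)

lemma p_coord_section [simp]: "p_coord (nil_section w) = w"
  by (simp add: p_coord_def nil_section_def rows_mat_nth vec_eq_iff)

lemma rows_mat_p_coord: "rows_mat (p_coord (blk A B C D)) = B"
  by (simp add: p_coord_def vec_eq_iff forall_2 rows_mat_nth)

lemma gram_rows_mat:
  "rows_mat w $ 1 \<bullet> rows_mat w $ 1 = re_sq w" "rows_mat w $ 2 \<bullet> rows_mat w $ 2 = im_sq w"
  "rows_mat w $ 1 \<bullet> rows_mat w $ 2 = - re_im w"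
  by (simp_all add: inner_vec_def rows_mat_nth re_sq_def im_sq_def re_im_def power2_eq_square sum_negf)

lemma quadric_iff_gram: "w \<in> quadric \<longleftrightarrow> re_sq w = im_sq w \<and> re_im w = 0"
proof -
  have "(\<Sum>j\<in>UNIV. (w $ j)\<^sup>2) = Complex (re_sq w - im_sq w) (2 * re_im w)"
    by (rule complex_eqI)
      (simp_all add: Re_power2 Im_power2 re_sq_def im_sq_def re_im_def sum_subtractf sum_distrib_left mult_ac)
  then show ?thesis
    by (simp add: quadric_def complex_eq_iff)
qed

lemma sq_sums_nonneg: "0 \<le> re_sq w" "0 \<le> im_sq w"
  by (simp_all add: re_sq_def im_sq_def sum_nonneg)

lemma top_sv_nonneg: "0 \<le> top_sv w"
  using sq_sums_nonneg[of w] by (simp add: top_sv_def)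

lemma sq_sums_le_top_sv: "re_sq w \<le> (top_sv w)\<^sup>2" "im_sq w \<le> (top_sv w)\<^sup>2"
proof -
  have "\<bar>(re_sq w - im_sq w) / 2\<bar> \<le> sqrt (((re_sq w - im_sq w) / 2)\<^sup>2 + (re_im w)\<^sup>2)"
    by (rule real_sqrt_ge_abs1)
  moreover have "(top_sv w)\<^sup>2 = (re_sq w + im_sq w) / 2 + sqrt (((re_sq w - im_sq w) / 2)\<^sup>2 + (re_im w)\<^sup>2)"
    unfolding top_sv_def using sq_sums_nonneg[of w] by (intro real_sqrt_pow2 add_nonneg_nonneg) auto
  ultimately show "re_sq w \<le> (top_sv w)\<^sup>2" "im_sq w \<le> (top_sv w)\<^sup>2"
    by (simp_all add: abs_le_iff field_simps)
qed

lemma component_le_top_sv: "\<bar>Re (w $ j)\<bar> \<le> top_sv w" "\<bar>Im (w $ j)\<bar> \<le> top_sv w"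
proof -
  have "(Re (w $ j))\<^sup>2 \<le> re_sq w" "(Im (w $ j))\<^sup>2 \<le> im_sq w"
    unfolding re_sq_def im_sq_def by (auto intro: member_le_sum)
  then have "(Re (w $ j))\<^sup>2 \<le> (top_sv w)\<^sup>2" "(Im (w $ j))\<^sup>2 \<le> (top_sv w)\<^sup>2"
    using sq_sums_le_top_sv[of w] by linarith+
  then show "\<bar>Re (w $ j)\<bar> \<le> top_sv w" "\<bar>Im (w $ j)\<bar> \<le> top_sv w"
    using abs_of_nonneg[OF top_sv_nonneg[of w]] by (simp_all add: abs_le_square_iff[symmetric])
qed

lemma top_sv_eq_0_iff: "top_sv w = 0 \<longleftrightarrow> w = 0"
proof
  assume "top_sv w = 0"
  then have "Re (w $ j) = 0" "Im (w $ j) = 0" for j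
    using component_le_top_sv[of w j] by simp_all
  then show "w = 0"
    by (simp add: vec_eq_iff complex_eq_iff)
qed (simp add: top_sv_def re_sq_def im_sq_def re_im_def)

lemma continuous_on_top_sv: "continuous_on S top_sv"
  unfolding top_sv_def[abs_def] re_sq_def im_sq_def re_im_def by (intro continuous_intros) simp_all

lemma isCont_top_sv: "isCont top_sv w"
  by (rule continuous_on_interior[OF continuous_on_top_sv[where S = UNIV]]) simp

lemma nil_section_lower: "nil_section w $ Inr i $ Inr j
    = - (1 / top_sv w) * (Im (w $ i) * Re (w $ j) - Re (w $ i) * Im (w $ j))"
  by (simp add: nil_section_def matrix_matrix_mult_def sum_2 J_mat_def transpose_def rows_mat_nth)

text \<open>Only the origin is delicate, where the entry reads 0 / 0: the numerator is at most 2
  (top_sv)^2, so the quotient is at most 2 top_sv and tends to 0.\<close>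

lemma isCont_nil_section_lower:
  fixes w :: "complex^'q::finite"
  shows "isCont (\<lambda>w. nil_section w $ Inr i $ Inr j) w"
proof (cases "w = 0")
  case False
  then show ?thesis
    unfolding nil_section_lower by (intro continuous_intros isCont_top_sv) (simp_all add: top_sv_eq_0_iff)
next
  case True
  have bound: "norm (nil_section v $ Inr i $ Inr j) \<le> 2 * top_sv v" for v :: "complex^'q"
  proof (cases "top_sv v = 0")
    case False
    have "\<bar>Im (v $ i) * Re (v $ j) - Re (v $ i) * Im (v $ j)\<bar> \<le> 2 * (top_sv v * top_sv v)"
      using mult_mono[OF component_le_top_sv(2)[of v i] component_le_top_sv(1)[of v j]]
        mult_mono[OF component_le_top_sv(1)[of v i] component_le_top_sv(2)[of v j]] top_sv_nonneg[of v]
      by (simp add: abs_mult[symmetric])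
    then show ?thesis
      using False top_sv_nonneg[of v] unfolding nil_section_lower
      by (simp add: abs_mult field_simps)
  qed (simp add: nil_section_lower)
  have "(\<lambda>v :: complex^'q. 2 * top_sv v) \<midarrow>0\<rightarrow> 2 * 0"
    using isCont_top_sv[of "0 :: complex^'q"] unfolding isCont_def
    by (intro tendsto_mult tendsto_const) (simp only: top_sv_eq_0_iff[THEN iffD2, OF refl])
  then have "(\<lambda>v :: complex^'q. 2 * top_sv v) \<midarrow>0\<rightarrow> 0"
    by simp
  then have "(\<lambda>v :: complex^'q. nil_section v $ Inr i $ Inr j) \<midarrow>0\<rightarrow> 0"
    by (rule Lim_null_comparison[rotated]) (simp only: bound always_eventually simp_thms)
  then show ?thesis
    unfolding True isCont_def by (simp add: nil_section_lower)
qed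

lemma continuous_on_matI:
  fixes f :: "'a::topological_space \<Rightarrow> real^'n^'m"
  assumes "\<And>i j. continuous_on S (\<lambda>x. f x $ i $ j)"
  shows "continuous_on S f"
proof -
  have "continuous_on S (\<lambda>x. \<chi> i j. f x $ i $ j)"
    by (intro continuous_on_vec_lambda assms)
  then show ?thesis
    by simp
qed

lemma continuous_on_nil_section: "continuous_on S (nil_section :: complex^'q::finite \<Rightarrow> _)"
proof (rule continuous_on_matI)
  fix i j :: "2 + 'q"
  have rows: "continuous_on S (\<lambda>w. rows_mat w $ a $ l)" for a and l :: 'q
    by (cases "a = 1") (auto simp: rows_mat_def intro!: continuous_intros)
  show "continuous_on S (\<lambda>w. nil_section w $ i $ j)"
  proof (cases i; cases j)
    fix a b :: 2
    assume "i = Inl a" "j = Inl b"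
    then show ?thesis
      by (simp add: nil_section_def) (intro continuous_intros continuous_on_top_sv)
  next
    fix a :: 2 and l
    assume "i = Inl a" "j = Inr l"
    then show ?thesis
      by (simp add: nil_section_def rows)
  next
    fix a :: 2 and l
    assume "i = Inr l" "j = Inl a"
    then show ?thesis
      by (simp add: nil_section_def rows transpose_def)
  next
    fix l m
    assume "i = Inr l" "j = Inr m"
    then show ?thesis
      using isCont_nil_section_lower by (auto intro: continuous_at_imp_continuous_on)
  qed
qed

lemma transpose_mult_2:
  fixes B :: "real^'q::finite^2"
  shows "transpose B *v x = x $ 1 *\<^sub>R B $ 1 + x $ 2 *\<^sub>R B $ 2"
  by (simp add: matrix_vector_mult_def transpose_def vec_eq_iff sum_2 mult.commute)

lemma mat2_mult_nth: "(B *v y) $ 1 = B $ 1 \<bullet> y" "(B *v y) $ 2 = B $ 2 \<bullet> (y :: real^'q::finite)" for B :: "real^'q^2"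
  by (simp_all add: matrix_vector_mult_def inner_vec_def)

text \<open>The vector (x, y) is a nonzero element of the kernel of the matrix with rows (p, - r)
  and (- r, q), whose determinant is p q - r^2.\<close>

lemma singular_2x2:
  fixes p q r x y :: real
  assumes "p * x = r * y" "q * y = r * x" "x \<noteq> 0 \<or> y \<noteq> 0"
  shows "p * q = r\<^sup>2"
proof -
  have "(p * q) * x = q * (p * x)"
    by (simp only: mult_ac)
  also have "\<dots> = r * (q * y)"
    by (simp only: assms(1) mult_ac)
  finally have x: "(p * q) * x = r\<^sup>2 * x"
    by (simp only: assms(2) power2_eq_square mult.assoc)
  have "(p * q) * y = p * (q * y)"
    by (simp only: mult_ac)
  also have "\<dots> = r * (p * x)"
    by (simp only: assms(2) mult_ac)
  finally have "(p * q) * y = r\<^sup>2 * y"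
    by (simp only: assms(1) power2_eq_square mult.assoc)
  with x assms(3) show ?thesis
    by auto
qed

context nilpotent_nonneg
begin

lemma gram_le: "B $ 1 \<bullet> B $ 1 \<le> a\<^sup>2" "B $ 2 \<bullet> B $ 2 \<le> a\<^sup>2"
  using norm_transpose_B_le[of "axis 1 1"] norm_transpose_B_le[of "axis 2 1"]
  by (simp_all add: transpose_mult_2 inner_axis_axis axis_def inner_2)

text \<open>By \<open>eigenvector\<close>, a^2 is an eigenvalue of the Gram matrix B B^t, so the
  characteristic polynomial vanishes there.\<close>

lemma gram_det:
  assumes "a \<noteq> 0"
  shows "(a\<^sup>2 - B $ 1 \<bullet> B $ 1) * (a\<^sup>2 - B $ 2 \<bullet> B $ 2) = (B $ 1 \<bullet> B $ 2)\<^sup>2"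
proof -
  obtain x where x: "x \<bullet> x = 1" "(transpose B *v x) \<bullet> (transpose B *v x) = a\<^sup>2"
    using ex_eigenvector[OF assms] .
  have "B *v (transpose B *v x) = a\<^sup>2 *\<^sub>R x"
    using eigenvector(1)[OF assms x] .
  then have "(a\<^sup>2 - B $ 1 \<bullet> B $ 1) * x $ 1 = (B $ 1 \<bullet> B $ 2) * x $ 2"
    "(a\<^sup>2 - B $ 2 \<bullet> B $ 2) * x $ 2 = (B $ 1 \<bullet> B $ 2) * x $ 1"
    by (simp_all add: real2_eq_iff mat2_mult_nth transpose_mult_2 inner_add_right inner_commute[of "B $ 2" "B $ 1"]
        algebra_simps)
  moreover have "x $ 1 \<noteq> 0 \<or> x $ 2 \<noteq> 0"
    using x(1) by (auto simp: inner_2)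
  ultimately show ?thesis
    by (rule singular_2x2)
qed

lemma eq_nil_section:
  assumes "0 \<le> a"
  shows "M = nil_section (p_coord M)"
proof (cases "a = 0")
  case True
  then have "M = 0"
    by (rule zero_if_a_zero)
  moreover have "p_coord 0 = (0 :: complex^'q)"
    by (simp add: p_coord_def vec_eq_iff complex_eq_iff)
  moreover have "nil_section (0 :: complex^'q) = 0"
    by (simp add: mat_sum_eq_iff nil_section_lower)
      (simp add: nil_section_def top_sv_eq_0_iff rows_mat_def transpose_def)
  ultimately show ?thesis
    by simp
next
  case False
  define w where "w = p_coord M"
  have B: "rows_mat w = B"
    by (simp add: w_def M rows_mat_p_coord)
  have gram: "B $ 1 \<bullet> B $ 1 = re_sq w" "B $ 2 \<bullet> B $ 2 = im_sq w" "(B $ 1 \<bullet> B $ 2)\<^sup>2 = (re_im w)\<^sup>2"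
    by (simp_all add: B[symmetric] gram_rows_mat)
  \<comment> \<open>The distance of a^2 from the mean of the two eigenvalues of the Gram matrix;
    \<open>gram_le\<close> makes it nonnegative, so a^2 is the larger eigenvalue and a is
    \<open>top_sv w\<close>.\<close>
  define s where "s = a\<^sup>2 - (re_sq w + im_sq w) / 2"
  have "0 \<le> s"
    using gram_le by (simp add: gram s_def)
  have "s\<^sup>2 - ((re_sq w - im_sq w) / 2)\<^sup>2 = (a\<^sup>2 - re_sq w) * (a\<^sup>2 - im_sq w)"
    by (simp add: s_def power2_eq_square field_simps)
  then have "s\<^sup>2 = ((re_sq w - im_sq w) / 2)\<^sup>2 + (re_im w)\<^sup>2"
    using gram_det[OF False] by (simp add: gram)
  then have "sqrt (((re_sq w - im_sq w) / 2)\<^sup>2 + (re_im w)\<^sup>2) = s"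
    using \<open>0 \<le> s\<close> by (metis real_sqrt_abs abs_of_nonneg)
  then have a: "top_sv w = a"
    using assms by (simp add: top_sv_def s_def)
  have "D = - (1 / a) *\<^sub>R (transpose B ** J_mat ** B)"
  proof (rule matrix_eq[THEN iffD2], rule allI)
    fix y
    have "(- (1 / a) *\<^sub>R (transpose B ** J_mat ** B)) *v y = - (1 / a) *\<^sub>R ((transpose B ** J_mat ** B) *v y)"
      by (rule scaleR_matrix_vector_assoc[symmetric])
    then show "D *v y = (- (1 / a) *\<^sub>R (transpose B ** J_mat ** B)) *v y"
      using D_eq[OF False, of y] by (simp only: matrix_vector_mul_assoc[symmetric])
  qed
  then show ?thesis
    unfolding w_def[symmetric] nil_section_def B a by (simp add: M)
qed

text \<open>If M^2 = 0, the upper block of M^2 (x, 0) says B B^t x = a^2 x for every x: the rows of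
  B are orthogonal and of equal length.\<close>

lemma in_quadric:
  assumes "M ** M = 0"
  shows "p_coord M \<in> quadric"
proof -
  define w where "w = p_coord M"
  have B: "rows_mat w = B"
    by (simp add: w_def M rows_mat_p_coord)
  have "B *v (transpose B *v x) = a\<^sup>2 *\<^sub>R x" for x
  proof -
    have "M *v (M *v joinv x 0) = 0"
      by (simp add: matrix_vector_mul_assoc assms)
    then have "B *v (transpose B *v x) - a\<^sup>2 *\<^sub>R x = 0"
      by (simp add: M_joinv matrix_vector_mult_0_right matrix_vector_mult_scaleR J_mat_simps
          joinv_arith power2_eq_square)
    then show ?thesis
      by simp
  qed
  from this[of "axis 1 1"] this[of "axis 2 1"]
  have "B $ 1 \<bullet> B $ 1 = a\<^sup>2" "B $ 2 \<bullet> B $ 2 = a\<^sup>2" "B $ 1 \<bullet> B $ 2 = 0"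
    by (simp_all add: real2_eq_iff mat2_mult_nth transpose_mult_2 axis_def)
  then show ?thesis
    unfolding w_def[symmetric] quadric_iff_gram using gram_rows_mat[of w] by (simp add: B)
qed

end

section \<open>The identity component of the group\<close>

lemma inner_matrix_transpose: "(A *v v) \<bullet> u = v \<bullet> (transpose A *v u)" for A :: "real^'n^'m"
  by (metis dot_lmul_matrix inner_commute transpose_matrix_vector transpose_transpose)

lemma form2q_transform_iff:
  "transpose g ** form2q ** g = form2q \<longleftrightarrow> (\<forall>v w. frm (g *v v) (g *v w) = frm v w)"
proof -
  have "frm (g *v v) (g *v w) = v \<bullet> ((transpose g ** form2q ** g) *v w)" for v w
    by (simp add: frm_def inner_matrix_transpose matrix_vector_mul_assoc matrix_mul_assoc)
  then show ?thesis
    by (simp only: frm_def vector_eq_ldot matrix_eq) (metis vector_eq_ldot)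
qed

lemma form2q_involution: "form2q ** form2q = mat 1"
proof (rule matrix_eq[THEN iffD2], rule allI)
  fix v :: "real^(2 + 'a)"
  show "(form2q ** form2q) *v v = mat 1 *v v"
    by (cases v rule: joinv_cases) (simp add: matrix_vector_mul_assoc[symmetric] form2q_joinv)
qed

lemma det_form2q: "det (form2q :: real^(2 + 'q::finite)^(2 + 'q)) \<noteq> 0"
proof
  assume "det (form2q :: real^(2 + 'q)^(2 + 'q)) = 0"
  then have "det (form2q ** form2q :: real^(2 + 'q)^(2 + 'q)) = 0"
    by (simp add: det_mul)
  then show False
    by (simp add: form2q_involution)
qed

lemma form_preserving_det:
  assumes "\<And>v w. frm (g *v v) (g *v w) = frm v w"
  shows "det g = 1 \<or> det g = - 1"
proof -
  have "transpose g ** form2q ** g = form2q"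
    using assms by (simp add: form2q_transform_iff)
  then have "det (transpose g ** form2q ** g) = det (form2q :: real^(2 + 'a)^(2 + 'a))"
    by (simp only:)
  then have "det g * det g = 1"
    using det_form2q[where 'q = 'a] by (simp add: det_mul)
  then show ?thesis
    by (simp only: square_eq_1_iff)
qed

lemma SO2q_iff: "g \<in> SO2q \<longleftrightarrow> (\<forall>v w. frm (g *v v) (g *v w) = frm v w) \<and> det g = 1"
  by (simp add: SO2q_def form2q_transform_iff)

lemma SO2q0_subset: "SO2q0 \<subseteq> SO2q"
  unfolding SO2q0_def by (rule connected_component_subset)

lemma connected_SO2q0: "connected SO2q0"
  unfolding SO2q0_def by (rule connected_connected_component)

lemma mat_1_in_SO2q0: "mat 1 \<in> SO2q0"
  unfolding SO2q0_def by (simp add: connected_component_refl_eq SO2q_iff)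

lemma SO2q0_frm: "g \<in> SO2q0 \<Longrightarrow> frm (g *v v) (g *v w) = frm v w"
  using SO2q0_subset SO2q_iff by blast

lemma matrix_inv_inverse:
  assumes "invertible A"
  shows "A ** matrix_inv A = mat 1" "matrix_inv A ** A = mat 1"
  using assms someI_ex[of "\<lambda>A'. A ** A' = mat 1 \<and> A' ** A = mat 1"]
  unfolding invertible_def matrix_inv_def by blast+

lemma SO2q0_inverse:
  assumes "g \<in> SO2q0"
  shows "g *v (matrix_inv g *v v) = v" "matrix_inv g *v (g *v v) = v"
proof -
  have "det g = 1"
    using assms SO2q0_subset SO2q_iff by blast
  then have "invertible g"
    by (simp add: invertible_det_nz)
  then show "g *v (matrix_inv g *v v) = v" "matrix_inv g *v (g *v v) = v"
    by (simp_all add: matrix_vector_mul_assoc matrix_inv_inverse)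
qed

lemma connected_subset_SO2q_imp_SO2q0:
  assumes "connected T" "T \<subseteq> SO2q" "g \<in> T" "h \<in> T" "g \<in> SO2q0"
  shows "h \<in> SO2q0"
proof -
  have "connected_component SO2q g h"
    using assms unfolding connected_component_def by blast
  moreover have "connected_component SO2q (mat 1) g"
    using assms(5) by (simp add: SO2q0_def)
  ultimately show ?thesis
    unfolding SO2q0_def using connected_component_trans by blast
qed

lemma continuous_on_matrix_mult [continuous_intros]:
  fixes f :: "'a::topological_space \<Rightarrow> real^'n^'m" and g :: "'a \<Rightarrow> real^'k^'n"
  assumes "continuous_on S f" "continuous_on S g"
  shows "continuous_on S (\<lambda>x. f x ** g x)"
  unfolding matrix_matrix_mult_def using assms by (intro continuous_on_vec_lambda continuous_intros)

lemma continuous_on_matrix_vector_mult [continuous_intros]: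
  fixes f :: "'a::topological_space \<Rightarrow> real^'n^'m"
  assumes "continuous_on S f" "continuous_on S g"
  shows "continuous_on S (\<lambda>x. f x *v g x)"
  unfolding matrix_vector_mult_def using assms by (intro continuous_on_vec_lambda continuous_intros)

lemma SO2q0_mult:
  assumes "g \<in> SO2q0" "h \<in> SO2q0"
  shows "g ** h \<in> SO2q0"
proof (rule connected_subset_SO2q_imp_SO2q0)
  show "connected ((\<lambda>x. g ** x) ` SO2q0)"
    by (intro connected_continuous_image continuous_intros connected_SO2q0)
  have "g ** x \<in> SO2q" if "x \<in> SO2q" for x
    using that assms(1) SO2q0_subset
    by (auto simp: SO2q_iff matrix_vector_mul_assoc[symmetric] det_mul)
  then show "(\<lambda>x. g ** x) ` SO2q0 \<subseteq> SO2q"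
    using SO2q0_subset by blast
  show "g \<in> (\<lambda>x. g ** x) ` SO2q0"
    using mat_1_in_SO2q0 by (auto intro!: image_eqI[of _ _ "mat 1"])
qed (use assms in auto)

section \<open>Adjoint orbits of bivectors\<close>

definition wedge :: "real^(2 + 'q::finite) \<Rightarrow> real^(2 + 'q) \<Rightarrow> real^(2 + 'q)^(2 + 'q)"
  where "wedge u n = (\<chi> i j. u $ i * (form2q *v n) $ j - n $ i * (form2q *v u) $ j)"

lemma form2q_nth: "(form2q *v n) $ Inl a = n $ Inl a" "(form2q *v n) $ Inr i = - n $ Inr i"
  by (cases n rule: joinv_cases, simp add: form2q_joinv)+

lemma wedge_nth: "wedge u n $ i $ j = u $ i * (form2q *v n) $ j - n $ i * (form2q *v u) $ j"
  by (simp add: wedge_def)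

lemma matrix_vector_mult_nth: "(A *v x) $ i = (\<Sum>j\<in>UNIV. A $ i $ j * x $ j)"
  by (simp add: matrix_vector_mult_def)

lemma frm_eq_sum: "frm x v = (\<Sum>j\<in>UNIV. (form2q *v x) $ j * v $ j)"
proof -
  have "frm v x = (\<Sum>j\<in>UNIV. (form2q *v x) $ j * v $ j)"
    by (simp add: frm_def inner_vec_def mult.commute)
  then show ?thesis
    by (simp only: frm_commute[of x v])
qed

lemma wedge_mult: "wedge u n *v v = frm n v *\<^sub>R u - frm u v *\<^sub>R n"
proof (rule vec_eq_iff[THEN iffD2], rule allI)
  fix i
  have "(wedge u n *v v) $ i = (\<Sum>j\<in>UNIV. u $ i * ((form2q *v n) $ j * v $ j) - n $ i * ((form2q *v u) $ j * v $ j))"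
    unfolding matrix_vector_mult_nth[of "wedge u n"] wedge_nth by (simp only: left_diff_distrib mult.assoc)
  then show "(wedge u n *v v) $ i = (frm n v *\<^sub>R u - frm u v *\<^sub>R n) $ i"
    by (simp add: sum_subtractf sum_distrib_left[symmetric] frm_eq_sum mult.commute)
qed

lemma wedge_linear:
  "wedge (u + u') n = wedge u n + wedge u' n" "wedge (c *\<^sub>R u) n = c *\<^sub>R wedge u n"
  "wedge u (c *\<^sub>R n) = c *\<^sub>R wedge u n"
  by (simp_all add: vec_eq_iff wedge_nth matrix_vector_right_distrib matrix_vector_mult_scaleR algebra_simps)

text \<open>Since g preserves the form, conjugation moves both factors of the bivector, and an
  adjoint orbit is described by the images of two vectors.\<close>

lemma wedge_conjugate:
  assumes "g \<in> SO2q0"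
  shows "g ** wedge u n ** matrix_inv g = wedge (g *v u) (g *v n)"
proof (rule matrix_eq[THEN iffD2], rule allI)
  fix v
  have "frm x (matrix_inv g *v v) = frm (g *v x) v" for x
    using SO2q0_frm[OF assms, of x "matrix_inv g *v v"] SO2q0_inverse[OF assms] by simp
  then show "(g ** wedge u n ** matrix_inv g) *v v = wedge (g *v u) (g *v n) *v v"
    by (simp add: matrix_vector_mul_assoc[symmetric] wedge_mult matrix_vector_mult_diff_distrib
        matrix_vector_mult_scaleR)
qed

lemma adjoint_orbit_wedge: "adjoint_orbit (wedge u n) = (\<lambda>g. wedge (g *v u) (g *v n)) ` SO2q0"
proof -
  have "adjoint_orbit (wedge u n) = (\<lambda>g. g ** wedge u n ** matrix_inv g) ` SO2q0"
    by (auto simp: adjoint_orbit_def)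
  also have "\<dots> = (\<lambda>g. wedge (g *v u) (g *v n)) ` SO2q0"
    by (intro image_cong wedge_conjugate refl)
  finally show ?thesis .
qed

lemma wedge_blk:
  obtains B D where "wedge u n = blk ((u $ Inl 1 * n $ Inl 2 - n $ Inl 1 * u $ Inl 2) *\<^sub>R J_mat) B (transpose B) D"
    "transpose D = - D"
proof
  let ?B = "\<chi> a j. wedge u n $ Inl a $ Inr j" and ?D = "\<chi> i j. wedge u n $ Inr i $ Inr j"
  show "wedge u n = blk ((u $ Inl 1 * n $ Inl 2 - n $ Inl 1 * u $ Inl 2) *\<^sub>R J_mat) ?B (transpose ?B) ?D"
    by (simp add: mat_sum_eq_iff forall_2 wedge_nth form2q_nth transpose_def J_mat_def algebra_simps)
  show "transpose ?D = - ?D"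
    by (simp add: vec_eq_iff transpose_def wedge_nth form2q_nth algebra_simps)
qed

text \<open>Write M for the bivector. Its image lies in the span of u and n; M n = 0 and M u = -
  (frm u u) n give M^3 = 0, and the form at M v is (frm n v)^2 (frm u u).\<close>

lemma wedge_nilpotent_nonneg:
  assumes "frm n n = 0" "frm u n = 0" "0 \<le> frm u u"
  obtains B D where "nilpotent_nonneg (u $ Inl 1 * n $ Inl 2 - n $ Inl 1 * u $ Inl 2) B D (wedge u n)"
proof -
  obtain B D where BD: "wedge u n = blk ((u $ Inl 1 * n $ Inl 2 - n $ Inl 1 * u $ Inl 2) *\<^sub>R J_mat) B (transpose B) D"
    "transpose D = - D"
    by (rule wedge_blk)
  have "nilpotent_nonneg (u $ Inl 1 * n $ Inl 2 - n $ Inl 1 * u $ Inl 2) B D (wedge u n)"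
  proof
    show "wedge u n *v (wedge u n *v (wedge u n *v v)) = 0" for v
      using assms by (simp add: wedge_mult frm_linear frm_linear' frm_commute[of n u])
    have "frm (wedge u n *v v) (wedge u n *v v) = (frm n v)\<^sup>2 * frm u u" for v
      using assms by (simp add: wedge_mult frm_linear frm_linear' frm_commute[of n u] power2_eq_square)
    then show "0 \<le> frm (wedge u n *v v) (wedge u n *v v)" for v
      using assms(3) by simp
  qed (fact BD)+
  then show thesis ..
qed

text \<open>Along the connected group, the entry \<open>a\<close> of an element of the orbit never vanishes, so it keeps
  its sign.\<close>

lemma orbit_wedge_in_section:
  fixes u n :: "real^(2 + 'q::finite)"
  assumes n: "frm n n = 0" "frm u n = 0" "0 \<le> frm u u"
    and pos: "u $ Inl 1 * n $ Inl 2 - n $ Inl 1 * u $ Inl 2 > 0"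
    and M: "M \<in> adjoint_orbit (wedge u n)"
  shows "M = nil_section (p_coord M)" "frm u u = 0 \<Longrightarrow> p_coord M \<in> quadric"
proof -
  define \<phi> where "\<phi> g = ((g :: real^(2 + 'q)^(2 + 'q)) *v u) $ Inl 1 * (g *v n) $ Inl 2 - (g *v n) $ Inl 1 * (g *v u) $ Inl 2" for g
  have nn: "\<exists>B D. nilpotent_nonneg (\<phi> g) B D (wedge (g *v u) (g *v n))" if "g \<in> SO2q0" for g
    unfolding \<phi>_def using n SO2q0_frm[OF that]
    by (metis wedge_nilpotent_nonneg[of "g *v n" "g *v u"])
  have nz: "\<phi> g \<noteq> 0" if g: "g \<in> SO2q0" for g
  proof
    assume "\<phi> g = 0"
    then have "wedge (g *v u) (g *v n) = 0"
      using nn[OF g] nilpotent_nonneg.zero_if_a_zero by blast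
    \<comment> \<open>A vanishing conjugate would make \<open>wedge u n\<close> zero, but its entry
      at \<open>Inl 1\<close>, \<open>Inl 2\<close> is the positive number of
      \<open>pos\<close>.\<close>
    then have "g *v (wedge u n *v v) = 0" for v
      using wedge_conjugate[OF g, of u n] SO2q0_inverse(2)[OF g, of v]
      by (metis matrix_vector_mul_assoc matrix_vector_mult_0)
    then have "wedge u n *v v = 0" for v
      using SO2q0_inverse(2)[OF g] by (metis matrix_vector_mult_0_right)
    then have "wedge u n = 0"
      by (intro matrix_eq[THEN iffD2]) simp
    then have "wedge u n $ Inl 1 $ Inl 2 = 0"
      by simp
    with pos show False
      by (simp add: wedge_nth form2q_nth)
  qed
  have conn: "connected (\<phi> ` SO2q0)"
    unfolding \<phi>_def by (intro connected_continuous_image continuous_intros connected_SO2q0)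
  have "\<phi> (mat 1) > 0"
    using pos by (simp add: \<phi>_def)
  have pos_\<phi>: "\<phi> g > 0" if "g \<in> SO2q0" for g
  proof (rule ccontr)
    assume "\<not> \<phi> g > 0"
    then have "0 \<in> \<phi> ` SO2q0"
      using conn[unfolded connected_iff_interval, rule_format, of "\<phi> g" "\<phi> (mat 1)" 0]
        \<open>\<phi> (mat 1) > 0\<close> imageI[OF that, of \<phi>] imageI[OF mat_1_in_SO2q0, of \<phi>] by linarith
    then show False
      using nz by auto
  qed
  obtain g where g: "g \<in> SO2q0" "M = wedge (g *v u) (g *v n)"
    using M by (auto simp: adjoint_orbit_wedge)
  obtain B D where "nilpotent_nonneg (\<phi> g) B D M"
    using nn[OF g(1)] g(2) by blast
  then interpret nilpotent_nonneg "\<phi> g" B D M .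
  show "M = nil_section (p_coord M)"
    using pos_\<phi>[OF g(1)] by (intro eq_nil_section) simp
  show "p_coord M \<in> quadric" if "frm u u = 0"
  proof (rule in_quadric, rule matrix_eq[THEN iffD2], rule allI)
    fix v
    show "(M ** M) *v v = 0 *v v"
      using n that by (simp add: matrix_vector_mul_assoc[symmetric] g(2) wedge_mult frm_linear frm_linear'
          SO2q0_frm[OF g(1)] frm_commute[of n u])
  qed
qed

lemma closure_orbit_wedge_conjugate:
  assumes g: "g \<in> SO2q0" and M: "wedge u' n' \<in> closure (adjoint_orbit (wedge u n))"
  shows "wedge (g *v u') (g *v n') \<in> closure (adjoint_orbit (wedge u n))"
proof -
  let ?f = "\<lambda>M. g ** M ** matrix_inv g"
  have "?f ` adjoint_orbit (wedge u n) \<subseteq> adjoint_orbit (wedge u n)"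
  proof
    fix M assume "M \<in> ?f ` adjoint_orbit (wedge u n)"
    then obtain h where "h \<in> SO2q0" "M = wedge (g *v (h *v u)) (g *v (h *v n))"
      by (auto simp: adjoint_orbit_wedge wedge_conjugate[OF g])
    then show "M \<in> adjoint_orbit (wedge u n)"
      unfolding adjoint_orbit_wedge using SO2q0_mult[OF g]
      by (intro image_eqI[of _ _ "g ** h"]) (simp_all add: matrix_vector_mul_assoc)
  qed
  moreover have "continuous_on (closure (adjoint_orbit (wedge u n))) ?f"
    by (intro continuous_intros)
  ultimately have "?f ` closure (adjoint_orbit (wedge u n)) \<subseteq> closure (adjoint_orbit (wedge u n))"
    by (meson closed_closure closure_subset image_closure_subset order_trans)
  then show ?thesis
    using M wedge_conjugate[OF g, of u' n'] by force
qed

text \<open>Both conditions are closed, the first because \<open>nil_section\<close> is continuous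
  everywhere, including at 0. So they pass from the orbit to its closure.\<close>

lemma closure_orbit_in_section:
  fixes u n :: "real^(2 + 'q::finite)"
  assumes "frm n n = 0" "frm u n = 0" "0 \<le> frm u u"
    and "u $ Inl 1 * n $ Inl 2 - n $ Inl 1 * u $ Inl 2 > 0"
    and "M \<in> closure (adjoint_orbit (wedge u n))"
  shows "M = nil_section (p_coord M)" "frm u u = 0 \<Longrightarrow> p_coord M \<in> quadric"
proof -
  have cont: "continuous_on UNIV (p_coord :: real^(2 + 'q)^(2 + 'q) \<Rightarrow> complex^'q)"
    unfolding p_coord_def Complex_eq by (intro continuous_on_vec_lambda continuous_intros)
  have cont_section: "continuous_on UNIV (\<lambda>M :: real^(2 + 'q)^(2 + 'q). nil_section (p_coord M))"
    using continuous_on_compose[OF cont continuous_on_nil_section] by (simp add: o_def)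
  have "closed {M :: real^(2 + 'q)^(2 + 'q). M = nil_section (p_coord M)}"
    using closed_Collect_eq[OF continuous_on_id cont_section] by simp
  moreover have "adjoint_orbit (wedge u n) \<subseteq> {M. M = nil_section (p_coord M)}"
    using orbit_wedge_in_section(1)[OF assms(1-4)] by blast
  ultimately show "M = nil_section (p_coord M)"
    using assms(5) closure_minimal by blast
  assume "frm u u = 0"
  have "closed (quadric :: (complex^'q) set)"
    unfolding quadric_def by (intro closed_Collect_eq continuous_intros)
  then have "closed (p_coord -` (quadric :: (complex^'q) set))"
    using cont by (simp add: closed_vimage)
  moreover have "adjoint_orbit (wedge u n) \<subseteq> p_coord -` quadric"
    using orbit_wedge_in_section(2)[OF assms(1-4) _ \<open>frm u u = 0\<close>] by blast
  ultimately show "p_coord M \<in> quadric"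
    using assms(5) closure_minimal by blast
qed

text \<open>Products of two reflections in vectors that are joined by a segment of non-isotropic vectors
  lie in the identity component; they supply all the group elements that are needed.\<close>

definition form_refl :: "real^(2 + 'q::finite) \<Rightarrow> real^(2 + 'q)^(2 + 'q)"
  where "form_refl u = (\<chi> i j. (if i = j then 1 else 0) - 2 / frm u u * (u $ i * (form2q *v u) $ j))"

lemma form_refl_mult: "form_refl u *v v = v - (2 * frm u v / frm u u) *\<^sub>R u"
proof (rule vec_eq_iff[THEN iffD2], rule allI)
  fix i
  define c where "c = 2 / frm u u * u $ i"
  have "(form_refl u *v v) $ i = (\<Sum>j\<in>UNIV. (if i = j then v $ j else 0) - c * ((form2q *v u) $ j * v $ j))"
    unfolding matrix_vector_mult_nth[of "form_refl u"]
    by (intro sum.cong) (simp_all add: form_refl_def c_def algebra_simps)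
  also have "\<dots> = v $ i - c * frm u v"
    by (simp add: sum_subtractf sum_distrib_left[symmetric] frm_eq_sum[of u v])
  finally show "(form_refl u *v v) $ i = (v - (2 * frm u v / frm u u) *\<^sub>R u) $ i"
    by (simp add: c_def)
qed

lemma form_refl_frm:
  assumes "frm u u \<noteq> 0"
  shows "frm (form_refl u *v v) (form_refl u *v w) = frm v w"
  using assms by (simp add: form_refl_mult frm_linear frm_linear' frm_commute[of v u] field_simps)

lemma form_refl_involution:
  assumes "frm u u \<noteq> 0"
  shows "form_refl u ** form_refl u = mat 1"
proof (rule matrix_eq[THEN iffD2], rule allI)
  fix v
  show "(form_refl u ** form_refl u) *v v = mat 1 *v v"
  proof -
    have "frm u (form_refl u *v v) = - frm u v"
      using assms by (simp add: form_refl_mult frm_linear')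
    then have "form_refl u *v (form_refl u *v v) = v"
      unfolding form_refl_mult[of u "form_refl u *v v"] by (simp add: form_refl_mult)
    then show ?thesis
      by (simp add: matrix_vector_mul_assoc)
  qed
qed

text \<open>The reflection in a followed by the one in a + t b is the identity at t = 0, since
  reflections are involutions. Along this path the determinant is continuous with values among 1 and
  -1, hence constant.\<close>

lemma refl_product_in_SO2q0:
  assumes nn: "\<And>t. t \<in> {0..1} \<Longrightarrow> frm (a + t *\<^sub>R b) (a + t *\<^sub>R b) \<noteq> 0"
  shows "form_refl (a + b) ** form_refl a \<in> SO2q0"
proof -
  define \<gamma> where "\<gamma> t = form_refl (a + t *\<^sub>R b) ** form_refl a" for t
  have a: "frm a a \<noteq> 0"
    using nn[of 0] by simp
  have pres: "frm (\<gamma> t *v v) (\<gamma> t *v w) = frm v w" if "t \<in> {0..1}" for t v w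
    using form_refl_frm[OF nn[OF that]] form_refl_frm[OF a]
    by (simp add: \<gamma>_def matrix_vector_mul_assoc[symmetric])
  have cont: "continuous_on {0..1} \<gamma>"
    unfolding \<gamma>_def
  proof (intro continuous_on_matrix_mult continuous_on_const continuous_on_matI)
    fix i j
    have "continuous_on {0..1} (\<lambda>t. frm (a + t *\<^sub>R b) (a + t *\<^sub>R b))"
      unfolding frm_linear frm_linear' by (intro continuous_intros)
    then show "continuous_on {0..1} (\<lambda>t. form_refl (a + t *\<^sub>R b) $ i $ j)"
      unfolding form_refl_def vec_lambda_beta matrix_vector_right_distrib matrix_vector_mult_scaleR
        vector_add_component vector_scaleR_component
      by (intro continuous_intros) (simp_all add: nn)
  qed
  have det1: "det (\<gamma> t) = 1" if t: "t \<in> {0..1}" for t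
  proof (rule ccontr)
    assume "det (\<gamma> t) \<noteq> 1"
    then have "det (\<gamma> t) = - 1"
      using form_preserving_det[OF pres[OF t]] by blast
    moreover have "det (\<gamma> 0) = 1"
      using form_refl_involution[OF a] by (simp add: \<gamma>_def)
    moreover have conn: "connected ((\<lambda>t. det (\<gamma> t)) ` {0..1})"
      unfolding det_def using cont
      by (intro connected_continuous_image continuous_intros connected_Icc)
    ultimately have "0 \<in> (\<lambda>t. det (\<gamma> t)) ` {0..1}"
      using conn[unfolded connected_iff_interval, rule_format, of "det (\<gamma> t)" "det (\<gamma> 0)" 0]
        imageI[OF t, of "\<lambda>t. det (\<gamma> t)"] imageI[of 0 "{0..1}" "\<lambda>t. det (\<gamma> t)"] by simp
    then obtain r where "r \<in> {0..1}" "det (\<gamma> r) = 0"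
      by auto
    then show False
      using form_preserving_det[OF pres] by force
  qed
  show ?thesis
  proof (rule connected_subset_SO2q_imp_SO2q0)
    show "connected (\<gamma> ` {0..1})"
      using cont by (intro connected_continuous_image connected_Icc)
    show "\<gamma> ` {0..1} \<subseteq> SO2q"
      using pres det1 by (auto simp: SO2q_iff)
    show "mat 1 \<in> \<gamma> ` {0..1}"
      using form_refl_involution[OF a] by (intro image_eqI[of _ _ 0]) (simp_all add: \<gamma>_def)
    show "form_refl (a + b) ** form_refl a \<in> \<gamma> ` {0..1}"
      by (intro image_eqI[of _ _ 1]) (simp_all add: \<gamma>_def)
  qed (rule mat_1_in_SO2q0)
qed

text \<open>Reflection in a sends a to - a, and reflection in a + b sends - a to b because a and b
  have the same norm. The bound on \<open>frm a b / N\<close> keeps the segment from a to a + b free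
  of isotropic vectors.\<close>

lemma refl_product_move:
  assumes N: "frm a a = N" "frm b b = N" "N \<noteq> 0" "frm a b / N > - 1"
  defines "g \<equiv> form_refl (a + b) ** form_refl a"
  shows "g \<in> SO2q0" "g *v a = b" "frm a v = 0 \<Longrightarrow> frm b v = 0 \<Longrightarrow> g *v v = v"
proof -
  define k where "k = frm a b / N"
  have ab: "frm a b = k * N" "frm b a = k * N"
    using N(3) frm_commute[of a b] by (simp_all add: k_def)
  have "frm (a + t *\<^sub>R b) (a + t *\<^sub>R b) \<noteq> 0" if "t \<in> {0..1}" for t
  proof -
    have "1 + t\<^sup>2 + 2 * t * k > 0"
    proof (cases "t = 0")
      case False
      then have "2 * t * k > 2 * t * (- 1)"
        using that N(4) by (intro mult_strict_left_mono) (auto simp: k_def)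
      moreover have "0 \<le> (1 - t)\<^sup>2"
        by simp
      ultimately show ?thesis
        by (simp add: power2_eq_square algebra_simps)
    qed simp
    moreover have "frm (a + t *\<^sub>R b) (a + t *\<^sub>R b) = N * (1 + t\<^sup>2 + 2 * t * k)"
      by (simp add: frm_linear frm_linear' ab N(1,2) power2_eq_square algebra_simps)
    ultimately show ?thesis
      using N(3) by simp
  qed
  then show "g \<in> SO2q0"
    unfolding g_def by (rule refl_product_in_SO2q0)
  have k: "1 + k \<noteq> 0"
    using N(4) by (simp add: k_def)
  have "form_refl a *v a = - a"
    using N(1,3) by (simp add: form_refl_mult scaleR_2)
  then have "g *v a = form_refl (a + b) *v (- a)"
    by (simp add: g_def matrix_vector_mul_assoc[symmetric])
  also have "\<dots> = - a - (2 * (- N * (1 + k)) / (2 * N * (1 + k))) *\<^sub>R (a + b)"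
    by (simp add: form_refl_mult frm_linear frm_linear' ab N(1,2) algebra_simps)
  also have "2 * (- N * (1 + k)) / (2 * N * (1 + k)) = - 1"
    using k N(3) by simp
  finally show "g *v a = b"
    by simp
  show "g *v v = v" if "frm a v = 0" "frm b v = 0"
    using that by (simp add: g_def matrix_vector_mul_assoc[symmetric] form_refl_mult frm_linear)
qed

section \<open>Rotations and boosts acting on frames\<close>

definition refl_vec :: "'a::real_inner \<Rightarrow> 'a \<Rightarrow> 'a"
  where "refl_vec u z = z - (2 * (u \<bullet> z) / (u \<bullet> u)) *\<^sub>R u"

lemma refl_vec_move:
  assumes "y \<bullet> y = 1" "y' \<bullet> y' = 1" "y' \<noteq> - y"
  shows "refl_vec (y + y') (refl_vec y y) = y'" "y \<bullet> y' > - 1"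
proof -
  have "y + y' \<noteq> 0"
    using assms(3) by (metis add.commute eq_neg_iff_add_eq_0)
  then have "(y + y') \<bullet> (y + y') > 0"
    by simp
  then have pos: "2 + 2 * (y \<bullet> y') > 0"
    using assms by (simp add: inner_add_left inner_add_right inner_commute)
  then show "y \<bullet> y' > - 1"
    by simp
  have "refl_vec y y = - y"
    using assms(1) by (simp add: refl_vec_def scaleR_2)
  then have "refl_vec (y + y') (refl_vec y y) = - y - (- (2 + 2 * (y \<bullet> y')) / (2 + 2 * (y \<bullet> y'))) *\<^sub>R (y + y')"
    using assms by (simp add: refl_vec_def inner_add_left inner_add_right inner_commute algebra_simps)
  also have "- (2 + 2 * (y \<bullet> y')) / (2 + 2 * (y \<bullet> y')) = - 1"
  proof -
    have "- k / k = - 1" if "k > 0" for k :: real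
      using that by simp
    then show ?thesis
      using pos .
  qed
  finally show "refl_vec (y + y') (refl_vec y y) = y'"
    by simp
qed

text \<open>The type argument records \<open>'q\<close>, which does not occur in the type of
  R.\<close>

definition rot_x :: "'q::finite itself \<Rightarrow> (real^2 \<Rightarrow> real^2) \<Rightarrow> bool"
  where "rot_x _ R \<longleftrightarrow> (\<exists>g \<in> (SO2q0 :: (real^(2 + 'q)^(2 + 'q)) set). \<forall>x z. g *v joinv x z = joinv (R x) z)"

definition rot_y :: "(real^'q::finite \<Rightarrow> real^'q) \<Rightarrow> bool"
  where "rot_y R \<longleftrightarrow> (\<exists>g\<in>SO2q0. \<forall>x z. g *v joinv x z = joinv x (R z))"

lemma form_refl_y: "form_refl (joinv 0 u) *v joinv x z = joinv x (refl_vec u z)"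
  by (simp add: form_refl_mult frm_joinv refl_vec_def joinv_arith)

lemma form_refl_x: "form_refl (joinv u 0) *v joinv x z = joinv (refl_vec u x) z"
  by (simp add: form_refl_mult frm_joinv refl_vec_def joinv_arith)

lemma rot_y_inner: "rot_y R \<Longrightarrow> R z \<bullet> R z' = z \<bullet> z'"
proof -
  assume "rot_y R"
  then obtain g where g: "g \<in> SO2q0" "\<And>x z. g *v joinv x z = joinv x (R z)"
    unfolding rot_y_def by blast
  show ?thesis
    using SO2q0_frm[OF g(1), of "joinv 0 z" "joinv 0 z'"] by (simp add: g(2) frm_joinv)
qed

lemma rot_x_inner: "rot_x TYPE('q::finite) R \<Longrightarrow> R z \<bullet> R z' = z \<bullet> z'"
  unfolding rot_x_def using SO2q0_frm[of _ "joinv z 0" "joinv z' 0"] by (force simp: frm_joinv)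

lemma rot_y_compose: "rot_y R \<Longrightarrow> rot_y R' \<Longrightarrow> rot_y (\<lambda>z. R' (R z))"
  unfolding rot_y_def using SO2q0_mult by (metis matrix_vector_mul_assoc)

lemma rot_x_compose: "rot_x TYPE('q::finite) R \<Longrightarrow> rot_x TYPE('q) R' \<Longrightarrow> rot_x TYPE('q) (\<lambda>z. R' (R z))"
  unfolding rot_x_def using SO2q0_mult by (metis matrix_vector_mul_assoc)

lemma rot_y_move:
  fixes y y' :: "real^'q::finite"
  assumes "y \<bullet> y = 1" "y' \<bullet> y' = 1" "y' \<noteq> - y"
  obtains R where "rot_y R" "R y = y'" "\<And>z. z \<bullet> y = 0 \<Longrightarrow> z \<bullet> y' = 0 \<Longrightarrow> R z = z"
proof
  let ?a = "joinv 0 y" and ?b = "joinv 0 y'"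
  have "form_refl (?a + ?b) ** form_refl ?a \<in> SO2q0"
    using assms refl_vec_move(2)[OF assms]
    by (intro refl_product_move(1)[of _ "- 1"]) (simp_all add: frm_joinv)
  then show "rot_y (\<lambda>z. refl_vec (y + y') (refl_vec y z))"
    unfolding rot_y_def
    by (intro bexI[of _ "form_refl (?a + ?b) ** form_refl ?a"])
      (simp_all add: matrix_vector_mul_assoc[symmetric] joinv_arith form_refl_y)
  show "refl_vec (y + y') (refl_vec y y) = y'"
    by (rule refl_vec_move[OF assms])
  show "refl_vec (y + y') (refl_vec y z) = z" if "z \<bullet> y = 0" "z \<bullet> y' = 0" for z
  proof -
    have "y \<bullet> z = 0" "(y + y') \<bullet> z = 0"
      using that by (simp_all add: inner_add_left inner_commute[of z])
    then show ?thesis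
      by (simp add: refl_vec_def)
  qed
qed

lemma rot_x_move:
  fixes x x' :: "real^2"
  assumes "x \<bullet> x = 1" "x' \<bullet> x' = 1" "x' \<noteq> - x"
  obtains R where "rot_x TYPE('q::finite) R" "R x = x'"
proof
  let ?a = "joinv x (0 :: real^'q)" and ?b = "joinv x' (0 :: real^'q)"
  have "form_refl (?a + ?b) ** form_refl ?a \<in> SO2q0"
    using assms refl_vec_move(2)[OF assms]
    by (intro refl_product_move(1)[of _ 1]) (simp_all add: frm_joinv)
  then show "rot_x TYPE('q) (\<lambda>z. refl_vec (x + x') (refl_vec x z))"
    unfolding rot_x_def
    by (intro bexI[of _ "form_refl (?a + ?b) ** form_refl ?a"])
      (simp_all add: matrix_vector_mul_assoc[symmetric] joinv_arith form_refl_x)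
  show "refl_vec (x + x') (refl_vec x x) = x'"
    by (rule refl_vec_move[OF assms])
qed

text \<open>\<open>rot_x_move\<close> excludes antipodal vectors; these are joined through the
  perpendicular vector J x.\<close>

lemma rot_x_transitive:
  fixes x x' :: "real^2"
  assumes x: "x \<bullet> x = 1" "x' \<bullet> x' = 1"
  obtains R where "rot_x TYPE('q::finite) R" "R x = x'"
proof (cases "x' = - x")
  case True
  let ?z = "J_mat *v x"
  have perp: "x \<bullet> ?z = 0" "?z \<bullet> ?z = 1"
    using x by (simp_all add: J_mat_simps)
  have "?z \<noteq> - x" "x' \<noteq> - ?z"
    using perp x True by auto
  then obtain R R' where R: "rot_x TYPE('q) R" "R x = ?z" "rot_x TYPE('q) R'" "R' ?z = x'"
    using rot_x_move[OF x(1) perp(2)] rot_x_move[OF perp(2) x(2)] by metis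
  then show thesis
    using rot_x_compose that by metis
next
  case False
  then show thesis
    using rot_x_move[OF x] that by metis
qed

lemma ex_unit_orthogonal:
  fixes p q :: "real^'q::finite"
  assumes "CARD('q) \<ge> 3"
  obtains y where "y \<bullet> y = 1" "y \<bullet> p = 0" "y \<bullet> q = 0"
proof -
  have "dim {p, q} \<le> card {p, q}"
    by (rule dim_le_card') simp
  also have "\<dots> < DIM(real^'q)"
    using assms card_insert_le_m1[of 2 "{q}" p] by simp
  finally obtain x where x: "x \<noteq> 0" "\<And>y. y \<in> span {p, q} \<Longrightarrow> orthogonal x y"
    by (rule orthogonal_to_subspace_exists) blast
  have "p \<in> span {p, q}" "q \<in> span {p, q}"
    by (simp_all add: span_base)
  then have "x \<bullet> p = 0" "x \<bullet> q = 0"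
    using x(2) by (simp_all add: orthogonal_def)
  moreover have "(inverse (norm x) *\<^sub>R x) \<bullet> (inverse (norm x) *\<^sub>R x) = 1"
    using x(1) by (simp add: dot_square_norm power2_eq_square)
  ultimately show thesis
    by (intro that[of "inverse (norm x) *\<^sub>R x"]) simp_all
qed

text \<open>First y1 is moved to y1', then the image of y2 to y2' while y1' stays fixed. An
  antipodal pair is joined through a unit vector orthogonal to it and to the fixed vector, which is
  where three dimensions are needed.\<close>

lemma rot_y_pair:
  fixes y1 y2 :: "real^'q::finite"
  assumes card: "CARD('q) \<ge> 3"
    and y: "y1 \<bullet> y1 = 1" "y2 \<bullet> y2 = 1" "y1 \<bullet> y2 = 0"
    and y': "y1' \<bullet> y1' = 1" "y2' \<bullet> y2' = 1" "y1' \<bullet> y2' = 0"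
  obtains R where "rot_y R" "R y1 = y1'" "R y2 = y2'"
proof -
  have move: "\<exists>R. rot_y R \<and> R y = y' \<and> R p = p"
    if y: "y \<bullet> y = 1" "y' \<bullet> y' = 1" and p: "p \<bullet> y = 0" "p \<bullet> y' = 0" for y y' p :: "real^'q"
  proof (cases "y' = - y")
    case True
    obtain z where z: "z \<bullet> z = 1" "z \<bullet> y = 0" "z \<bullet> p = 0"
      using ex_unit_orthogonal[OF card] by metis
    have "z \<noteq> - y" "y' \<noteq> - z"
      using z y True by auto
    then obtain R R' where "rot_y R" "R y = z" "R p = p" "rot_y R'" "R' z = y'" "R' p = p"
      using rot_y_move[OF y(1) z(1)] rot_y_move[OF z(1) y(2)] p z(3) by (metis inner_commute)
    then show ?thesis
      using rot_y_compose by (intro exI[of _ "\<lambda>z. R' (R z)"]) auto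
  next
    case False
    then show ?thesis
      using rot_y_move[OF y False] p by metis
  qed
  obtain R where R: "rot_y R" "R y1 = y1'"
    using move[OF y(1) y'(1), of 0] by auto
  have "R y2 \<bullet> R y2 = 1" "y1' \<bullet> R y2 = 0"
    using rot_y_inner[OF R(1), of y2 y2] rot_y_inner[OF R(1), of y1 y2] R(2) y by simp_all
  then obtain R' where R': "rot_y R'" "R' (R y2) = y2'" "R' y1' = y1'"
    using move[of "R y2" y2' y1'] y' by auto
  then show thesis
    using that[OF rot_y_compose[OF R(1) R'(1)]] R(2) by simp
qed

text \<open>Its off-diagonal block is s1 x1 y1^t + s2 x2 y2^t, a singular value decomposition when
  the frames are orthonormal. In that case n = (x2, - y1) is isotropic and orthogonal to u = (s1 x1,
  s2 y2), and frm u u = s1^2 - s2^2.\<close>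

definition frame_elt :: "real \<Rightarrow> real \<Rightarrow> real^2 \<Rightarrow> real^2 \<Rightarrow> real^'q::finite \<Rightarrow> real^'q \<Rightarrow> real^(2 + 'q)^(2 + 'q)"
  where "frame_elt s1 s2 x1 x2 y1 y2 = wedge (joinv (s1 *\<^sub>R x1) (s2 *\<^sub>R y2)) (joinv x2 (- y1))"

definition orthonormal_pair :: "'a::real_inner \<Rightarrow> 'a \<Rightarrow> bool"
  where "orthonormal_pair x y \<longleftrightarrow> x \<bullet> x = 1 \<and> y \<bullet> y = 1 \<and> x \<bullet> y = 0"

text \<open>In the applications \<open>C\<close> is the closure of an orbit.\<close>

locale invariant_set =
  fixes C :: "(real^(2 + 'q::finite)^(2 + 'q)) set"
  assumes conj_closed: "g \<in> SO2q0 \<Longrightarrow> wedge u n \<in> C \<Longrightarrow> wedge (g *v u) (g *v n) \<in> C"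
    and in_section: "M \<in> C \<Longrightarrow> M = nil_section (p_coord M)"
    and closed_C: "closed C"
    and card: "CARD('q) \<ge> 3"
begin

text \<open>Rotations carry the frames to the new ones, except that x2 may go to either unit vector
  orthogonal to x1'. The sign is decided by membership in C: the entry at \<open>Inl 1\<close>,
  \<open>Inl 2\<close> equals some \<open>top_sv w\<close> and so is nonnegative.\<close>

lemma frame_change:
  assumes mem: "frame_elt s1 s2 x1 x2 y1 y2 \<in> C" and s1: "s1 > 0"
    and on: "orthonormal_pair x1 x2" "orthonormal_pair y1 y2" "x1' \<bullet> x1' = 1" "orthonormal_pair y1' y2'"
  shows "frame_elt s1 s2 x1' (- (J_mat *v x1')) y1' y2' \<in> C"
proof -
  obtain R where "rot_y R" and R: "R y1 = y1'" "R y2 = y2'"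
    using rot_y_pair[OF card] on unfolding orthonormal_pair_def by metis
  then obtain g where g: "g \<in> SO2q0" "\<And>x z. g *v joinv x z = joinv x (R z)"
    unfolding rot_y_def by blast
  obtain R' where rot: "rot_x TYPE('q) R'" and R': "R' x1 = x1'"
    using rot_x_transitive on unfolding orthonormal_pair_def by metis
  then obtain g' :: "real^(2 + 'q)^(2 + 'q)" where g': "g' \<in> SO2q0" "\<And>x z. g' *v joinv x z = joinv (R' x) z"
    unfolding rot_x_def by blast
  have gg': "(g' ** g) *v joinv x z = joinv (R' x) (R z)" for x z
    by (simp add: matrix_vector_mul_assoc[symmetric] g g')
  have scale: "R' (c *\<^sub>R x) = c *\<^sub>R R' x" "R (c *\<^sub>R z) = c *\<^sub>R R z" for c x z
    using matrix_vector_mult_scaleR[of "g' ** g" c "joinv x z"] by (simp_all add: gg' joinv_arith)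
  have minus: "R (- z) = - R z" for z
    using scale(2)[of "- 1" z] by simp
  have "wedge ((g' ** g) *v joinv (s1 *\<^sub>R x1) (s2 *\<^sub>R y2)) ((g' ** g) *v joinv x2 (- y1)) \<in> C"
    using mem SO2q0_mult[OF g'(1) g(1)] unfolding frame_elt_def by (intro conj_closed)
  then have mem': "frame_elt s1 s2 x1' (R' x2) y1' y2' \<in> C"
    by (simp add: gg' frame_elt_def scale minus R R')
  let ?x2 = "R' x2"
  have "?x2 \<bullet> ?x2 = 1" "x1' \<bullet> ?x2 = 0"
    using rot_x_inner[OF rot, of x2 x2] rot_x_inner[OF rot, of x1 x2] R' on
    by (simp_all add: orthonormal_pair_def)
  then obtain c where c: "?x2 = c *\<^sub>R (J_mat *v x1')" "c\<^sup>2 = 1"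
    using plane_frame[OF on(3), of ?x2] on(3)
    by (metis (no_types, lifting) J_mat_simps(2) add_0 inner_scaleR_left inner_scaleR_right mult.right_neutral
        power2_eq_square scaleR_zero_left)
  have "0 \<le> frame_elt s1 s2 x1' ?x2 y1' y2' $ Inl 1 $ Inl 2"
  proof -
    have "nil_section w $ Inl 1 $ Inl 2 = top_sv w" for w :: "complex^'q"
      by (simp add: nil_section_def J_mat_def)
    then show ?thesis
      using in_section[OF mem'] top_sv_nonneg by metis
  qed
  also have "frame_elt s1 s2 x1' ?x2 y1' y2' $ Inl 1 $ Inl 2 = - (c * s1 * (x1' \<bullet> x1'))"
    by (simp add: frame_elt_def wedge_nth form2q_nth c(1) J_mat_mult inner_2 algebra_simps)
  finally have "c \<le> 0"
    using s1 on(3) by (simp add: mult_le_0_iff)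
  then have "c = - 1"
    using c(2) by (simp add: power2_eq_1_iff)
  then show ?thesis
    using mem' c(1) by simp
qed

text \<open>A hyperbolic rotation in the plane of (x1, 0) and (0, y2), which is orthogonal to n: it
  fixes n and moves u = (x1, 0) to (ch x1, sh y2).\<close>

lemma boost:
  assumes mem: "frame_elt 1 0 x1 x2 y1 y2 \<in> C" and on: "orthonormal_pair x1 x2" "orthonormal_pair y1 y2"
    and ch: "ch\<^sup>2 - sh\<^sup>2 = 1" "ch > 0"
  shows "frame_elt ch sh x1 x2 y1 y2 \<in> C"
proof -
  let ?a = "joinv x1 (0 :: real^'q)" and ?b = "joinv (ch *\<^sub>R x1) (sh *\<^sub>R y2)" and ?n = "joinv x2 (- y1)"
  note on = on[unfolded orthonormal_pair_def]
  have ab: "frm ?a ?a = 1" "frm ?b ?b = 1" "frm ?a ?b / 1 > - 1"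
    using on ch by (simp_all add: frm_joinv power2_eq_square)
  have "frm ?a ?n = 0" "frm ?b ?n = 0"
    using on by (simp_all add: frm_joinv inner_commute)
  note move = refl_product_move[OF ab(1,2) one_neq_zero ab(3)]
  have "wedge ?a ?n \<in> C"
    using mem by (simp add: frame_elt_def)
  from conj_closed[OF move(1) this] show ?thesis
    unfolding move(2) move(3)[OF \<open>frm ?a ?n = 0\<close> \<open>frm ?b ?n = 0\<close>] by (simp add: frame_elt_def)
qed

text \<open>A boost in the plane of (x2, 0) and (0, y1), which is orthogonal to u. The vector n
  spans an isotropic line of that plane, so it is an eigenvector, with eigenvalue l, and the
  bivector is multiplied by l.\<close>

lemma scale:
  assumes mem: "frame_elt s1 s2 x1 x2 y1 y2 \<in> C" and on: "orthonormal_pair x1 x2" "orthonormal_pair y1 y2"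
    and l: "l > 0"
  shows "frame_elt (l * s1) (l * s2) x1 x2 y1 y2 \<in> C"
proof -
  \<comment> \<open>Hyperbolic cosine and sine of - ln l, so that ch - sh = l.\<close>
  define ch where "ch = (l + 1 / l) / 2"
  define sh where "sh = (1 / l - l) / 2"
  have ch: "ch > 0" "ch * ch = 1 + sh * sh" "ch - sh = l"
    using l by (simp_all add: ch_def sh_def field_simps add_pos_pos)
  let ?a = "joinv x2 (0 :: real^'q)" and ?f = "joinv (0 :: real^2) y1"
  let ?b = "joinv (ch *\<^sub>R x2) (sh *\<^sub>R y1)" and ?u = "joinv (s1 *\<^sub>R x1) (s2 *\<^sub>R y2)"
  let ?g = "form_refl (?a + ?b) ** form_refl ?a"
  note on = on[unfolded orthonormal_pair_def]
  have ab: "frm ?a ?a = 1" "frm ?b ?b = 1" "frm ?a ?b / 1 > - 1"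
    using on ch by (simp_all add: frm_joinv)
  have "frm ?a ?u = 0" "frm ?b ?u = 0"
    using on by (simp_all add: frm_joinv inner_commute)
  note move = refl_product_move[OF ab(1,2) one_neq_zero ab(3)]
  have "form_refl ?a *v ?f = ?f"
    by (simp add: form_refl_mult frm_joinv)
  moreover have "form_refl (?a + ?b) *v ?f = joinv (sh *\<^sub>R x2) (ch *\<^sub>R y1)"
  proof -
    have "frm (?a + ?b) ?f = - sh" "frm (?a + ?b) (?a + ?b) = 2 * (1 + ch)"
      using on ch by (simp_all add: joinv_arith frm_joinv inner_add_left inner_add_right algebra_simps)
    then have "form_refl (?a + ?b) *v ?f = ?f + (sh / (1 + ch)) *\<^sub>R (?a + ?b)"
    proof -
      have "2 * (- sh) / (2 * (1 + ch)) = - (sh / (1 + ch))"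
        using ch(1) by (simp add: field_simps)
      with \<open>frm (?a + ?b) ?f = - sh\<close> \<open>frm (?a + ?b) (?a + ?b) = 2 * (1 + ch)\<close> show ?thesis
        by (simp only: form_refl_mult scaleR_minus_left diff_minus_eq_add)
    qed
    also have "\<dots> = joinv ((sh / (1 + ch) * (1 + ch)) *\<^sub>R x2) ((1 + sh / (1 + ch) * sh) *\<^sub>R y1)"
    proof -
      have "?f + k *\<^sub>R (?a + ?b) = joinv ((k * (1 + ch)) *\<^sub>R x2) ((1 + k * sh) *\<^sub>R y1)" for k
        by (simp add: joinv_arith algebra_simps)
      then show ?thesis .
    qed
    also have "sh / (1 + ch) * (1 + ch) = sh"
      using ch(1) by simp
    also have "1 + sh / (1 + ch) * sh = ch"
      using ch(1,2) by (simp add: field_simps)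
    finally show ?thesis .
  qed
  ultimately have "?g *v ?f = joinv (sh *\<^sub>R x2) (ch *\<^sub>R y1)"
    by (simp add: matrix_vector_mul_assoc[symmetric])
  moreover have "joinv x2 (- y1) = ?a - ?f"
    by (simp add: joinv_arith)
  ultimately have "?g *v joinv x2 (- y1) = ?b - joinv (sh *\<^sub>R x2) (ch *\<^sub>R y1)"
    using move(2) by (simp add: matrix_vector_mult_diff_distrib)
  also have "\<dots> = l *\<^sub>R joinv x2 (- y1)"
    by (simp add: joinv_arith ch(3)[symmetric] algebra_simps)
  finally have n: "?g *v joinv x2 (- y1) = l *\<^sub>R joinv x2 (- y1)" .
  have "wedge (?g *v ?u) (?g *v joinv x2 (- y1)) \<in> C"
    using mem unfolding frame_elt_def by (intro conj_closed move(1))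
  then have "wedge ?u (l *\<^sub>R joinv x2 (- y1)) \<in> C"
    unfolding n move(3)[OF \<open>frm ?a ?u = 0\<close> \<open>frm ?b ?u = 0\<close>] .
  moreover have "wedge ?u (l *\<^sub>R joinv x2 (- y1)) = frame_elt (l * s1) (l * s2) x1 x2 y1 y2"
    unfolding frame_elt_def wedge_linear(3) wedge_linear(2)[symmetric] by (simp add: joinv_arith)
  ultimately show ?thesis
    by simp
qed

lemma limit:
  assumes "\<And>t. t > 0 \<Longrightarrow> M + t *\<^sub>R N \<in> C"
  shows "M \<in> C"
proof (rule Lim_in_closed_set[OF closed_C])
  show "((\<lambda>t. M + t *\<^sub>R N) \<longlongrightarrow> M) (at_right 0)"
    by (auto intro!: tendsto_eq_intros)
  show "\<forall>\<^sub>F t in at_right 0. M + t *\<^sub>R N \<in> C"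
    using eventually_at_right_less[of "0::real"] by eventually_elim (rule assms)
qed simp

lemma section_eqI:
  assumes "M \<in> C" "p_coord M = w"
  shows "nil_section w \<in> C"
  using assms in_section by metis

end

section \<open>Singular value decompositions and the two closures\<close>

lemma frame_elt_nth:
  "frame_elt s1 s2 x1 x2 y1 y2 $ Inl a $ Inr j = s1 * x1 $ a * y1 $ j + s2 * x2 $ a * y2 $ j"
  by (simp add: frame_elt_def wedge_nth form2q_nth)

lemma p_coord_frame_elt:
  assumes "\<And>a. rows_mat w $ a = (s1 * x1 $ a) *\<^sub>R y1 + (s2 * x2 $ a) *\<^sub>R y2"
  shows "p_coord (frame_elt s1 s2 x1 x2 y1 y2) = w"
proof -
  have "frame_elt s1 s2 x1 x2 y1 y2 $ Inl a $ Inr j = rows_mat w $ a $ j" for a j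
    by (simp add: frame_elt_nth assms)
  then show ?thesis
    by (simp add: p_coord_def vec_eq_iff rows_mat_nth)
qed

lemma frame_elt_add:
  "frame_elt s1 s2 x1 x2 y1 y2 + t *\<^sub>R frame_elt r1 r2 x1 x2 y1 y2
    = frame_elt (s1 + t * r1) (s2 + t * r2) x1 x2 y1 y2"
  unfolding frame_elt_def wedge_linear(2)[symmetric] wedge_linear(1)[symmetric]
  by (simp add: joinv_arith algebra_simps)

lemma closure_orbit_frame:
  fixes y1 y2 :: "real^'q::finite"
  assumes on: "orthonormal_pair x1 x2" "orthonormal_pair y1 y2" and s: "\<bar>s2\<bar> \<le> s1"
    and pos: "s1 * (x1 $ 1 * x2 $ 2 - x2 $ 1 * x1 $ 2) > 0" and card: "CARD('q) \<ge> 3"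
  defines "C \<equiv> closure (adjoint_orbit (frame_elt s1 s2 x1 x2 y1 y2))"
  shows "invariant_set C" "frame_elt s1 s2 x1 x2 y1 y2 \<in> C" "s1 = s2 \<Longrightarrow> M \<in> C \<Longrightarrow> p_coord M \<in> quadric"
proof -
  let ?u = "joinv (s1 *\<^sub>R x1) (s2 *\<^sub>R y2)" and ?n = "joinv x2 (- y1)"
  note on = on[unfolded orthonormal_pair_def]
  have C: "C = closure (adjoint_orbit (wedge ?u ?n))"
    by (simp add: C_def frame_elt_def)
  have "s2 * s2 \<le> s1 * s1"
    using s by (metis abs_le_square_iff abs_of_nonneg abs_ge_zero order_trans power2_eq_square)
  then have base: "frm ?n ?n = 0" "frm ?u ?n = 0" "0 \<le> frm ?u ?u"
    "?u $ Inl 1 * ?n $ Inl 2 - ?n $ Inl 1 * ?u $ Inl 2 > 0"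
    using on pos by (simp_all add: frm_joinv inner_commute algebra_simps)
  show "invariant_set C"
  proof
    show "wedge (g *v u) (g *v n) \<in> C" if "g \<in> SO2q0" "wedge u n \<in> C" for g u n
      using that unfolding C by (rule closure_orbit_wedge_conjugate)
    show "M = nil_section (p_coord M)" if "M \<in> C" for M
      using closure_orbit_in_section(1)[OF base] that unfolding C by blast
  qed (simp_all add: C card)
  have "frame_elt s1 s2 x1 x2 y1 y2 \<in> adjoint_orbit (frame_elt s1 s2 x1 x2 y1 y2)"
    unfolding frame_elt_def adjoint_orbit_wedge by (rule image_eqI[OF _ mat_1_in_SO2q0]) simp
  then show "frame_elt s1 s2 x1 x2 y1 y2 \<in> C"
    unfolding C_def by (rule subsetD[OF closure_subset])
  show "p_coord M \<in> quadric" if "s1 = s2" "M \<in> C"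
  proof -
    have "frm ?u ?u = 0"
      using on that(1) by (simp add: frm_joinv)
    then show ?thesis
      using closure_orbit_in_section(2)[OF base] that(2) unfolding C by blast
  qed
qed

lemma unit_multiple:
  fixes b :: "real^'q::finite"
  assumes "b \<noteq> 0"
  obtains y where "y \<bullet> y = 1" "b = norm b *\<^sub>R y"
proof
  show "(inverse (norm b) *\<^sub>R b) \<bullet> (inverse (norm b) *\<^sub>R b) = 1"
    using assms by (simp add: dot_square_norm power2_eq_square)
qed (use assms in simp)

text \<open>A singular value decomposition; \<open>x1\<close> maximises the norm of the image on the unit circle.\<close>

lemma ex_frame:
  fixes w :: "complex^'q::finite"
  assumes card: "CARD('q) \<ge> 3"
  obtains s1 s2 x1 y1 y2 where "x1 \<bullet> x1 = 1" "orthonormal_pair y1 y2" "\<bar>s2\<bar> \<le> s1"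
    "p_coord (frame_elt s1 s2 x1 (- (J_mat *v x1)) y1 y2) = w"
proof -
  let ?B = "rows_mat w"
  define T where "T x = transpose ?B *v x" for x
  define f where "f x = T x \<bullet> T x" for x
  have T: "T (x + y) = T x + T y" "T (c *\<^sub>R x) = c *\<^sub>R T x" "T (- x) = - T x" for x y c
    by (simp_all add: T_def matrix_vector_right_distrib matrix_vector_mult_scaleR matrix_vector_mult_minus)
  have "\<exists>x1\<in>sphere (0 :: real^2) 1. \<forall>y\<in>sphere 0 1. f y \<le> f x1"
    unfolding f_def T_def by (intro continuous_attains_sup continuous_intros) simp_all
  then obtain x1 where x1: "norm x1 = 1" "\<And>y. norm y = 1 \<Longrightarrow> f y \<le> f x1"
    by auto
  have unit: "x1 \<bullet> x1 = 1"
    using x1(1) by (simp add: dot_square_norm)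
  have f_le: "f x \<le> f x1 * (x \<bullet> x)" for x
  proof (cases "x = 0")
    case False
    have "f (inverse (norm x) *\<^sub>R x) \<le> f x1"
      using False by (intro x1(2)) simp
    then have "(inverse (norm x))\<^sup>2 * f x \<le> f x1"
      by (simp add: f_def T power2_eq_square)
    then show ?thesis
      using False by (simp add: dot_square_norm field_simps)
  qed (simp add: f_def T_def matrix_vector_mult_0_right)
  define x2 where "x2 = - (J_mat *v x1)"
  have x2: "x2 \<bullet> x2 = 1" "x1 \<bullet> x2 = 0"
    using unit by (simp_all add: x2_def J_mat_simps)
  define b0 where "b0 = T x1"
  define b2 where "b2 = T x2"
  \<comment> \<open>First-order condition for the maximum of f at x1, in the direction x2: the
    images of x1 and x2 are orthogonal.\<close>
  have "0 \<le> 2 * t * (- (b0 \<bullet> b2)) + t\<^sup>2 * (f x1 - f x2)" for t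
    using f_le[of "x1 + t *\<^sub>R x2"] unit x2
    by (simp add: f_def T b0_def[symmetric] b2_def[symmetric] inner_add_left inner_add_right
        inner_commute[of x2 x1] inner_commute[of b2 b0] power2_eq_square algebra_simps)
  then have "- (b0 \<bullet> b2) = 0"
    by (rule quadratic_nonneg_imp_zero)
  then have perp: "b0 \<bullet> b2 = 0"
    by simp
  have "f x2 \<le> f x1"
    using f_le[of x2] x2 by simp
  then have le: "norm b2 \<le> norm b0"
    by (simp add: f_def b0_def b2_def norm_le)
  have rows: "?B $ a = x1 $ a *\<^sub>R b0 + x2 $ a *\<^sub>R b2" for a
  proof -
    have "?B $ a = T (axis a 1)"
      by (simp add: T_def transpose_def vec_eq_iff matrix_vector_mult_def axis_def
          if_distrib[of "\<lambda>x. _ * x"] cong: if_cong)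
    also have "axis a 1 = x1 $ a *\<^sub>R x1 + x2 $ a *\<^sub>R x2"
      using plane_frame[OF unit, of "axis a 1"] by (simp add: x2_def inner_axis)
    finally show ?thesis
      by (simp add: T b0_def b2_def)
  qed
  obtain y1 where y1: "y1 \<bullet> y1 = 1" "b0 = norm b0 *\<^sub>R y1"
  proof (cases "b0 = 0")
    case True
    then show thesis
      using ex_unit_orthogonal[OF card] that by (metis norm_zero scaleR_zero_left)
  next
    case False
    then show thesis
      using unit_multiple that by metis
  qed
  \<comment> \<open>If b2 vanishes, any unit vector orthogonal to y1 completes the frame. Otherwise
    b0 is nonzero too, being at least as long, and the orthogonality of b0 and b2 passes to their
    directions.\<close>
  obtain y2 where y2: "y2 \<bullet> y2 = 1" "y1 \<bullet> y2 = 0" "b2 = norm b2 *\<^sub>R y2"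
  proof (cases "b2 = 0")
    case True
    then show thesis
      using ex_unit_orthogonal[OF card, of y1 y1] that by (metis inner_commute norm_zero scaleR_zero_left)
  next
    case False
    then obtain y2 where y2: "y2 \<bullet> y2 = 1" "b2 = norm b2 *\<^sub>R y2"
      using unit_multiple by metis
    have "norm b0 * norm b2 * (y1 \<bullet> y2) = b0 \<bullet> b2"
      by (subst y1(2), subst y2(2)) simp
    moreover have "norm b0 > 0" "norm b2 > 0"
      using False le by (auto intro: less_le_trans)
    ultimately have "y1 \<bullet> y2 = 0"
      using perp by simp
    with y2 show thesis
      using that by blast
  qed
  have "?B $ a = (norm b0 * x1 $ a) *\<^sub>R y1 + (norm b2 * x2 $ a) *\<^sub>R y2" for a
    using rows[of a] y1(2) y2(3) by (metis mult.commute scaleR_scaleR)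
  then have "p_coord (frame_elt (norm b0) (norm b2) x1 (- (J_mat *v x1)) y1 y2) = w"
    unfolding x2_def[symmetric] by (rule p_coord_frame_elt)
  then show thesis
    using that[of x1 y1 y2 "norm b2" "norm b0"] unit y1(1) y2(1,2) le
    by (simp add: orthonormal_pair_def)
qed

text \<open>On the quadric the rows of B are orthogonal and of equal length, so the standard basis
  of the plane already gives a decomposition; \<open>- (J_mat *v axis 1 1)\<close> is
  \<open>axis 2 1\<close>.\<close>

lemma ex_frame_quadric:
  fixes w :: "complex^'q::finite"
  assumes card: "CARD('q) \<ge> 3" and w: "w \<in> quadric"
  obtains s y1 y2 where "orthonormal_pair y1 y2" "0 \<le> s"
    "p_coord (frame_elt s s (axis 1 1) (- (J_mat *v axis 1 1)) y1 y2) = w"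
proof -
  let ?B = "rows_mat w"
  define s where "s = norm (?B $ 1)"
  have eq: "?B $ 1 \<bullet> ?B $ 1 = ?B $ 2 \<bullet> ?B $ 2" "?B $ 1 \<bullet> ?B $ 2 = 0"
    using w by (simp_all add: gram_rows_mat quadric_iff_gram)
  then have s: "norm (?B $ 1) = s" "norm (?B $ 2) = s"
    by (simp_all add: s_def norm_eq)
  have "\<exists>y1 y2. orthonormal_pair y1 y2 \<and> ?B $ 1 = s *\<^sub>R y1 \<and> ?B $ 2 = s *\<^sub>R y2"
  proof (cases "s = 0")
    case True
    obtain y1 :: "real^'q" where "y1 \<bullet> y1 = 1"
      using ex_unit_orthogonal[OF card] by metis
    moreover obtain y2 where "y2 \<bullet> y2 = 1" "y2 \<bullet> y1 = 0"
      using ex_unit_orthogonal[OF card, of y1 y1] by metis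
    ultimately show ?thesis
      using True s by (intro exI[of _ y1] exI[of _ y2]) (simp add: orthonormal_pair_def inner_commute)
  next
    case False
    then obtain y1 y2 where y: "y1 \<bullet> y1 = 1" "?B $ 1 = s *\<^sub>R y1" "y2 \<bullet> y2 = 1" "?B $ 2 = s *\<^sub>R y2"
      using unit_multiple[of "?B $ 1"] unit_multiple[of "?B $ 2"] s by (metis norm_zero)
    moreover have "y1 \<bullet> y2 = 0"
      using eq(2) False y(2,4) by simp
    ultimately show ?thesis
      by (auto simp: orthonormal_pair_def)
  qed
  then obtain y1 y2 where y: "orthonormal_pair y1 y2" "?B $ 1 = s *\<^sub>R y1" "?B $ 2 = s *\<^sub>R y2"
    by blast
  have "\<forall>a. ?B $ a = (s * axis 1 1 $ a) *\<^sub>R y1 + (s * (- (J_mat *v axis 1 1)) $ a) *\<^sub>R y2"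
    using y by (simp add: forall_2 J_mat_mult axis_def)
  then have "p_coord (frame_elt s s (axis 1 1) (- (J_mat *v axis 1 1)) y1 y2) = w"
    by (intro p_coord_frame_elt) (rule spec)
  moreover have "0 \<le> s"
    by (simp add: s_def)
  ultimately show thesis
    using that y(1) by blast
qed

text \<open>The antidiagonal \<open>S_mat\<close> pairs row 1 with column \<open>c 2\<close>, which
  explains the order of the last two vectors; both singular values are 1/2.\<close>

lemma e1_eq_frame_elt:
  assumes "inj c"
  shows "e1 c = frame_elt (1/2) (1/2) (axis 1 1) (axis 2 1) (axis (c 2) 1) (axis (c 1) 1)"
proof -
  have "c 1 \<noteq> c 2"
    using assms by (simp add: inj_eq)
  then show ?thesis
    by (auto simp: mat_sum_eq_iff forall_2 e1_def A2_elt_def X_elt_def blk22_def incl_mat_def S_mat_def J_mat_def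
        matrix_matrix_mult_def transpose_def sum_2 frame_elt_def wedge_nth form2q_nth axis_def)
qed

text \<open>The off-diagonal block is (S + I) / 2, with all entries 1/2 in the two columns: rank one
  with singular value 1, and r, which is 1 / sqrt 2 up to sign, normalises the frame.\<close>

lemma e1_e2_eq_frame_elt:
  assumes "inj c" and r: "r * r = 1/2"
  shows "e1 c + e2 c = frame_elt 1 0 (vector [r, r]) (vector [- r, r])
    (r *\<^sub>R (axis (c 1) 1 + axis (c 2) 1)) (r *\<^sub>R (axis (c 1) 1 - axis (c 2) 1))"
proof -
  have "c 1 \<noteq> c 2"
    using assms by (simp add: inj_eq)
  then show ?thesis
    using r by (auto simp: mat_sum_eq_iff forall_2 e1_def e2_def A2_elt_def B2_elt_def X_elt_def Y_elt_def blk22_def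
        incl_mat_def S_mat_def J_mat_def mat_def matrix_matrix_mult_def transpose_def sum_2 frame_elt_def wedge_nth
        form2q_nth axis_def)
qed

lemma closure_orbit20:
  fixes c :: "2 \<Rightarrow> 'q::finite"
  assumes card: "CARD('q) \<ge> 3" and c: "inj c"
  shows "closure (orbit20 c) = range nil_section"
proof -
  define r where "r = 1 / sqrt 2"
  have r: "r * r = 1/2"
    by (simp add: r_def)
  let ?x1 = "vector [r, r] :: real^2" and ?x2 = "vector [- r, r] :: real^2"
  let ?y1 = "r *\<^sub>R (axis (c 1) 1 + axis (c 2) 1) :: real^'q" and ?y2 = "r *\<^sub>R (axis (c 1) 1 - axis (c 2) 1) :: real^'q"
  have "c 1 \<noteq> c 2"
    using c by (simp add: inj_eq)
  then have on: "orthonormal_pair ?x1 ?x2" "orthonormal_pair ?y1 ?y2"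
    using r by (simp_all add: orthonormal_pair_def inner_2 inner_add_left inner_add_right inner_diff_left
        inner_diff_right inner_axis_axis mult.assoc[symmetric])
  have C_eq: "closure (orbit20 c) = closure (adjoint_orbit (frame_elt 1 0 ?x1 ?x2 ?y1 ?y2))"
    by (simp only: orbit20_def e1_e2_eq_frame_elt[OF c r])
  have pos: "(1::real) * (?x1 $ 1 * ?x2 $ 2 - ?x2 $ 1 * ?x1 $ 2) > 0"
    using r by simp
  define C where "C = closure (orbit20 c)"
  note orbit = closure_orbit_frame[OF on _ pos card, of 0, folded C_eq C_def, simplified]
  interpret invariant_set C
    by (rule orbit)
  have "nil_section w \<in> C" for w
  proof -
    obtain s1 s2 x1 y1 y2 where fr: "x1 \<bullet> x1 = 1" "orthonormal_pair y1 y2" "\<bar>s2\<bar> \<le> s1"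
      "p_coord (frame_elt s1 s2 x1 (- (J_mat *v x1)) y1 y2) = w"
      by (rule ex_frame[OF card])
    let ?x2 = "- (J_mat *v x1)"
    have on': "orthonormal_pair x1 ?x2"
      using fr(1) by (simp add: orthonormal_pair_def J_mat_simps)
    have base: "frame_elt 1 0 x1 ?x2 y1 y2 \<in> C"
      using orbit(2) by (rule frame_change) (use on fr in auto)
    \<comment> \<open>For t > 0 the values satisfy |s2| < s1 + t, so a boost from (1, 0) followed by
      scaling with m = sqrt ((s1 + t)^2 - s2^2) reaches them; the case |s2| = s1 arises only in the
      limit t to 0.\<close>
    have "frame_elt s1 s2 x1 ?x2 y1 y2 + t *\<^sub>R frame_elt 1 0 x1 ?x2 y1 y2 \<in> C" if t: "t > 0" for t
    proof -
      define m where "m = sqrt ((s1 + t)\<^sup>2 - s2\<^sup>2)"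
      have "\<bar>s2\<bar>\<^sup>2 < (s1 + t)\<^sup>2"
        using fr(3) t by (intro power_strict_mono) auto
      then have m: "m > 0" "m\<^sup>2 = (s1 + t)\<^sup>2 - s2\<^sup>2"
        by (simp_all add: m_def)
      have "frame_elt ((s1 + t) / m) (s2 / m) x1 ?x2 y1 y2 \<in> C"
      proof (rule boost[OF base on' fr(2)])
        show "((s1 + t) / m)\<^sup>2 - (s2 / m)\<^sup>2 = 1"
        proof -
          have "((s1 + t) / m)\<^sup>2 - (s2 / m)\<^sup>2 = m\<^sup>2 / m\<^sup>2"
            unfolding m(2) by (simp only: power_divide diff_divide_distrib m(2))
          then show ?thesis
            using m(1) by simp
        qed
        show "(s1 + t) / m > 0"
          using m t fr(3) by simp
      qed
      from scale[OF this on' fr(2) m(1)] show ?thesis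
        using m(1) by (simp add: frame_elt_add)
    qed
    then have "frame_elt s1 s2 x1 ?x2 y1 y2 \<in> C"
      by (rule limit)
    then show ?thesis
      using fr(4) by (rule section_eqI)
  qed
  moreover have "M \<in> range nil_section" if "M \<in> C" for M
    using in_section[OF that] by blast
  ultimately show ?thesis
    unfolding C_def[symmetric] by blast
qed

lemma closure_orbit10:
  fixes c :: "2 \<Rightarrow> 'q::finite"
  assumes card: "CARD('q) \<ge> 3" and c: "inj c"
  shows "closure (orbit10 c) = nil_section ` quadric"
proof -
  let ?x1 = "axis 1 1 :: real^2" and ?x2 = "axis 2 1 :: real^2"
  let ?y1 = "axis (c 2) 1 :: real^'q" and ?y2 = "axis (c 1) 1 :: real^'q"
  have "c 1 \<noteq> c 2"
    using c by (simp add: inj_eq)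
  then have on: "orthonormal_pair ?x1 ?x2" "orthonormal_pair ?y1 ?y2"
    by (simp_all add: orthonormal_pair_def inner_axis_axis)
  have C_eq: "closure (orbit10 c) = closure (adjoint_orbit (frame_elt (1/2) (1/2) ?x1 ?x2 ?y1 ?y2))"
    by (simp only: orbit10_def e1_eq_frame_elt[OF c])
  have pos: "(1/2::real) * (?x1 $ 1 * ?x2 $ 2 - ?x2 $ 1 * ?x1 $ 2) > 0"
    by (simp add: axis_def)
  have s: "\<bar>1/2 :: real\<bar> \<le> 1/2"
    by simp
  define C where "C = closure (orbit10 c)"
  note orbit = closure_orbit_frame[OF on s pos card, folded C_eq C_def]
  interpret invariant_set C
    by (rule orbit)
  have "nil_section w \<in> C" if w: "w \<in> quadric" for w
  proof -
    obtain s y1 y2 where fr: "orthonormal_pair y1 y2" "0 \<le> s"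
      "p_coord (frame_elt s s (axis 1 1) (- (J_mat *v axis 1 1)) y1 y2) = w"
      by (rule ex_frame_quadric[OF card w])
    let ?x2' = "- (J_mat *v ?x1)"
    have on': "orthonormal_pair ?x1 ?x2'"
      by (simp add: orthonormal_pair_def J_mat_simps inner_axis_axis)
    have base: "frame_elt (1/2) (1/2) ?x1 ?x2' y1 y2 \<in> C"
      using orbit(2) by (rule frame_change) (use on fr in \<open>auto simp: inner_axis_axis\<close>)
    \<comment> \<open>Scaling from (1/2, 1/2) needs a positive factor, so s = 0 is reached only as t
      tends to 0.\<close>
    have "frame_elt s s ?x1 ?x2' y1 y2 + t *\<^sub>R frame_elt 1 1 ?x1 ?x2' y1 y2 \<in> C" if t: "t > 0" for t
    proof -
      have "2 * (s + t) * (1/2) = s + t"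
        by simp
      then show ?thesis
        using scale[OF base on' fr(1), of "2 * (s + t)"] t fr(2) by (simp only: frame_elt_add mult_1_right)
    qed
    then have "frame_elt s s ?x1 ?x2' y1 y2 \<in> C"
      by (rule limit)
    then show ?thesis
      using fr(3) by (rule section_eqI)
  qed
  moreover have "M \<in> nil_section ` quadric" if "M \<in> C" for M
    using in_section[OF that] orbit(3)[OF refl that] by blast
  ultimately show ?thesis
    unfolding C_def[symmetric] by blast
qed

section \<open>Coordinates and the structure sheaf\<close>

definition row_coord :: "complex^(2 + 'q::finite)^(2 + 'q) \<Rightarrow> complex^'q"
  where "row_coord W = (\<chi> j. W $ Inl 1 $ Inr j)"

definition p_plus_elt :: "complex^'q::finite \<Rightarrow> complex^(2 + 'q)^(2 + 'q)"
  where "p_plus_elt w = (let B = vector [w, \<i> *s w] in blk 0 B (transpose B) 0)"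

lemma row_coord_p_plus_elt [simp]: "row_coord (p_plus_elt w) = w"
  by (simp add: row_coord_def p_plus_elt_def Let_def vec_eq_iff)

lemma z_elt_nth:
  "(z_elt :: 'a::ring_1^(2 + 'q::finite)^(2 + 'q)) $ Inl 1 $ Inl 1 = 0"
  "(z_elt :: 'a^(2 + 'q)^(2 + 'q)) $ Inl 1 $ Inl 2 = 1"
  "(z_elt :: 'a^(2 + 'q)^(2 + 'q)) $ Inl 2 $ Inl 1 = - 1"
  "(z_elt :: 'a^(2 + 'q)^(2 + 'q)) $ Inl 2 $ Inl 2 = 0"
  "(z_elt :: 'a^(2 + 'q)^(2 + 'q)) $ Inl a $ Inr j = 0"
  "(z_elt :: 'a^(2 + 'q)^(2 + 'q)) $ Inr j $ i = 0"
  by (simp_all add: z_elt_def J_mat_def) (cases i; simp)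

lemma lie_bracket_z_elt:
  fixes W :: "'a::ring_1^(2 + 'q::finite)^(2 + 'q)"
  shows "lie_bracket z_elt W $ Inl 1 $ Inr j = W $ Inl 2 $ Inr j"
    "lie_bracket z_elt W $ Inl 2 $ Inr j = - W $ Inl 1 $ Inr j"
    "lie_bracket z_elt W $ Inr j $ Inl 1 = W $ Inr j $ Inl 2"
    "lie_bracket z_elt W $ Inr j $ Inl 2 = - W $ Inr j $ Inl 1"
    "lie_bracket z_elt W $ Inr i $ Inr j = 0"
    "(\<And>a b. W $ Inl a $ Inl b = 0) \<Longrightarrow> lie_bracket z_elt W $ Inl a' $ Inl b' = 0"
  by (simp_all add: lie_bracket_def matrix_matrix_mult_def sum_UNIV_sum sum_2 z_elt_nth)

lemma scale_mat_nth: "scale_mat c W $ i $ j = c * W $ i $ j"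
  by (simp add: scale_mat_def map_matrix_def)

lemma p_plus_elt_nth:
  "p_plus_elt w $ Inl 1 $ Inr j = w $ j" "p_plus_elt w $ Inl 2 $ Inr j = \<i> * w $ j"
  "p_plus_elt w $ Inr j $ Inl 1 = w $ j" "p_plus_elt w $ Inr j $ Inl 2 = \<i> * w $ j"
  "p_plus_elt w $ Inl a $ Inl b = 0" "p_plus_elt w $ Inr i $ Inr j = 0"
  by (simp_all add: p_plus_elt_def Let_def transpose_def)

text \<open>The eigenvalue equation J B = \<i> B says that the second row is \<i> times the first,
  so the first row can be chosen freely and determines the element.\<close>

lemma p_plus_eq: "(p_plus :: (complex^(2 + 'q::finite)^(2 + 'q)) set) = range p_plus_elt"
proof
  show "range p_plus_elt \<subseteq> (p_plus :: (complex^(2 + 'q)^(2 + 'q)) set)"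
  proof
    fix W :: "complex^(2 + 'q)^(2 + 'q)"
    assume "W \<in> range p_plus_elt"
    then obtain w where W: "W = p_plus_elt w" by blast
    have "W \<in> p_complex"
      unfolding W p_plus_elt_def p_complex_def Let_def by blast
    moreover have "lie_bracket z_elt W = scale_mat \<i> W"
      by (simp add: mat_sum_eq_iff forall_2 lie_bracket_z_elt scale_mat_nth W p_plus_elt_nth)
    ultimately show "W \<in> p_plus"
      by (simp add: p_plus_def)
  qed
  show "(p_plus :: (complex^(2 + 'q)^(2 + 'q)) set) \<subseteq> range p_plus_elt"
  proof
    fix W :: "complex^(2 + 'q)^(2 + 'q)"
    assume "W \<in> p_plus"
    then obtain B where W: "W = blk 0 B (transpose B) 0" and eq: "lie_bracket z_elt W = scale_mat \<i> W"
      by (auto simp: p_plus_def p_complex_def)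
    have "B $ 2 $ j = \<i> * B $ 1 $ j" for j
      using arg_cong[OF eq, of "\<lambda>M. M $ Inl 1 $ Inr j"]
      by (simp add: lie_bracket_z_elt scale_mat_nth) (simp add: W)
    then have "W = p_plus_elt (B $ 1)"
      by (simp add: mat_sum_eq_iff forall_2 p_plus_elt_nth W transpose_def)
    then show "W \<in> range p_plus_elt"
      by blast
  qed
qed

lemma proj_p_plus_nth:
  "proj_p_plus M $ Inl 1 $ Inr j = Complex (M $ Inl 1 $ Inr j) (- M $ Inl 2 $ Inr j)"
  "proj_p_plus M $ Inl 2 $ Inr j = Complex (M $ Inl 2 $ Inr j) (M $ Inl 1 $ Inr j)"
  "proj_p_plus M $ Inr j $ Inl 1 = Complex (M $ Inr j $ Inl 1) (- M $ Inr j $ Inl 2)"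
  "proj_p_plus M $ Inr j $ Inl 2 = Complex (M $ Inr j $ Inl 2) (M $ Inr j $ Inl 1)"
  "proj_p_plus M $ Inl a $ Inl b = 0" "proj_p_plus M $ Inr i $ Inr j = 0"
  by (simp_all add: proj_p_plus_def p_to_p_plus_def scale_mat_nth map_matrix_def lie_bracket_z_elt proj_p_def
      complex_eq_iff)

lemma row_coord_proj_p_plus: "row_coord (proj_p_plus M) = p_coord M"
  by (simp add: row_coord_def p_coord_def proj_p_plus_nth)

lemma proj_p_plus_nil_section: "proj_p_plus (nil_section w) = p_plus_elt w"
  by (simp add: mat_sum_eq_iff forall_2 proj_p_plus_nth p_plus_elt_nth)
    (simp add: nil_section_def transpose_def rows_mat_nth complex_eq_iff)

lemma row_coord_linear:
  "row_coord (V + W) = row_coord V + row_coord W" "row_coord (scale_mat c W) = c *s row_coord W"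
  "row_coord (r *\<^sub>R W) = r *\<^sub>R row_coord W"
  by (simp_all add: row_coord_def vec_eq_iff scale_mat_nth)

lemma p_plus_elt_linear:
  "p_plus_elt (v + w) = p_plus_elt v + p_plus_elt w" "p_plus_elt (r *\<^sub>R w) = r *\<^sub>R p_plus_elt w"
  "p_plus_elt (c *s w) = scale_mat c (p_plus_elt w)"
  by (simp_all add: mat_sum_eq_iff forall_2 p_plus_elt_nth scale_mat_nth algebra_simps)

lemma bounded_linear_row_coord: "bounded_linear row_coord"
  by (rule linear_conv_bounded_linear[THEN iffD1]) (rule linearI, simp_all add: row_coord_linear)

lemma bounded_linear_p_plus_elt: "bounded_linear p_plus_elt"
  by (rule linear_conv_bounded_linear[THEN iffD1]) (rule linearI, simp_all add: p_plus_elt_linear)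

lemma linear_coordinates_row_coord: "linear_coordinates row_coord"
  unfolding linear_coordinates_def
proof
  have "vector_space (scale_mat :: complex \<Rightarrow> complex^(2 + 'a)^(2 + 'a) \<Rightarrow> _)"
    by unfold_locales (simp_all add: vec_eq_iff scale_mat_nth algebra_simps)
  then show "Vector_Spaces.linear scale_mat (*s) (row_coord :: complex^(2 + 'a)^(2 + 'a) \<Rightarrow> _)"
    by (simp add: Vector_Spaces.linear_iff vec.vector_space_axioms row_coord_linear)
  show "bij_betw row_coord p_plus (UNIV :: (complex^'a) set)"
    by (rule bij_betw_byWitness[of _ p_plus_elt]) (auto simp: p_plus_eq)
qed

section \<open>Homeomorphisms and germs along the section\<close>

lemma continuous_on_p_coord: "continuous_on S p_coord"
  unfolding p_coord_def Complex_eq by (intro continuous_on_vec_lambda continuous_intros)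

lemma homeomorphism_section:
  "homeomorphism (nil_section ` T) T (row_coord \<circ> proj_p_plus) nil_section"
  by (rule homeomorphismI)
    (auto simp: row_coord_proj_p_plus o_def intro: continuous_on_p_coord continuous_on_nil_section)

lemma homeomorphism_section_p_plus:
  "homeomorphism (range nil_section) p_plus proj_p_plus (\<lambda>W. nil_section (row_coord W))"
proof (rule homeomorphismI)
  have "continuous_on (range nil_section) (\<lambda>M. p_plus_elt (p_coord M))"
    by (intro continuous_on_compose2[OF linear_continuous_on[OF bounded_linear_p_plus_elt]] continuous_on_p_coord) auto
  then show "continuous_on (range nil_section) proj_p_plus"
    by (rule continuous_on_eq) (auto simp: proj_p_plus_nil_section)
  show "continuous_on p_plus (\<lambda>W. nil_section (row_coord W))"
    by (intro continuous_on_compose2[OF continuous_on_nil_section] linear_continuous_on bounded_linear_row_coord) auto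
qed (auto simp: proj_p_plus_nil_section p_plus_eq)

text \<open>\<open>nil_section\<close> and \<open>p_coord\<close> are continuous and inverse to each
  other along the section, so neighbourhoods in its image and in T correspond.\<close>

lemma eventually_nhds_in_section:
  "(\<forall>\<^sub>F y in nhds_in (nil_section ` T) (nil_section p). P y) \<longleftrightarrow> (\<forall>\<^sub>F w in nhds_in T p. P (nil_section w))"
proof
  assume "\<forall>\<^sub>F y in nhds_in (nil_section ` T) (nil_section p). P y"
  then have ev: "\<forall>\<^sub>F y in nhds (nil_section p). y \<in> nil_section ` T \<longrightarrow> P y"
    by (simp only: eventually_nhds_in)
  have "isCont nil_section p"
    by (rule continuous_on_interior[OF continuous_on_nil_section[where S = UNIV]]) simp
  then have "filterlim nil_section (nhds (nil_section p)) (nhds p)"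
    by (simp only: isCont_def tendsto_at_iff_tendsto_nhds)
  from eventually_compose_filterlim[OF ev this]
  show "\<forall>\<^sub>F w in nhds_in T p. P (nil_section w)"
    unfolding eventually_nhds_in by eventually_elim auto
next
  assume "\<forall>\<^sub>F w in nhds_in T p. P (nil_section w)"
  then have ev: "\<forall>\<^sub>F w in nhds p. w \<in> T \<longrightarrow> P (nil_section w)"
    by (simp only: eventually_nhds_in)
  have "isCont p_coord (nil_section p)"
    by (rule continuous_on_interior[OF continuous_on_p_coord[where S = UNIV]]) simp
  then have "filterlim p_coord (nhds (p_coord (nil_section p))) (nhds (nil_section p))"
    by (simp only: isCont_def tendsto_at_iff_tendsto_nhds)
  then have "filterlim p_coord (nhds p) (nhds (nil_section p))"
    by simp
  from eventually_compose_filterlim[OF ev this]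
  show "\<forall>\<^sub>F y in nhds_in (nil_section ` T) (nil_section p). P y"
    unfolding eventually_nhds_in by eventually_elim auto
qed

text \<open>The range of \<open>p_plus_elt\<close> is \<open>p_plus\<close>, so composing with it
  turns a derivative within the subspace into an unrestricted one on C^q.\<close>

lemma holomorphic_near_imp_cdiff_near:
  assumes "holomorphic_near F (p_plus_elt p)"
  shows "cdiff_near (\<lambda>w. F (p_plus_elt w)) p"
proof -
  have ev: "\<forall>\<^sub>F v in nhds (p_plus_elt p). v \<in> p_plus \<longrightarrow> complex_differentiable_within scale_mat (*) F p_plus v"
    using assms by (simp add: holomorphic_near_def eventually_nhds_in)
  have "isCont p_plus_elt p"
    using linear_continuous_at[OF bounded_linear_p_plus_elt] .
  then have "filterlim p_plus_elt (nhds (p_plus_elt p)) (nhds p)"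
    by (simp only: isCont_def tendsto_at_iff_tendsto_nhds)
  from eventually_compose_filterlim[OF ev this] show ?thesis
  proof eventually_elim
    case (elim w)
    then obtain D where D: "(F has_derivative D) (at (p_plus_elt w) within p_plus)"
      "\<And>v. v \<in> p_plus \<Longrightarrow> D (scale_mat \<i> v) = \<i> * D v"
      by (auto simp: complex_differentiable_within_def p_plus_eq)
    have "(p_plus_elt has_derivative p_plus_elt) (at w)"
      by (rule bounded_linear_imp_has_derivative[OF bounded_linear_p_plus_elt])
    from has_derivative_in_compose[OF this D(1)[unfolded p_plus_eq]]
    have "((\<lambda>w. F (p_plus_elt w)) has_derivative (\<lambda>v. D (p_plus_elt v))) (at w)" .
    then show ?case
      unfolding cdiff_def using D(2)
      by (intro exI[of _ "\<lambda>v. D (p_plus_elt v)"]) (auto simp: p_plus_elt_linear p_plus_eq)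
  qed
qed

lemma cdiff_near_imp_holomorphic_near:
  assumes "cdiff_near F p"
  shows "holomorphic_near (\<lambda>W. F (row_coord W)) (p_plus_elt p)"
proof -
  have "isCont row_coord (p_plus_elt p)"
    using linear_continuous_at[OF bounded_linear_row_coord] .
  then have "filterlim row_coord (nhds (row_coord (p_plus_elt p))) (nhds (p_plus_elt p))"
    by (simp only: isCont_def tendsto_at_iff_tendsto_nhds)
  then have "filterlim row_coord (nhds p) (nhds (p_plus_elt p))"
    by simp
  from eventually_compose_filterlim[OF assms this]
  show ?thesis
    unfolding holomorphic_near_def eventually_nhds_in
  proof eventually_elim
    case (elim W)
    then obtain D where D: "(F has_derivative D) (at (row_coord W))" "\<And>v. D (\<i> *s v) = \<i> * D v"
      by (auto simp: cdiff_def)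
    have "(row_coord has_derivative row_coord) (at W)"
      by (rule bounded_linear_imp_has_derivative[OF bounded_linear_row_coord])
    from has_derivative_compose[OF this D(1)]
    have "((\<lambda>W. F (row_coord W)) has_derivative (\<lambda>V. D (row_coord V))) (at W within p_plus)"
      by (rule has_derivative_at_withinI)
    then show ?case
      unfolding complex_differentiable_within_def using D(2)
      by (intro impI exI[of _ "\<lambda>V. D (row_coord V)"]) (simp add: row_coord_linear)
  qed
qed

text \<open>Read through \<open>nil_section\<close>, the elements of the stalk are germs on T of
  holomorphic functions on C^q, so the two clauses of \<open>germs_divisible\<close> supply
  \<open>dom\<close> and \<open>divide\<close> of \<open>normal_germ_ring\<close>; boundedness comes
  from continuity at p.\<close>

lemma normal_stalk:
  fixes p :: "complex^'q::finite"
  assumes p: "p \<in> T" and div: "germs_divisible T p"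
  shows "normal_ring (analytic_stalk (nil_section ` T) (nil_section p))"
proof -
  let ?Z = "nil_section ` T" and ?x = "nil_section p"
  define Fs where "Fs = {f. \<exists>F. cdiff_near F p \<and> (\<forall>\<^sub>F w in nhds_in T p. f (nil_section w) = F w)}"
  have Fs: "{f. \<exists>F. holomorphic_near F (proj_p_plus ?x) \<and>
      (\<forall>\<^sub>F y in nhds_in ?Z ?x. f y = F (proj_p_plus y))} = Fs"
    unfolding Fs_def proj_p_plus_nil_section eventually_nhds_in_section
  proof (intro Collect_cong iffI; elim exE conjE)
    fix f F
    assume "holomorphic_near F (p_plus_elt p)" "\<forall>\<^sub>F w in nhds_in T p. f (nil_section w) = F (p_plus_elt w)"
    then show "\<exists>F. cdiff_near F p \<and> (\<forall>\<^sub>F w in nhds_in T p. f (nil_section w) = F w)"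
      using holomorphic_near_imp_cdiff_near by blast
  next
    fix f F
    assume "cdiff_near F p" "\<forall>\<^sub>F w in nhds_in T p. f (nil_section w) = F w"
    then show "\<exists>F. holomorphic_near F (p_plus_elt p) \<and> (\<forall>\<^sub>F w in nhds_in T p. f (nil_section w) = F (p_plus_elt w))"
      using cdiff_near_imp_holomorphic_near by (intro exI[of _ "\<lambda>W. F (row_coord W)"]) simp
  qed
  have "normal_ring (germ_ring (nhds_in ?Z ?x) Fs)"
  proof (rule normal_germ_ring; (unfold eventually_nhds_in_section)?)
    show "(\<lambda>_. c) \<in> Fs" for c
      unfolding Fs_def by (intro CollectI exI[of _ "\<lambda>_. c"] conjI cdiff_near_const) simp
    show "(\<lambda>y. f y + g y) \<in> Fs" if fg: "f \<in> Fs" "g \<in> Fs" for f g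
    proof -
      obtain F G where FG: "cdiff_near F p" "cdiff_near G p"
        "\<forall>\<^sub>F w in nhds_in T p. f (nil_section w) = F w" "\<forall>\<^sub>F w in nhds_in T p. g (nil_section w) = G w"
        using fg by (auto simp: Fs_def)
      have "\<forall>\<^sub>F w in nhds_in T p. f (nil_section w) + g (nil_section w) = F w + G w"
        using FG(3,4) by eventually_elim simp
      then show ?thesis
        unfolding Fs_def using cdiff_near_add[OF FG(1,2)] by blast
    qed
    show "(\<lambda>y. f y * g y) \<in> Fs" if fg: "f \<in> Fs" "g \<in> Fs" for f g
    proof -
      obtain F G where FG: "cdiff_near F p" "cdiff_near G p"
        "\<forall>\<^sub>F w in nhds_in T p. f (nil_section w) = F w" "\<forall>\<^sub>F w in nhds_in T p. g (nil_section w) = G w"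
        using fg by (auto simp: Fs_def)
      have "\<forall>\<^sub>F w in nhds_in T p. f (nil_section w) * g (nil_section w) = F w * G w"
        using FG(3,4) by eventually_elim simp
      then show ?thesis
        unfolding Fs_def using cdiff_near_mult[OF FG(1,2)] by blast
    qed
    show "\<exists>C. \<forall>\<^sub>F w in nhds_in T p. norm (f (nil_section w)) \<le> C" if f: "f \<in> Fs" for f
    proof -
      obtain F where F: "cdiff_near F p" "\<forall>\<^sub>F w in nhds_in T p. f (nil_section w) = F w"
        using f by (auto simp: Fs_def)
      have "filterlim F (nhds (F p)) (nhds p)"
        using cdiff_near_imp_isCont[OF F(1)] by (simp only: isCont_def tendsto_at_iff_tendsto_nhds)
      then have "\<forall>\<^sub>F w in nhds p. dist (F w) (F p) < 1"
        by (rule tendstoD) simp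
      then have "\<forall>\<^sub>F w in nhds_in T p. dist (F w) (F p) < 1"
        unfolding eventually_nhds_in by eventually_elim simp
      with F(2) have "\<forall>\<^sub>F w in nhds_in T p. norm (f (nil_section w)) \<le> norm (F p) + 1"
      proof eventually_elim
        case (elim w)
        then show ?case
          using norm_triangle_sub[of "F w" "F p"] by (simp add: dist_norm)
      qed
      then show ?thesis ..
    qed
    show "nhds_in ?Z ?x \<noteq> bot"
    proof
      assume "nhds_in ?Z ?x = bot"
      then have "\<forall>\<^sub>F y in nhds_in ?Z ?x. False"
        by simp
      then have "\<forall>\<^sub>F w in nhds p. w \<in> T \<longrightarrow> False"
        by (simp only: eventually_nhds_in_section) (simp only: eventually_nhds_in)
      then show False
        using eventually_nhds_x_imp_x p by blast
    qed
    show "(\<forall>\<^sub>F w in nhds_in T p. f (nil_section w) = 0) \<or> (\<forall>\<^sub>F w in nhds_in T p. g (nil_section w) = 0)"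
      if fg: "f \<in> Fs" "g \<in> Fs" and zero: "\<forall>\<^sub>F w in nhds_in T p. f (nil_section w) * g (nil_section w) = 0" for f g
    proof -
      obtain F G where FG: "cdiff_near F p" "cdiff_near G p"
        "\<forall>\<^sub>F w in nhds_in T p. f (nil_section w) = F w" "\<forall>\<^sub>F w in nhds_in T p. g (nil_section w) = G w"
        using fg by (auto simp: Fs_def)
      have "\<forall>\<^sub>F w in nhds_in T p. F w * G w = 0"
        using zero FG(3,4) by eventually_elim simp
      then have "(\<forall>\<^sub>F w in nhds_in T p. F w = 0) \<or> (\<forall>\<^sub>F w in nhds_in T p. G w = 0)"
        using div FG(1,2) unfolding germs_divisible_def by blast
      then show ?thesis
      proof
        assume "\<forall>\<^sub>F w in nhds_in T p. F w = 0"
        with FG(3) have "\<forall>\<^sub>F w in nhds_in T p. f (nil_section w) = 0"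
          by eventually_elim simp
        then show ?thesis ..
      next
        assume "\<forall>\<^sub>F w in nhds_in T p. G w = 0"
        with FG(4) have "\<forall>\<^sub>F w in nhds_in T p. g (nil_section w) = 0"
          by eventually_elim simp
        then show ?thesis ..
      qed
    qed
    show "\<exists>h\<in>Fs. \<forall>\<^sub>F w in nhds_in T p. f (nil_section w) = h (nil_section w) * g (nil_section w)"
      if fg: "f \<in> Fs" "g \<in> Fs"
        and le: "\<forall>\<^sub>F w in nhds_in T p. norm (f (nil_section w)) \<le> C * norm (g (nil_section w))"
        and g0: "\<not> (\<forall>\<^sub>F w in nhds_in T p. g (nil_section w) = 0)" for f g C
    proof -
      obtain F G where FG: "cdiff_near F p" "cdiff_near G p"
        "\<forall>\<^sub>F w in nhds_in T p. f (nil_section w) = F w" "\<forall>\<^sub>F w in nhds_in T p. g (nil_section w) = G w"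
        using fg by (auto simp: Fs_def)
      have "\<forall>\<^sub>F w in nhds_in T p. norm (F w) \<le> C * norm (G w)"
        using le FG(3,4) by eventually_elim simp
      moreover have "\<not> (\<forall>\<^sub>F w in nhds_in T p. G w = 0)"
      proof
        assume "\<forall>\<^sub>F w in nhds_in T p. G w = 0"
        with FG(4) have "\<forall>\<^sub>F w in nhds_in T p. g (nil_section w) = 0"
          by eventually_elim simp
        with g0 show False ..
      qed
      ultimately obtain H where H: "cdiff_near H p" "\<forall>\<^sub>F w in nhds_in T p. F w = H w * G w"
        using div FG(1,2) unfolding germs_divisible_def by blast
      have "(\<lambda>y. H (p_coord y)) \<in> Fs"
        unfolding Fs_def using H(1) by auto
      moreover have "\<forall>\<^sub>F w in nhds_in T p. f (nil_section w) = H (p_coord (nil_section w)) * g (nil_section w)"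
        using H(2) FG(3,4) by eventually_elim simp
      ultimately show ?thesis
        by (intro bexI[of _ "\<lambda>y. H (p_coord y)"])
    qed
  qed
  then show ?thesis
    unfolding analytic_stalk_def Fs .
qed

theorem theorem3p6p3:
  fixes c :: "2 \<Rightarrow> 'q::finite"
  assumes "CARD('q) \<ge> 3" and "inj c"
  shows "(\<exists>r. homeomorphism (closure (orbit20 c)) p_plus proj_p_plus r)
    \<and> (\<exists>w. linear_coordinates w
          \<and> (\<exists>r. homeomorphism (closure (orbit10 c)) quadric (w \<circ> proj_p_plus) r))
    \<and> (\<forall>w \<in> (quadric :: (complex^'q) set) - {0}. smooth_hypersurface_at quadric w)
    \<and> normal_analytic (closure (orbit10 c))
    \<and> normal_analytic (closure (orbit20 c))"
  unfolding closure_orbit10[OF assms] closure_orbit20[OF assms]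
proof (intro conjI)
  show "\<exists>r. homeomorphism (range nil_section :: (real^(2 + 'q)^(2 + 'q)) set) p_plus proj_p_plus r"
    using homeomorphism_section_p_plus by blast
  show "\<exists>w. linear_coordinates w \<and>
      (\<exists>r. homeomorphism (nil_section ` (quadric :: (complex^'q) set)) quadric (w \<circ> proj_p_plus) r)"
    using linear_coordinates_row_coord homeomorphism_section by blast
  show "\<forall>w \<in> (quadric :: (complex^'q) set) - {0}. smooth_hypersurface_at quadric w"
    using smooth_hypersurface_quadric by blast
  show "normal_analytic (nil_section ` (quadric :: (complex^'q) set))"
    unfolding normal_analytic_def using normal_stalk germs_divisible_quadric[OF assms(1)] by blast
  show "normal_analytic (range nil_section :: (real^(2 + 'q)^(2 + 'q)) set)"
    unfolding normal_analytic_def using normal_stalk[OF UNIV_I germs_divisible_UNIV] by blast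
qed

end
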